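(* Let $0<\gamma\leq 1$, $1<q\leq\alpha<p\leq\infty$ and $w\in\mathcal A_{q}$. If $\lambda>\max\{q,3\}$, then there exists a constant $C>0$ such that $$\left\|g^{\ast}_{\lambda,\gamma}(f)\right\|_{q_{w},p,\alpha}\leq C\left\|f\right\|_{q_{w},p,\alpha}$$ for all $f\in (L^{q}_{w},L^{p})^{\alpha}(\mathbb R^{n})$.
   Context: A weight $w$ on $\mathbb R^n$ is a positive locally integrable function on $\mathbb R^{n}$, and $w(E)=\int_{E}w(x)\,dx$. $B(y,r)$ is the open ball of $\mathbb R^n$ centered at $y$ with radius $r$, and $|E|$ is the Lebesgue measure of $E$. For $1<q<\infty$, $w\in\mathcal A_{q}$ means that there is a constant $C>0$ such that for all balls $B\subset\mathbb R^{n}$, $$\left(\frac{1}{|B|}\int_{B}w(x)\,dx\right)\left(\frac{1}{|B|}\int_{B}w(x)^{\frac{-1}{q-1}}\,dx\right)^{q-1}\leq C.$$ Put $\|f\|_{q_{w}}=\left(\int_{\mathbb R^{n}}|f(x)|^{q}w(x)\,dx\right)^{1/q}$. For $1\leq q\leq\alpha\leq p\leq\infty$, with the convention $\frac1\infty=0$, the space $(L^{q}_{w},L^{p})^{\alpha}(\mathbb R^{n})$ consists of the measurable functions $f$ on $\mathbb R^n$ such that $\|f\|_{q_{w},p,\alpha}<\infty$, where $$\|f\|_{q_{w},p,\alpha}:=\sup_{r>0}\left[\int_{\mathbb R^{n}}\left(w(B(y,r))^{\frac{1}{\alpha}-\frac{1}{q}-\frac{1}{p}}\left\|f\chi_{B(y,r)}\right\|_{q_{w}}\right)^{p}dy\right]^{\frac{1}{p}},$$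 with the usual modification (essential supremum over $y\in\mathbb R^n$) when $p=\infty$; $\chi_E$ is the characteristic function of $E$. For $0<\gamma\leq 1$, $\mathcal C_{\gamma}$ is the family of functions $\varphi$ defined on $\mathbb R^{n}$ with support in the closed unit ball $\{x\in\mathbb R^n:|x|\leq 1\}$, with $\int_{\mathbb R^{n}}\varphi(x)\,dx=0$, and such that $|\varphi(x)-\varphi(x')|\leq|x-x'|^{\gamma}$ for all $x,x'\in\mathbb R^{n}$. Put $\varphi_{t}(x)=t^{-n}\varphi(t^{-1}x)$ for $t>0$, and $\mathbb R^{n+1}_{+}=\mathbb R^{n}\times(0,\infty)$. The intrinsic Littlewood-Paley $g^{\ast}_{\lambda}$-function is $$g^{\ast}_{\lambda,\gamma}(f)(x)=\left[\int_{\mathbb R^{n+1}_{+}}\left(\frac{t}{t+|x-y|}\right)^{\lambda n}\left(\sup_{\varphi\in\mathcal C_{\gamma}}|f\ast\varphi_{t}(y)|\right)^{2}\frac{dy\,dt}{t^{n+1}}\right]^{\frac{1}{2}}.$$ *)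

theory Defs
  imports "HOL-Analysis.Analysis" "HOL-Probability.Essential_Supremum"
begin

text \<open>
  \<open>\<real>\<^sup>n\<close> is the type \<open>real ^ 'n\<close> with \<open>n = CARD('n)\<close>.  Norms, suprema and integrals of nonnegative
  functions take values in \<open>ennreal\<close>, so that infinite values are not lost; the mixed norm below
  therefore takes a nonnegative function \<open>u\<close>, which stands for \<open>\<bar>f\<bar>\<close>.
\<close>

text \<open>Real powers on \<open>[0,\<infinity>]\<close>; only used with exponents \<open>a > 0\<close>, where \<open>\<infinity>\<close> to the power \<open>a\<close> is \<open>\<infinity>\<close>.\<close>

definition ennreal_powr :: "ennreal \<Rightarrow> real \<Rightarrow> ennreal" where
  "ennreal_powr x a = (if x = \<infinity> then \<infinity> else ennreal (enn2real x powr a))"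

definition weight :: "(real ^ 'n \<Rightarrow> real) \<Rightarrow> bool" where
  "weight w \<longleftrightarrow> (\<forall>x. 0 < w x) \<and> w \<in> borel_measurable lebesgue \<and>
     (\<forall>K. compact K \<longrightarrow> set_integrable lebesgue K w)"

text \<open>\<open>w(E)\<close>, finite for bounded measurable \<open>E\<close>; it is only used for balls.\<close>

definition wmeas :: "(real ^ 'n \<Rightarrow> real) \<Rightarrow> (real ^ 'n) set \<Rightarrow> real" where
  "wmeas w E = (LINT x:E|lebesgue. w x)"

text \<open>The integrals are taken in \<open>[0,\<infinity>]\<close>: finiteness of the second one is part of the condition.\<close>

definition Muckenhoupt :: "real \<Rightarrow> (real ^ 'n \<Rightarrow> real) \<Rightarrow> bool" where
  "Muckenhoupt q w \<longleftrightarrow> weight w \<and>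
     (\<exists>C::real. C > 0 \<and> (\<forall>y r. r > 0 \<longrightarrow>
        ((\<integral>\<^sup>+x\<in>ball y r. ennreal (w x) \<partial>lebesgue) / emeasure lebesgue (ball y r)) *
        ennreal_powr
          ((\<integral>\<^sup>+x\<in>ball y r. ennreal (w x powr (- 1 / (q - 1))) \<partial>lebesgue)
             / emeasure lebesgue (ball y r)) (q - 1)
        \<le> ennreal C))"

definition weighted_Lq_norm ::
    "(real ^ 'n \<Rightarrow> real) \<Rightarrow> real \<Rightarrow> (real ^ 'n \<Rightarrow> ennreal) \<Rightarrow> ennreal" where
  "weighted_Lq_norm w q u =
     ennreal_powr (\<integral>\<^sup>+x. ennreal_powr (u x) q * ennreal (w x) \<partial>lebesgue) (1 / q)"

definition Lp_norm :: "ennreal \<Rightarrow> (real ^ 'n \<Rightarrow> ennreal) \<Rightarrow> ennreal" where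
  "Lp_norm p F =
     (if p = \<infinity> then esssup lebesgue F
      else ennreal_powr (\<integral>\<^sup>+y. ennreal_powr (F y) (enn2real p) \<partial>lebesgue) (1 / enn2real p))"

text \<open>In \<open>ennreal\<close>, \<open>1 / \<infinity> = 0\<close>.\<close>

definition mixed_norm ::
    "(real ^ 'n \<Rightarrow> real) \<Rightarrow> real \<Rightarrow> ennreal \<Rightarrow> real \<Rightarrow> (real ^ 'n \<Rightarrow> ennreal) \<Rightarrow> ennreal" where
  "mixed_norm w q p \<alpha> u =
     (SUP r\<in>{0<..}. Lp_norm p (\<lambda>y.
        ennreal (wmeas w (ball y r) powr (1 / \<alpha> - 1 / q - enn2real (1 / p))) *
        weighted_Lq_norm w q (\<lambda>x. u x * indicator (ball y r) x)))"

definition mixed_space ::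
    "(real ^ 'n \<Rightarrow> real) \<Rightarrow> real \<Rightarrow> ennreal \<Rightarrow> real \<Rightarrow> (real ^ 'n \<Rightarrow> complex) set" where
  "mixed_space w q p \<alpha> =
     {f. f \<in> borel_measurable lebesgue \<and> mixed_norm w q p \<alpha> (\<lambda>x. ennreal (norm (f x))) < \<infinity>}"

definition Cfam :: "real \<Rightarrow> (real ^ 'n \<Rightarrow> complex) set" where
  "Cfam \<gamma> = {\<phi>. closure {x. \<phi> x \<noteq> 0} \<subseteq> cball 0 1 \<and> (LINT x|lebesgue. \<phi> x) = 0 \<and>
     (\<forall>x x'. norm (\<phi> x - \<phi> x') \<le> norm (x - x') powr \<gamma>)}"

definition dilate :: "real \<Rightarrow> (real ^ 'n \<Rightarrow> complex) \<Rightarrow> real ^ 'n \<Rightarrow> complex" where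
  "dilate t \<phi> x = of_real (1 / t ^ CARD('n)) * \<phi> ((1 / t) *\<^sub>R x)"

definition conv :: "(real ^ 'n \<Rightarrow> complex) \<Rightarrow> (real ^ 'n \<Rightarrow> complex) \<Rightarrow> real ^ 'n \<Rightarrow> complex" where
  "conv f g y = (LINT z|lebesgue. f z * g (y - z))"

definition gstar :: "real \<Rightarrow> real \<Rightarrow> (real ^ 'n \<Rightarrow> complex) \<Rightarrow> real ^ 'n \<Rightarrow> ennreal" where
  "gstar lam \<gamma> f x =
     ennreal_powr
       (\<integral>\<^sup>+(y, t)\<in>UNIV \<times> {0<..}.
          ennreal ((t / (t + norm (x - y))) powr (lam * CARD('n))) *
          (SUP \<phi>\<in>Cfam \<gamma>. ennreal (norm (conv f (dilate t \<phi>) y))) ^ 2 *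
          ennreal (1 / t ^ (CARD('n) + 1)) \<partial>lebesgue)
       (1 / 2)"

end

theory Submission
  imports Defs
begin

text \<open>
  The proof reduces the mixed norm estimate to an estimate on a single ball, and this in turn to a boundedness
  result on \<open>L\<^sup>q(w)\<close> for a discrete square function.

  Discretization. The half space is cut into the pieces \<open>cube j m \<times> (2\<^sup>j / 2, 2\<^sup>j]\<close>. On such a piece every
  convolution with a dilated \<open>\<phi>\<close> is, up to a constant, the pairing of \<open>f\<close> with a mean-zero Hoelder
  kernel adapted to the cube, and \<open>t / (t + \<bar>x - y\<bar>)\<close> is about \<open>2\<^sup>j / 2\<^sup>k\<close>, where
  \<open>k \<ge> j\<close> is the first scale at which \<open>x\<close> and \<open>y\<close> lie in neighbouring cubes. So the square of the function is at most a sum over \<open>k\<close> of quantities that depend only on the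
  cube of \<open>x\<close> at scale \<open>k\<close> (\<open>gstar_le_levels\<close>): weighted sums, with weights \<open>2 powr (lam n (j - k))\<close>, of squared
  pairings with the kernels of the cubes of scale \<open>j \<le> k\<close> close to that cube. For integrable \<open>f\<close>, near-extremal
  kernels replace the supremum over all kernels by one kernel for each cube (\<open>kernel_choice\<close>).

  Boundedness on \<open>L\<^sup>q(w)\<close> (\<open>square_bounded\<close>). Where the averages of \<open>\<bar>f\<bar>\<close> are at most \<open>a\<close>, the integral of the
  square function up to scale \<open>K\<close> over a cube of that scale is at most a constant times \<open>a\<^sup>2\<close> times its volume
  (\<open>local_estimate\<close>). This follows from a Calderon-Zygmund decomposition along Whitney cubes: the flat part is in
  \<open>L\<^sup>2\<close> and is handled by almost orthogonality of the kernels (\<open>bessel\<close>); the bad parts are handled by their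
  cancellation against kernels of larger scale, and by the decay of the weights, with \<open>lam > 2\<close>, against kernels of
  smaller scale. The local estimate gives a good-\<open>\<lambda>\<close> inequality that compares the square function with the maximal
  function of \<open>f\<close>, first for Lebesgue measure and then for \<open>w\<close>, since a subset of a cube with at most half of its
  volume has at most the fraction \<open>\<theta> < 1\<close> of its weight (\<open>half_measure\<close>). The maximal function is bounded on
  \<open>L\<^sup>q(w)\<close> (\<open>maximal_bounded\<close>).

  Mixed norms. On a ball of radius \<open>r\<close> the scales up to about \<open>r\<close> see \<open>f\<close> only on a fixed dilate of the ball, so
  the bound on \<open>L\<^sup>q(w)\<close> applies; the larger scales are bounded by averages of \<open>\<bar>f\<bar>\<close> over the balls of radius
  \<open>8 n 2\<^sup>i r\<close>. Normalized as in the mixed norm, the \<open>i\<close>-th of these is damped by the power \<open>1/\<alpha> - 1/p > 0\<close> of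
  the ratio of the weights of the balls, which decays geometrically in \<open>i\<close> by \<open>ball_reverse_doubling\<close>. Summing the
  series in the \<open>p\<close>-norm (\<open>Lp_norm_geometric\<close>) bounds the norm at radius \<open>r\<close> by the supremum over all radii.
\<close>

section \<open>Powers of extended nonnegative reals\<close>

lemma ennreal_powr_ennreal: "0 \<le> r \<Longrightarrow> ennreal_powr (ennreal r) a = ennreal (r powr a)"
  by (simp add: ennreal_powr_def)

lemma ennreal_powr_top [simp]: "ennreal_powr top a = top"
  by (simp add: ennreal_powr_def)

lemma ennreal_powr_0 [simp]: "ennreal_powr 0 a = 0"
  by (simp add: ennreal_powr_def)

lemma ennreal_powr_1 [simp]: "ennreal_powr 1 a = 1"
  by (simp add: ennreal_powr_def)

lemma ennreal_powr_mono:
  assumes "x \<le> y" "0 \<le> a" shows "ennreal_powr x a \<le> ennreal_powr y a"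
proof (cases "y = top")
  case False
  then have "x \<noteq> top" using assms(1) top_unique by auto
  with False assms show ?thesis
    by (cases x; cases y) (auto simp: ennreal_powr_ennreal intro!: ennreal_leI powr_mono2)
qed simp

lemma ennreal_powr_mult:
  assumes "0 < a" shows "ennreal_powr (x * y) a = ennreal_powr x a * ennreal_powr y a"
proof (cases x; cases y)
  fix r s :: real assume *: "0 \<le> r" "x = ennreal r" "0 \<le> s" "y = ennreal s"
  then have "x * y = ennreal (r * s)" by (simp add: ennreal_mult)
  then have "ennreal_powr (x * y) a = ennreal ((r * s) powr a)"
    using * by (simp add: ennreal_powr_ennreal)
  with * show ?thesis by (simp add: ennreal_powr_ennreal powr_mult ennreal_mult)
next
  fix r :: real assume "0 \<le> r" "x = ennreal r" "y = top"
  then show ?thesis using assms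
    by (cases "r = 0") (auto simp: ennreal_mult_top ennreal_powr_ennreal)
next
  fix r :: real assume "0 \<le> r" "y = ennreal r" "x = top"
  then show ?thesis using assms
    by (cases "r = 0") (auto simp: ennreal_top_mult ennreal_powr_ennreal)
next
  assume "x = top" "y = top" then show ?thesis by simp
qed

lemma ennreal_powr_powr: "ennreal_powr (ennreal_powr x a) b = ennreal_powr x (a * b)"
  by (cases x) (auto simp: ennreal_powr_ennreal powr_powr)

lemma ennreal_powr_one [simp]: "ennreal_powr x 1 = x"
  by (cases x) (auto simp: ennreal_powr_ennreal)

lemma ennreal_powr_two: "ennreal_powr x 2 = x ^ 2"
proof (cases x)
  case (real r)
  then show ?thesis by (simp add: ennreal_powr_ennreal ennreal_power)
qed (simp add: power2_eq_square)

lemma ennreal_powr_half_square [simp]: "ennreal_powr (x ^ 2) (1 / 2) = x"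
  by (simp flip: ennreal_powr_two add: ennreal_powr_powr)

lemma ennreal_powr_le_iff:
  assumes "0 < a" shows "ennreal_powr x a \<le> y \<longleftrightarrow> x \<le> ennreal_powr y (1 / a)"
proof
  assume "ennreal_powr x a \<le> y"
  then have "ennreal_powr (ennreal_powr x a) (1 / a) \<le> ennreal_powr y (1 / a)"
    using assms by (intro ennreal_powr_mono) auto
  then show "x \<le> ennreal_powr y (1 / a)" using assms by (simp add: ennreal_powr_powr)
next
  assume "x \<le> ennreal_powr y (1 / a)"
  then have "ennreal_powr x a \<le> ennreal_powr (ennreal_powr y (1 / a)) a"
    using assms by (intro ennreal_powr_mono) auto
  then show "ennreal_powr x a \<le> y" using assms by (simp add: ennreal_powr_powr)
qed

lemma ennreal_powr_eq_0_iff: "0 < a \<Longrightarrow> ennreal_powr x a = 0 \<longleftrightarrow> x = 0"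
  using ennreal_powr_le_iff[of a x 0] by auto

lemma ennreal_powr_eq_top_iff [simp]: "ennreal_powr x a = top \<longleftrightarrow> x = top"
  by (auto simp: ennreal_powr_def)

lemma ennreal_powr_SUP:
  assumes "0 < a" shows "ennreal_powr (SUP i\<in>A. u i) a = (SUP i\<in>A. ennreal_powr (u i) a)"
proof (rule antisym)
  show "ennreal_powr (SUP i\<in>A. u i) a \<le> (SUP i\<in>A. ennreal_powr (u i) a)"
    unfolding ennreal_powr_le_iff[OF assms]
    by (rule SUP_least) (auto simp flip: ennreal_powr_le_iff[OF assms] intro: SUP_upper)
  show "(SUP i\<in>A. ennreal_powr (u i) a) \<le> ennreal_powr (SUP i\<in>A. u i) a"
    using assms by (intro SUP_least ennreal_powr_mono SUP_upper) auto
qed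

lemma ennreal_powr_add_le:
  assumes "0 < a"
  shows "ennreal_powr (x + y) a \<le> ennreal (2 powr a) * (ennreal_powr x a + ennreal_powr y a)"
proof -
  have "x + y \<le> ennreal 2 * max x y"
    by (metis add_mono ennreal_numeral max.cobounded1 max.cobounded2 mult_2 zero_le_numeral)
  then have "ennreal_powr (x + y) a \<le> ennreal_powr (ennreal 2 * max x y) a"
    using assms by (intro ennreal_powr_mono) auto
  also have "\<dots> = ennreal (2 powr a) * ennreal_powr (max x y) a"
    using assms by (subst ennreal_powr_mult) (auto simp: ennreal_powr_ennreal simp del: ennreal_numeral)
  also have "ennreal_powr (max x y) a \<le> ennreal_powr x a + ennreal_powr y a"
    by (auto simp: max_def)
  finally show ?thesis by (simp add: mult_left_mono)
qed

lemma measurable_ennreal_powr [measurable]: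
  assumes "u \<in> borel_measurable M" shows "(\<lambda>x. ennreal_powr (u x) a) \<in> borel_measurable M"
  unfolding ennreal_powr_def using assms by measurable

lemma ennreal_powr_cmult:
  assumes "0 < s" "0 < a" shows "ennreal_powr (ennreal s * x) a = ennreal (s powr a) * ennreal_powr x a"
  using assms by (simp add: ennreal_powr_mult ennreal_powr_ennreal)

section \<open>The layer cake formula\<close>

lemma nn_integral_powr_below:
  assumes "0 < a"
  shows "(\<integral>\<^sup>+t. ennreal (a * t powr (a - 1)) * indicator {0<..} t * indicator {t. ennreal t < x} t \<partial>lborel)
    = ennreal_powr x a"
proof -
  have fin: "(\<integral>\<^sup>+t. ennreal (a * t powr (a - 1)) * indicator {0..s} t \<partial>lborel) = ennreal (s powr a)"
    if "0 \<le> s" for s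
  proof -
    have "((\<lambda>t. a * t powr (a - 1)) has_integral (s powr a - 0 powr a)) {0..s}"
    proof (rule fundamental_theorem_of_calculus_interior)
      show "continuous_on {0..s} (\<lambda>x. x powr a)" using assms by (intro continuous_on_powr') (auto intro!: continuous_intros)
      show "((\<lambda>x. x powr a) has_vector_derivative a * x powr (a - 1)) (at x)" if "x \<in> {0<..<s}" for x
        using that by (auto simp flip: has_real_derivative_iff_has_vector_derivative intro!: derivative_eq_intros)
    qed (use that in auto)
    then have "((\<lambda>t. a * t powr (a - 1)) has_integral (s powr a)) {0..s}" using assms by simp
    then have "((\<lambda>t. if t \<in> {0..s} then a * t powr (a - 1) else 0) has_integral (s powr a)) UNIV"
      by (simp only: has_integral_restrict_UNIV)
    also have "(\<lambda>t. if t \<in> {0..s} then a * t powr (a - 1) else 0) = (\<lambda>t. (a * t powr (a - 1)) * indicator {0..s} t)"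
      by auto
    finally have "(\<integral>\<^sup>+t. ennreal ((a * t powr (a - 1)) * indicator {0..s} t) \<partial>lborel) = ennreal (s powr a)"
      using assms by (intro nn_integral_has_integral_lborel) auto
    then show ?thesis using assms by (simp add: ennreal_mult ennreal_indicator del: indicator_simps)
  qed
  show ?thesis
  proof (cases x)
    case (real r)
    have "AE t in lborel. t \<noteq> 0 \<and> t \<noteq> r"
      using AE_lborel_singleton[of 0] AE_lborel_singleton[of r] by auto
    then have "(\<integral>\<^sup>+t. ennreal (a * t powr (a - 1)) * indicator {0<..} t * indicator {t. ennreal t < x} t \<partial>lborel)
       = (\<integral>\<^sup>+t. ennreal (a * t powr (a - 1)) * indicator {0..r} t \<partial>lborel)"
      by (intro nn_integral_cong_AE) (use real in \<open>auto simp: indicator_def ennreal_less_iff split: if_splits\<close>)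
    then show ?thesis using fin[of r] real by (simp add: ennreal_powr_ennreal)
  next
    case top
    let ?J = "\<integral>\<^sup>+t. ennreal (a * t powr (a - 1)) * indicator {0<..} t * indicator {t. ennreal t < x} t \<partial>lborel"
    have "ennreal (real n) \<le> ?J" for n
    proof -
      have "ennreal (real n) = ennreal ((real n powr (1 / a)) powr a)" using assms by (simp add: powr_powr)
      also have "\<dots> = (\<integral>\<^sup>+t. ennreal (a * t powr (a - 1)) * indicator {0..real n powr (1 / a)} t \<partial>lborel)"
        by (rule fin[symmetric]) simp
      also have "\<dots> \<le> ?J"
        by (rule nn_integral_mono_AE, rule AE_mp[OF AE_lborel_singleton[of 0]], rule AE_I2)
           (auto simp: indicator_def top)
      finally show ?thesis .
    qed
    then have "\<not> ?J < top"
      using ennreal_Ex_less_of_nat[of ?J] by (auto simp: ennreal_of_nat_eq_real_of_nat not_less[symmetric])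
    then have "?J = top" by (metis less_top)
    then show ?thesis by (simp add: top)
  qed
qed

text \<open>This identity turns every distributional inequality below into a norm inequality.\<close>

lemma layer_cake:
  fixes u :: "'a \<Rightarrow> ennreal"
  assumes "sigma_finite_measure M" and [measurable]: "u \<in> borel_measurable M" and a: "0 < a"
  shows "(\<integral>\<^sup>+x. ennreal_powr (u x) a \<partial>M) =
    (\<integral>\<^sup>+t. ennreal (a * t powr (a - 1)) * indicator {0<..} t * emeasure M {x \<in> space M. ennreal t < u x} \<partial>lborel)"
proof -
  interpret M: sigma_finite_measure M by fact
  interpret pair_sigma_finite lborel M ..
  let ?h = "\<lambda>t x. ennreal (a * t powr (a - 1)) * indicator {0<..} t * indicator {t. ennreal t < u x} t"
  have "(\<integral>\<^sup>+x. ennreal_powr (u x) a \<partial>M) = (\<integral>\<^sup>+x. \<integral>\<^sup>+t. ?h t x \<partial>lborel \<partial>M)"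
    using a by (simp add: nn_integral_powr_below)
  also have "\<dots> = (\<integral>\<^sup>+t. \<integral>\<^sup>+x. ?h t x \<partial>M \<partial>lborel)"
  proof (rule Fubini')
    have [measurable]: "Measurable.pred (lborel \<Otimes>\<^sub>M M) (\<lambda>p. ennreal (fst p) < u (snd p))" by measurable
    show "(\<lambda>(t, x). ?h t x) \<in> borel_measurable (lborel \<Otimes>\<^sub>M M)"
      unfolding indicator_def split_beta' by measurable
  qed
  also have "\<dots> = (\<integral>\<^sup>+t. ennreal (a * t powr (a - 1)) * indicator {0<..} t * emeasure M {x \<in> space M. ennreal t < u x} \<partial>lborel)"
  proof (rule nn_integral_cong)
    fix t :: real
    have "(\<integral>\<^sup>+x. ?h t x \<partial>M) = (\<integral>\<^sup>+x. ennreal (a * t powr (a - 1)) * indicator {0<..} t * indicator {x \<in> space M. ennreal t < u x} x \<partial>M)"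
      by (rule nn_integral_cong) (auto simp: indicator_def)
    then show "(\<integral>\<^sup>+x. ?h t x \<partial>M) = ennreal (a * t powr (a - 1)) * indicator {0<..} t * emeasure M {x \<in> space M. ennreal t < u x}"
      by (simp add: nn_integral_cmult)
  qed
  finally show ?thesis .
qed

lemma measurable_distribution:
  fixes u :: "'a \<Rightarrow> ennreal"
  assumes "sigma_finite_measure M" and [measurable]: "u \<in> borel_measurable M"
  shows "(\<lambda>t. emeasure M {x \<in> space M. ennreal t < u x}) \<in> borel_measurable lborel"
proof -
  interpret sigma_finite_measure M by fact
  have [measurable]: "{p \<in> space (lborel \<Otimes>\<^sub>M M). ennreal (fst p) < u (snd p)} \<in> sets (lborel \<Otimes>\<^sub>M M)"
    by measurable
  have "(\<lambda>t. emeasure M (Pair t -` {p \<in> space (lborel \<Otimes>\<^sub>M M). ennreal (fst p) < u (snd p)})) \<in> borel_measurable lborel"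
    by (rule measurable_emeasure_Pair) measurable
  then show ?thesis by (simp add: space_pair_measure vimage_def)
qed

section \<open>Dyadic cubes\<close>

text \<open>A dyadic cube is given by its scale \<open>k\<close> (side length \<open>2 powi k\<close>) and its integer index \<open>m\<close>; \<open>coarsen d m\<close> is
  the index of the cube of scale \<open>k + d\<close> that contains it. Inclusions and distances of cubes become arithmetic of
  indices, and no family of sets has to be carried along.\<close>

definition cell :: "int \<Rightarrow> real ^ 'n \<Rightarrow> int ^ 'n" where
  "cell k x = (\<chi> i. \<lfloor>x $ i / 2 powi k\<rfloor>)"

definition coarsen :: "nat \<Rightarrow> int ^ 'n \<Rightarrow> int ^ 'n" where
  "coarsen d m = (\<chi> i. m $ i div 2 ^ d)"

definition near :: "int \<Rightarrow> int ^ 'n \<Rightarrow> int ^ 'n \<Rightarrow> bool" where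
  "near r m m' \<longleftrightarrow> (\<forall>i. \<bar>m $ i - m' $ i\<bar> \<le> r)"

definition cube :: "int \<Rightarrow> int ^ 'n \<Rightarrow> (real ^ 'n) set" where
  "cube k m = {x. cell k x = m}"

definition star :: "int \<Rightarrow> int \<Rightarrow> int ^ 'n \<Rightarrow> (real ^ 'n) set" where
  "star r k m = {x. near r m (cell k x)}"

lemma mem_cube [simp]: "x \<in> cube k m \<longleftrightarrow> cell k x = m"
  by (simp add: cube_def)

lemma mem_star [simp]: "x \<in> star r k m \<longleftrightarrow> near r m (cell k x)"
  by (simp add: star_def)

lemma cell_coarsen: "cell (k + int d) x = coarsen d (cell k x)"
proof -
  have "\<lfloor>x $ i / 2 powi (k + int d)\<rfloor> = \<lfloor>x $ i / 2 powi k\<rfloor> div 2 ^ d" for i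
  proof -
    have "x $ i / 2 powi (k + int d) = (x $ i / 2 powi k) / real_of_int (2 ^ d)"
      by (simp add: power_int_add)
    then show ?thesis by (simp only: floor_divide_real_eq_div[of "2 ^ d"] zero_le_power zero_le_numeral)
  qed
  then show ?thesis by (simp add: cell_def coarsen_def vec_eq_iff)
qed

lemma cell_coarsen': "k \<le> k' \<Longrightarrow> cell k' x = coarsen (nat (k' - k)) (cell k x)"
  using cell_coarsen[of k "nat (k' - k)" x] by simp

lemma coarsen_0 [simp]: "coarsen 0 m = m"
  by (simp add: coarsen_def vec_eq_iff)

lemma coarsen_coarsen: "coarsen d (coarsen e m) = coarsen (e + d) m"
  by (simp add: coarsen_def vec_eq_iff zdiv_zmult2_eq power_add)

lemma near_refl [simp]: "0 \<le> r \<Longrightarrow> near r m m"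
  by (simp add: near_def)

lemma near_sym: "near r m m' \<longleftrightarrow> near r m' m"
  by (simp add: near_def abs_minus_commute)

lemma near_trans:
  assumes "near r a b" "near s b c" shows "near (r + s) a c"
  unfolding near_def
proof
  fix i
  have "\<bar>a $ i - b $ i\<bar> \<le> r" "\<bar>b $ i - c $ i\<bar> \<le> s" using assms by (auto simp: near_def)
  then show "\<bar>a $ i - c $ i\<bar> \<le> r + s" by linarith
qed

lemma near_nonneg: "near r a b \<Longrightarrow> 0 \<le> r"
  unfolding near_def by (meson abs_ge_zero order_trans)

lemma near_coarsen:
  assumes "near r a b" shows "near r (coarsen d a) (coarsen d b)"
proof -
  have key: "x div 2 ^ d \<le> y div 2 ^ d + r" if "x \<le> y + r" "0 \<le> r" for x y :: int
  proof -
    have "x \<le> y + r * 2 ^ d"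
      using that by (smt (verit, best) mult_le_cancel_left1 one_le_power)
    then have "x div 2 ^ d \<le> (y + r * 2 ^ d) div 2 ^ d" by (intro zdiv_mono1) auto
    then show ?thesis by simp
  qed
  have "0 \<le> r" using assms by (rule near_nonneg)
  show ?thesis unfolding near_def coarsen_def
  proof safe
    fix i
    have "\<bar>a $ i - b $ i\<bar> \<le> r" using assms by (simp add: near_def)
    then have "a $ i div 2 ^ d \<le> b $ i div 2 ^ d + r" "b $ i div 2 ^ d \<le> a $ i div 2 ^ d + r"
      using \<open>0 \<le> r\<close> by (auto intro!: key)
    then show "\<bar>(\<chi> i. a $ i div 2 ^ d) $ i - (\<chi> i. b $ i div 2 ^ d) $ i\<bar> \<le> r" by simp
  qed
qed

lemma near_cell_mono: "near r (cell k x) (cell k y) \<Longrightarrow> k \<le> k' \<Longrightarrow> near r (cell k' x) (cell k' y)"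
  by (simp add: cell_coarsen'[of k k'] near_coarsen)

lemma card_vec_box:
  fixes A :: "'n::finite \<Rightarrow> int set"
  assumes "\<And>i. finite (A i)"
  shows "finite {m::int ^ 'n. \<forall>i. m $ i \<in> A i}" "card {m::int ^ 'n. \<forall>i. m $ i \<in> A i} = (\<Prod>i\<in>UNIV. card (A i))"
proof -
  have "bij_betw (\<lambda>m. \<lambda>i. m $ i) {m::int ^ 'n. \<forall>i. m $ i \<in> A i} (Pi\<^sub>E UNIV A)"
    by (rule bij_betwI[where g = "\<lambda>f. \<chi> i. f i"]) (auto simp: vec_eq_iff PiE_def)
  moreover have "finite (Pi\<^sub>E UNIV A)" using assms by (intro finite_PiE) auto
  ultimately show "finite {m::int ^ 'n. \<forall>i. m $ i \<in> A i}" "card {m::int ^ 'n. \<forall>i. m $ i \<in> A i} = (\<Prod>i\<in>UNIV. card (A i))"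
    by (auto simp: bij_betw_finite bij_betw_same_card card_PiE)
qed

text \<open>All overlap constants below come from this count, mostly through the case \<open>d = 0\<close>.\<close>

lemma near_coarsen_count:
  fixes m :: "int ^ 'n"
  assumes "0 \<le> r"
  shows "finite {m'. near r m (coarsen d m')}"
    and "real (card {m'. near r m (coarsen d m')}) = (2 ^ d * (2 * of_int r + 1)) ^ CARD('n)"
proof -
  let ?A = "\<lambda>i. {2 ^ d * (m $ i - r)..<2 ^ d * (m $ i + r + 1)}"
  have eq: "{m'. near r m (coarsen d m')} = {m'. \<forall>i. m' $ i \<in> ?A i}"
  proof -
    have "\<bar>a - b div 2 ^ d\<bar> \<le> r \<longleftrightarrow> b \<in> {2 ^ d * (a - r)..<2 ^ d * (a + r + 1)}" for a b :: int
    proof -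
      have b: "b = 2 ^ d * (b div 2 ^ d) + b mod 2 ^ d" by simp
      have mod: "0 \<le> b mod 2 ^ d" "b mod 2 ^ d < 2 ^ d" by simp_all
      have "2 ^ d * (b div 2 ^ d) \<le> b" "b < 2 ^ d * (b div 2 ^ d + 1)"
        using b mod unfolding distrib_left by linarith+
      note D = le_less_trans[OF _ this(2)] order_trans[OF _ this(1)] less_le_trans[OF this(2)] le_less_trans[OF this(1)]
      have "a - r \<le> b div 2 ^ d \<longleftrightarrow> 2 ^ d * (a - r) \<le> b"
      proof
        show "2 ^ d * (a - r) \<le> b" if "a - r \<le> b div 2 ^ d"
          by (rule D(2)) (use that in simp)
        show "a - r \<le> b div 2 ^ d" if "2 ^ d * (a - r) \<le> b"
          using D(1)[OF that] by simp
      qed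
      moreover have "b div 2 ^ d < a + r + 1 \<longleftrightarrow> b < 2 ^ d * (a + r + 1)"
      proof
        show "b < 2 ^ d * (a + r + 1)" if "b div 2 ^ d < a + r + 1"
          by (rule D(3)) (use that in simp)
        show "b div 2 ^ d < a + r + 1" if "b < 2 ^ d * (a + r + 1)"
          using D(4)[OF that] by simp
      qed
      ultimately show ?thesis by auto
    qed
    then show ?thesis by (simp add: near_def coarsen_def)
  qed
  show "finite {m'. near r m (coarsen d m')}" unfolding eq by (rule card_vec_box) auto
  have "card (?A i) = nat (2 ^ d * (2 * r + 1))" for i
    by (simp add: algebra_simps)
  then have "card {m'. near r m (coarsen d m')} = nat (2 ^ d * (2 * r + 1)) ^ CARD('n)"
    unfolding eq by (subst card_vec_box) auto
  then show "real (card {m'. near r m (coarsen d m')}) = (2 ^ d * (2 * of_int r + 1)) ^ CARD('n)"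
    using assms by simp
qed

lemma near_count:
  fixes m :: "int ^ 'n"
  assumes "0 \<le> r"
  shows "finite {m'. near r m m'}" "real (card {m'. near r m m'}) = (2 * of_int r + 1) ^ CARD('n)"
  using near_coarsen_count[OF assms, of m 0] by simp_all

lemma near_cell_norm:
  fixes x y :: "real ^ 'n"
  assumes "near r (cell k x) (cell k y)"
  shows "norm (x - y) < CARD('n) * ((of_int r + 1) * 2 powi k)"
proof -
  have "\<bar>(x - y) $ i\<bar> < (of_int r + 1) * 2 powi k" for i
  proof -
    have "\<bar>\<lfloor>x $ i / 2 powi k\<rfloor> - \<lfloor>y $ i / 2 powi k\<rfloor>\<bar> \<le> r"
      using assms by (simp add: near_def cell_def)
    then have "\<bar>x $ i / 2 powi k - y $ i / 2 powi k\<bar> < of_int r + 1" by linarith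
    then have "\<bar>(x $ i - y $ i) / 2 powi k\<bar> < of_int r + 1" by (simp add: diff_divide_distrib)
    then show ?thesis by (simp add: abs_divide divide_simps)
  qed
  then have "(\<Sum>i\<in>UNIV. \<bar>(x - y) $ i\<bar>) < (\<Sum>i\<in>(UNIV::'n set). (of_int r + 1) * 2 powi k)"
    by (intro sum_strict_mono) auto
  then show ?thesis using norm_le_l1_cart[of "x - y"] by simp
qed

lemma norm_near_cell:
  fixes x y :: "real ^ 'n"
  assumes "norm (x - y) \<le> of_int r * 2 powi k"
  shows "near r (cell k x) (cell k y)"
  unfolding near_def
proof
  fix i
  have "\<bar>x $ i - y $ i\<bar> \<le> of_int r * 2 powi k"
    using component_le_norm_cart[of "x - y" i] assms by simp
  then have "\<bar>(x $ i - y $ i) / 2 powi k\<bar> \<le> of_int r" by (simp add: abs_divide divide_simps)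
  then have "\<bar>x $ i / 2 powi k - y $ i / 2 powi k\<bar> \<le> of_int r" by (simp add: diff_divide_distrib)
  then show "\<bar>cell k x $ i - cell k y $ i\<bar> \<le> r" unfolding cell_def by (simp, linarith)
qed

lemma cube_nonempty: "\<exists>x. x \<in> cube k (m :: int ^ 'n)"
  by (rule exI[of _ "\<chi> i. of_int (m $ i) * 2 powi k"]) (simp add: cell_def vec_eq_iff)

lemma cube_measure:
  fixes m :: "int ^ 'n"
  shows "cube k m \<in> sets borel" "emeasure lborel (cube k m) = ennreal ((2 powi k) ^ CARD('n))"
proof -
  let ?a = "(\<chi> i. of_int (m $ i) * 2 powi k) :: real ^ 'n"
  let ?b = "(\<chi> i. of_int (m $ i + 1) * 2 powi k) :: real ^ 'n"
  have mem: "x \<in> cube k m \<longleftrightarrow> (\<forall>i. ?a $ i \<le> x $ i \<and> x $ i < ?b $ i)" for x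
    by (simp add: cell_def vec_eq_iff floor_eq_iff divide_simps)
  have "cube k m = (\<Inter>i. {x. ?a $ i \<le> x $ i \<and> x $ i < ?b $ i})"
    using mem by blast
  also have "\<dots> \<in> sets borel" by measurable
  finally show *: "cube k m \<in> sets borel" .
  have le: "\<And>i. i \<in> Basis \<Longrightarrow> ?a \<bullet> i \<le> ?b \<bullet> i"
    by (auto simp: Basis_vec_def inner_axis mult_right_mono)
  have c: "emeasure lborel (cbox ?a ?b) = ennreal ((2 powi k) ^ CARD('n))"
  proof -
    have "cbox ?a ?b \<noteq> {}" using le by (simp add: box_ne_empty)
    then have "measure lborel (cbox ?a ?b) = (\<Prod>i\<in>UNIV. ?b $ i - ?a $ i)"
      by (rule content_cbox_cart)
    also have "\<dots> = (2 powi k) ^ CARD('n)" by (simp add: algebra_simps)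
    finally show ?thesis
      using emeasure_eq_ennreal_measure[of lborel "cbox ?a ?b"] emeasure_lborel_cbox_finite[of ?a ?b]
      by (simp add: less_top)
  qed
  have "emeasure lborel (box ?a ?b) = emeasure lborel (cbox ?a ?b)"
    using le by (simp add: emeasure_lborel_cbox emeasure_lborel_box)
  moreover have "emeasure lborel (box ?a ?b) \<le> emeasure lborel (cube k m)"
    using * mem by (intro emeasure_mono) (auto simp: mem_box_cart less_imp_le)
  moreover have "emeasure lborel (cube k m) \<le> emeasure lborel (cbox ?a ?b)"
    using mem by (intro emeasure_mono) (auto simp: mem_box_cart less_imp_le)
  ultimately show "emeasure lborel (cube k m) = ennreal ((2 powi k) ^ CARD('n))" using c by auto
qed

lemma sets_cube [measurable]: "cube k m \<in> sets lebesgue" "cube k m \<in> sets borel"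
  using cube_measure(1) by (auto intro: lborelD)

lemma emeasure_cube: "emeasure lebesgue (cube k (m :: int ^ 'n)) = ennreal ((2 powi k) ^ CARD('n))"
  using cube_measure by (simp add: emeasure_completion)

lemma measurable_cell [measurable]: "(cell k :: real ^ 'n \<Rightarrow> _) \<in> lebesgue \<rightarrow>\<^sub>M count_space UNIV"
proof -
  have "cell k -` {a} = cube k a" for a :: "int ^ 'n" by auto
  then show ?thesis by (subst measurable_count_space_eq_countable) auto
qed

lemma star_eq: "star r k m = (\<Union>m'\<in>{m'. near r m m'}. cube k m')"
  by auto

lemma disjoint_cubes: "disjoint_family_on (cube k) A"
  by (auto simp: disjoint_family_on_def)

lemma sets_star [measurable]: "star r k m \<in> sets lebesgue" "star r k m \<in> sets borel"
  unfolding star_eq by (rule sets.countable_UN''; auto)+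

lemma emeasure_star:
  fixes m :: "int ^ 'n"
  assumes "0 \<le> r"
  shows "emeasure lebesgue (star r k m) = ennreal ((2 * of_int r + 1) ^ CARD('n) * (2 powi k) ^ CARD('n))"
proof -
  have "emeasure lebesgue (star r k m) = (\<Sum>m'\<in>{m'. near r m m'}. emeasure lebesgue (cube k m'))"
    unfolding star_eq using near_count(1)[OF assms]
    by (intro sum_emeasure[symmetric] disjoint_cubes) auto
  also have "\<dots> = ennreal (real (card {m'. near r m m'}) * (2 powi k) ^ CARD('n))"
    by (simp add: emeasure_cube ennreal_mult ennreal_of_nat_eq_real_of_nat)
  finally show ?thesis by (simp only: near_count(2)[OF assms])
qed

lemma emeasure_star_finite: "0 \<le> r \<Longrightarrow> emeasure lebesgue (star r k m) < \<infinity>"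
  by (subst emeasure_star) auto

section \<open>Muckenhoupt weights and their duals\<close>

lemma ennreal_Young:
  fixes x y :: ennreal
  assumes "1 < p" "1 < p'" "1 / p + 1 / p' = 1"
  shows "x * y \<le> ennreal (1 / p) * ennreal_powr x p + ennreal (1 / p') * ennreal_powr y p'"
proof (cases "x = top \<or> y = top")
  case True
  then have "ennreal (1 / p) * ennreal_powr x p + ennreal (1 / p') * ennreal_powr y p' = top"
    using assms by (auto simp: ennreal_mult_top)
  then show ?thesis by (metis top_greatest)
next
  case False
  then obtain a b where ab: "0 \<le> a" "x = ennreal a" "0 \<le> b" "y = ennreal b" by (cases x; cases y) auto
  have "a * b \<le> a powr p / p + b powr p' / p'"
    using assms ab by (intro Youngs_inequality) auto
  then have "ennreal (a * b) \<le> ennreal (1 / p * (a powr p) + 1 / p' * (b powr p'))"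
    by (intro ennreal_leI) simp
  then show ?thesis using assms ab
    by (simp add: ennreal_powr_ennreal flip: ennreal_mult)
qed

lemma nn_integral_Hoelder:
  assumes [measurable]: "f \<in> borel_measurable M" "g \<in> borel_measurable M"
    and p: "1 < p" "1 < p'" "1 / p + 1 / p' = 1"
  shows "(\<integral>\<^sup>+x. f x * g x \<partial>M) \<le>
    ennreal_powr (\<integral>\<^sup>+x. ennreal_powr (f x) p \<partial>M) (1 / p) * ennreal_powr (\<integral>\<^sup>+x. ennreal_powr (g x) p' \<partial>M) (1 / p')"
    (is "_ \<le> ennreal_powr ?F _ * ennreal_powr ?G _")
proof -
  consider (0) "?F = 0 \<or> ?G = 0" | (top) "?F \<noteq> 0" "?G \<noteq> 0" "?F = top \<or> ?G = top"
    | (fin) "?F \<noteq> 0" "?G \<noteq> 0" "?F \<noteq> top" "?G \<noteq> top" by blast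
  then show ?thesis
  proof cases
    case 0
    then have "AE x in M. f x * g x = 0"
    proof
      assume "?F = 0"
      then have "AE x in M. ennreal_powr (f x) p = 0" by (subst (asm) nn_integral_0_iff_AE) auto
      then show ?thesis by eventually_elim (use p in \<open>simp add: ennreal_powr_eq_0_iff\<close>)
    next
      assume "?G = 0"
      then have "AE x in M. ennreal_powr (g x) p' = 0" by (subst (asm) nn_integral_0_iff_AE) auto
      then show ?thesis by eventually_elim (use p in \<open>simp add: ennreal_powr_eq_0_iff\<close>)
    qed
    then have "(\<integral>\<^sup>+x. f x * g x \<partial>M) = 0" by (subst nn_integral_0_iff_AE) auto
    then show ?thesis by simp
  next
    case top
    then have "ennreal_powr ?F (1 / p) * ennreal_powr ?G (1 / p') = top"
      using p ennreal_powr_eq_0_iff[of "1/p" ?F] ennreal_powr_eq_0_iff[of "1/p'" ?G]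
      by (auto simp: ennreal_mult_eq_top_iff)
    then show ?thesis by simp
  next
    case fin
    then obtain F G where FG: "?F = ennreal F" "?G = ennreal G" "0 < F" "0 < G"
      by (cases ?F; cases ?G) (auto simp: less_le)
    define a b where "a = F powr (1 / p)" and "b = G powr (1 / p')"
    have ab: "0 < a" "0 < b" "a powr p = F" "b powr p' = G"
      using FG p by (auto simp: a_def b_def powr_powr)
    have "f x * g x = ennreal a * ennreal b * ((ennreal (1 / a) * f x) * (ennreal (1 / b) * g x))" for x
    proof -
      have "ennreal a * ennreal (1 / a) = 1" "ennreal b * ennreal (1 / b) = 1"
        using ab by (auto simp flip: ennreal_mult')
      then have "f x * g x = (ennreal a * ennreal (1 / a)) * f x * ((ennreal b * ennreal (1 / b)) * g x)" by simp
      then show ?thesis by (simp only: ac_simps)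
    qed
    then have "(\<integral>\<^sup>+x. f x * g x \<partial>M) = ennreal a * ennreal b * (\<integral>\<^sup>+x. (ennreal (1 / a) * f x) * (ennreal (1 / b) * g x) \<partial>M)"
      by (simp add: nn_integral_cmult)
    also have "(\<integral>\<^sup>+x. (ennreal (1 / a) * f x) * (ennreal (1 / b) * g x) \<partial>M)
      \<le> (\<integral>\<^sup>+x. ennreal (1 / p) * ennreal_powr (ennreal (1 / a) * f x) p + ennreal (1 / p') * ennreal_powr (ennreal (1 / b) * g x) p' \<partial>M)"
      by (intro nn_integral_mono ennreal_Young p)
    also have "\<dots> = ennreal (1 / p) * (ennreal ((1 / a) powr p) * ?F) + ennreal (1 / p') * (ennreal ((1 / b) powr p') * ?G)"
      using p ab by (simp add: ennreal_powr_cmult nn_integral_add nn_integral_cmult)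
    also have "ennreal ((1 / a) powr p) * ?F = 1"
      using ab FG by (simp add: powr_divide flip: ennreal_mult')
    also have "ennreal ((1 / b) powr p') * ?G = 1"
      using ab FG by (simp add: powr_divide flip: ennreal_mult')
    also have "ennreal (1 / p) * 1 + ennreal (1 / p') * 1 = 1"
      using p by (simp flip: ennreal_plus)
    finally have "(\<integral>\<^sup>+x. f x * g x \<partial>M) \<le> ennreal a * ennreal b" by (simp add: mult_left_mono)
    then show ?thesis using FG by (simp add: a_def b_def ennreal_powr_ennreal)
  qed
qed

abbreviation weighted :: "(real ^ 'n \<Rightarrow> real) \<Rightarrow> (real ^ 'n) measure" where
  "weighted w \<equiv> density lebesgue (\<lambda>x. ennreal (w x))"

text \<open>The two weights of the condition are kept on an equal footing, so that every consequence for \<open>w\<close> is also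
  available for \<open>\<sigma>\<close> with the conjugate exponent.\<close>

locale dual_weights =
  fixes w \<sigma> :: "real ^ 'n \<Rightarrow> real" and q A :: real
  assumes q: "1 < q" and A: "0 < A"
    and w_meas [measurable]: "w \<in> borel_measurable lebesgue"
    and w_pos: "\<And>x. 0 < w x"
    and sigma: "\<And>x. \<sigma> x = w x powr (- 1 / (q - 1))"
    and Aq: "\<And>y r. 0 < r \<Longrightarrow>
      emeasure (weighted w) (ball y r) * ennreal_powr (emeasure (weighted \<sigma>) (ball y r)) (q - 1)
      \<le> ennreal A * ennreal_powr (emeasure lebesgue (ball y r)) q"
begin

lemma sigma_meas [measurable]: "\<sigma> \<in> borel_measurable lebesgue"
proof -
  have "\<sigma> = (\<lambda>x. w x powr (- 1 / (q - 1)))" using sigma by blast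
  then show ?thesis by simp
qed

lemma sigma_pos: "0 < \<sigma> x"
  using sigma[of x] w_pos[of x] by simp

lemma lebesgue_ball: "0 < r \<Longrightarrow> emeasure lebesgue (ball y r) = ennreal (unit_ball_vol CARD('n) * r ^ CARD('n))"
  for y :: "real ^ 'n"
  by (simp add: emeasure_ball)

lemma weighted_pos:
  assumes "S \<in> sets lebesgue" "emeasure lebesgue S \<noteq> 0"
  shows "emeasure (weighted w) S \<noteq> 0" "emeasure (weighted \<sigma>) S \<noteq> 0"
proof -
  have "emeasure (weighted v) S \<noteq> 0" if [measurable]: "v \<in> borel_measurable lebesgue" and "\<And>x. 0 < v x" for v
  proof
    assume "emeasure (weighted v) S = 0"
    then have "AE x in lebesgue. ennreal (v x) * indicator S x = 0"
      using assms by (simp add: emeasure_density nn_integral_0_iff_AE)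
    then have "AE x in lebesgue. x \<notin> S"
      by eventually_elim (use that(2)[THEN not_le[THEN iffD2]] in \<open>auto simp: indicator_def ennreal_eq_0_iff split: if_splits\<close>)
    then show False using assms by (simp add: AE_iff_measurable[OF _ refl] AE_iff_null null_setsD1)
  qed
  then show "emeasure (weighted w) S \<noteq> 0" "emeasure (weighted \<sigma>) S \<noteq> 0" using w_pos sigma_pos by simp_all
qed

lemma ball_nonnull: "0 < r \<Longrightarrow> emeasure lebesgue (ball y r) \<noteq> 0" for y :: "real ^ 'n"
proof -
  assume "0 < r"
  moreover have "0 < unit_ball_vol (real CARD('n))" by (rule unit_ball_vol_pos) simp
  ultimately have "0 < unit_ball_vol CARD('n) * r ^ CARD('n)" by simp
  then show ?thesis using \<open>0 < r\<close> by (metis lebesgue_ball ennreal_eq_0_iff not_le)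
qed

text \<open>Finiteness of both weights on balls is part of the condition: the product of two nonzero factors is finite.\<close>

lemma ball_finite:
  assumes "0 < r"
  shows "emeasure (weighted w) (ball y r) \<noteq> top" "emeasure (weighted \<sigma>) (ball y r) \<noteq> top"
proof -
  let ?B = "ball y r"
  have "ennreal A * ennreal_powr (emeasure lebesgue ?B) q \<noteq> top"
    using assms by (subst lebesgue_ball) (auto simp: ennreal_powr_ennreal ennreal_mult_eq_top_iff)
  then have "emeasure (weighted w) ?B * ennreal_powr (emeasure (weighted \<sigma>) ?B) (q - 1) \<noteq> top"
    using Aq[OF assms, of y] by (metis top_unique)
  moreover have "emeasure (weighted w) ?B \<noteq> 0" "ennreal_powr (emeasure (weighted \<sigma>) ?B) (q - 1) \<noteq> 0"
    using weighted_pos[of ?B] ball_nonnull[OF assms, of y] q by (auto simp: ennreal_powr_eq_0_iff)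
  ultimately show "emeasure (weighted w) ?B \<noteq> top" "emeasure (weighted \<sigma>) ?B \<noteq> top"
    by (auto simp: ennreal_mult_eq_top_iff)
qed

lemma conj_exponent: "1 < q / (q - 1)" "1 / q + 1 / (q / (q - 1)) = 1" "q / (q - 1) - 1 = 1 / (q - 1)"
  using q by (auto simp: field_simps)

text \<open>The condition is symmetric in the pair: raise it to the power \<open>1 / (q - 1)\<close>.\<close>

lemma dual: "dual_weights \<sigma> w (q / (q - 1)) (A powr (1 / (q - 1)))"
proof
  show "1 < q / (q - 1)" "0 < A powr (1 / (q - 1))" "\<sigma> \<in> borel_measurable lebesgue" "\<And>x. 0 < \<sigma> x"
    using conj_exponent A sigma_pos by auto
  show "w x = \<sigma> x powr (- 1 / (q / (q - 1) - 1))" for x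
  proof -
    have "(- 1 / (q - 1)) * (- 1 / (1 / (q - 1))) = 1" using q by (simp add: divide_simps)
    then show ?thesis
      unfolding sigma conj_exponent(3) powr_powr using w_pos[of x] by simp
  qed
  fix y r assume r: "0 < (r::real)"
  have "ennreal_powr (emeasure (weighted w) (ball y r) * ennreal_powr (emeasure (weighted \<sigma>) (ball y r)) (q - 1)) (1 / (q - 1))
    \<le> ennreal_powr (ennreal A * ennreal_powr (emeasure lebesgue (ball y r)) q) (1 / (q - 1))"
    using q by (intro ennreal_powr_mono Aq r) auto
  then show "emeasure (weighted \<sigma>) (ball y r) * ennreal_powr (emeasure (weighted w) (ball y r)) (q / (q - 1) - 1)
    \<le> ennreal (A powr (1 / (q - 1))) * ennreal_powr (emeasure lebesgue (ball y r)) (q / (q - 1))"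
    unfolding conj_exponent(3) using q A
    by (simp add: ennreal_powr_mult ennreal_powr_powr ennreal_powr_ennreal mult.commute less_imp_le)
qed

text \<open>Hoelder's inequality turns the condition into the domination of Lebesgue averages by weighted averages.
  All comparisons between \<open>w\<close> and Lebesgue measure below are instances.\<close>

lemma average_le:
  assumes [measurable]: "u \<in> borel_measurable lebesgue" and r: "0 < r"
  shows "ennreal_powr (\<integral>\<^sup>+x. u x * indicator (ball y r) x \<partial>lebesgue) q * emeasure (weighted w) (ball y r)
    \<le> ennreal A * ennreal_powr (emeasure lebesgue (ball y r)) q *
       (\<integral>\<^sup>+x. ennreal_powr (u x) q * indicator (ball y r) x \<partial>weighted w)"
proof -
  let ?B = "ball y r" and ?p = "q / (q - 1)"
  have [measurable]: "ball y r \<in> sets lebesgue" by auto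
  let ?f = "\<lambda>x. u x * ennreal (w x powr (1 / q)) * indicator ?B x"
  let ?g = "\<lambda>x. ennreal (w x powr (- 1 / q)) * indicator ?B x"
  have "u x * indicator ?B x = ?f x * ?g x" for x
  proof -
    have "ennreal (w x powr (1 / q)) * ennreal (w x powr (- 1 / q)) = 1"
      using w_pos[of x] by (simp flip: ennreal_mult' powr_add)
    then have "u x * indicator ?B x = u x * (ennreal (w x powr (1 / q)) * ennreal (w x powr (- 1 / q))) * indicator ?B x"
      by simp
    then show ?thesis by (auto simp: indicator_def mult.assoc split: if_splits)
  qed
  then have "(\<integral>\<^sup>+x. u x * indicator ?B x \<partial>lebesgue) = (\<integral>\<^sup>+x. ?f x * ?g x \<partial>lebesgue)" by simp
  also have "\<dots> \<le> ennreal_powr (\<integral>\<^sup>+x. ennreal_powr (?f x) q \<partial>lebesgue) (1 / q)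
      * ennreal_powr (\<integral>\<^sup>+x. ennreal_powr (?g x) ?p \<partial>lebesgue) (1 / ?p)"
    using conj_exponent q by (intro nn_integral_Hoelder) auto
  also have "(\<integral>\<^sup>+x. ennreal_powr (?f x) q \<partial>lebesgue) = (\<integral>\<^sup>+x. ennreal_powr (u x) q * indicator ?B x \<partial>weighted w)"
  proof -
    have "ennreal_powr (?f x) q = ennreal (w x) * (ennreal_powr (u x) q * indicator ?B x)" for x
      using q w_pos[of x]
      by (auto simp: indicator_def ennreal_powr_mult ennreal_powr_ennreal powr_powr mult.commute less_imp_le)
    then show ?thesis by (simp add: nn_integral_density)
  qed
  also have "(\<integral>\<^sup>+x. ennreal_powr (?g x) ?p \<partial>lebesgue) = emeasure (weighted \<sigma>) ?B"
  proof -
    have "ennreal_powr (?g x) ?p = ennreal (\<sigma> x) * indicator ?B x" for x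
      using q w_pos[of x]
      by (auto simp: indicator_def ennreal_powr_mult ennreal_powr_ennreal powr_powr sigma)
    then show ?thesis by (simp add: emeasure_density)
  qed
  finally have "ennreal_powr (\<integral>\<^sup>+x. u x * indicator ?B x \<partial>lebesgue) q \<le>
    ennreal_powr (ennreal_powr (\<integral>\<^sup>+x. ennreal_powr (u x) q * indicator ?B x \<partial>weighted w) (1 / q)
      * ennreal_powr (emeasure (weighted \<sigma>) ?B) (1 / ?p)) q"
    using q by (intro ennreal_powr_mono) auto
  also have "\<dots> = (\<integral>\<^sup>+x. ennreal_powr (u x) q * indicator ?B x \<partial>weighted w) * ennreal_powr (emeasure (weighted \<sigma>) ?B) (q - 1)"
    using q by (simp add: ennreal_powr_mult ennreal_powr_powr)
  finally have "ennreal_powr (\<integral>\<^sup>+x. u x * indicator ?B x \<partial>lebesgue) q * emeasure (weighted w) ?B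
    \<le> (\<integral>\<^sup>+x. ennreal_powr (u x) q * indicator ?B x \<partial>weighted w) * ennreal_powr (emeasure (weighted \<sigma>) ?B) (q - 1)
      * emeasure (weighted w) ?B"
    by (intro mult_right_mono) auto
  also have "\<dots> = (\<integral>\<^sup>+x. ennreal_powr (u x) q * indicator ?B x \<partial>weighted w) *
    (emeasure (weighted w) ?B * ennreal_powr (emeasure (weighted \<sigma>) ?B) (q - 1))"
    by (simp only: ac_simps)
  also have "\<dots> \<le> (\<integral>\<^sup>+x. ennreal_powr (u x) q * indicator ?B x \<partial>weighted w) *
     (ennreal A * ennreal_powr (emeasure lebesgue ?B) q)"
    by (intro mult_left_mono Aq r) auto
  finally show ?thesis by (simp only: ac_simps)
qed

lemma measure_ratio:
  assumes [measurable]: "S \<in> sets lebesgue" and "S \<subseteq> ball y r" and r: "0 < r"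
  shows "ennreal_powr (emeasure lebesgue S) q * emeasure (weighted w) (ball y r)
    \<le> ennreal A * ennreal_powr (emeasure lebesgue (ball y r)) q * emeasure (weighted w) S"
proof -
  have eq: "ennreal_powr (indicator S x) q * indicator (ball y r) x = (indicator S x :: ennreal)"
    "indicator S x * indicator (ball y r) x = (indicator S x :: ennreal)" for x
    using assms(2) by (auto simp: indicator_def)
  show ?thesis using average_le[OF _ r, of "indicator S" y] unfolding eq by simp
qed

end

section \<open>Maximal functions over dyadic stars\<close>

lemma ennreal_div_le_iff:
  fixes a b c :: ennreal
  assumes "b \<noteq> 0" "b \<noteq> top" shows "a / b \<le> c \<longleftrightarrow> a \<le> c * b"
proof
  assume "a / b \<le> c"
  then have "a / b * b \<le> c * b" by (intro mult_right_mono) auto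
  moreover have "b / b = 1" using assms by (intro ennreal_divide_self) (auto simp: zero_less_iff_neq_zero less_top)
  ultimately show "a \<le> c * b" by (simp add: ennreal_divide_times)
next
  assume "a \<le> c * b" then show "a / b \<le> c"
    using assms by (intro divide_le_posI_ennreal) (auto simp: zero_less_iff_neq_zero mult.commute)
qed

lemma ennreal_le_div_iff:
  fixes a b c :: ennreal
  assumes "b \<noteq> 0" "b \<noteq> top" shows "c \<le> a / b \<longleftrightarrow> c * b \<le> a"
proof
  have bb: "b / b = 1" using assms by (intro ennreal_divide_self) (auto simp: zero_less_iff_neq_zero less_top)
  show "c * b \<le> a" if "c \<le> a / b"
  proof -
    have "c * b \<le> a / b * b" using that by (intro mult_right_mono) auto
    then show ?thesis by (simp add: ennreal_divide_times bb)
  qed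
  show "c \<le> a / b" if "c * b \<le> a"
  proof -
    have "c * b / b \<le> a / b" using that by (rule divide_right_mono_ennreal)
    then show ?thesis using assms by (simp add: ennreal_mult_divide_eq)
  qed
qed

lemma ennreal_less_div_iff:
  fixes a b c :: ennreal
  assumes "b \<noteq> 0" "b \<noteq> top" shows "c < a / b \<longleftrightarrow> c * b < a"
  using ennreal_div_le_iff[OF assms, of a c] by (simp add: not_le[symmetric])

lemma borel_measurable_of_cell [measurable]:
  "(\<lambda>x. F (cell k x)) \<in> borel_measurable lebesgue" for F :: "int ^ 'n \<Rightarrow> 'b::topological_space"
  by (rule measurable_compose[OF measurable_cell]) simp

lemma emeasure_UN_le_countable:
  assumes "countable I" "\<And>i. i \<in> I \<Longrightarrow> X i \<in> sets M"
  shows "emeasure M (\<Union>i\<in>I. X i) \<le> (\<integral>\<^sup>+i. emeasure M (X i) \<partial>count_space I)"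
proof -
  have "(\<Union>i\<in>I. X i) \<in> sets M" using assms by (intro sets.countable_UN'')
  then have "emeasure M (\<Union>i\<in>I. X i) = (\<integral>\<^sup>+x. indicator (\<Union>i\<in>I. X i) x \<partial>M)" by simp
  also have "\<dots> \<le> (\<integral>\<^sup>+x. \<integral>\<^sup>+i. indicator (X i) x \<partial>count_space I \<partial>M)"
  proof (rule nn_integral_mono)
    fix x
    show "indicator (\<Union>i\<in>I. X i) x \<le> (\<integral>\<^sup>+i. indicator (X i) x \<partial>count_space I)"
    proof (cases "x \<in> (\<Union>i\<in>I. X i)")
      case True
      then obtain i where i: "i \<in> I" "x \<in> X i" by auto
      have "indicator (\<Union>i\<in>I. X i) x = (1::ennreal)" using True by simp
      then show ?thesis using i nn_integral_ge_point[of i I "\<lambda>i. indicator (X i) x"] by simp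
    qed simp
  qed
  also have "\<dots> = (\<integral>\<^sup>+i. \<integral>\<^sup>+x. indicator (X i) x \<partial>M \<partial>count_space I)"
    using assms by (intro nn_integral_count_space_nn_integral) auto
  also have "\<dots> = (\<integral>\<^sup>+i. emeasure M (X i) \<partial>count_space I)"
    using assms by (intro nn_integral_cong) auto
  finally show ?thesis .
qed

definition maximal_cubes :: "(int \<Rightarrow> int ^ 'n \<Rightarrow> bool) \<Rightarrow> (int \<times> (int ^ 'n)) set" where
  "maximal_cubes F = {(k, m). F k m \<and> (\<forall>d>0. \<not> F (k + int d) (coarsen d m))}"

lemma maximal_cubes_disjoint: "disjoint_family_on (\<lambda>(k, m). cube k m) (maximal_cubes F)"
proof -
  have "(k, m) = (k', m')" if "(k, m) \<in> maximal_cubes F" "(k', m') \<in> maximal_cubes F"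
    "cell k x = m" "cell k' x = m'" "k \<le> k'" for k m k' m' x
  proof -
    have m': "m' = coarsen (nat (k' - k)) m" using cell_coarsen'[of k k' x] that by simp
    have k: "k' = k + int (nat (k' - k))" using that by simp
    have "F k' m'" using that(2) by (auto simp: maximal_cubes_def)
    then have "\<not> nat (k' - k) > 0"
      using that(1) m' k unfolding maximal_cubes_def by (metis (no_types, lifting) case_prodD mem_Collect_eq)
    then show ?thesis using m' that by simp
  qed
  then show ?thesis
    unfolding disjoint_family_on_def by (auto, (metis linear Pair_inject)+)
qed

text \<open>Cubes that contain a given one form a chain of scales, so an upper bound for the scales yields maximal cubes.\<close>

lemma maximal_cubes_cover:
  assumes bound: "\<And>k m. F k m \<Longrightarrow> k \<le> K" and "F k m"
  obtains d where "(k + int d, coarsen d m) \<in> maximal_cubes F"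
proof -
  let ?S = "{d. F (k + int d) (coarsen d m)}"
  have "?S \<subseteq> {..nat (K - k)}" using bound by force
  then have fin: "finite ?S" by (rule finite_subset) simp
  have ne: "0 \<in> ?S" using assms(2) by simp
  define d where "d = Max ?S"
  have "d \<in> ?S" unfolding d_def using Max_in[OF fin] ne by blast
  moreover have "\<not> F (k + int d + int e) (coarsen e (coarsen d m))" if "e > 0" for e
  proof
    assume "F (k + int d + int e) (coarsen e (coarsen d m))"
    then have "d + e \<in> ?S" by (simp add: coarsen_coarsen add.assoc)
    then have "d + e \<le> d" unfolding d_def using Max_ge[OF fin] by blast
    then show False using that by simp
  qed
  ultimately show ?thesis using that[of d] by (auto simp: maximal_cubes_def)
qed

text \<open>The integral is taken over the cube and its neighbours up to distance two, the region in which the kernels below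
  a cube live; the normalization by the cube itself makes the value constant on cubes of scale \<open>k\<close>.\<close>

definition maxfn :: "(real ^ 'n) measure \<Rightarrow> int set \<Rightarrow> (real ^ 'n \<Rightarrow> ennreal) \<Rightarrow> real ^ 'n \<Rightarrow> ennreal" where
  "maxfn \<mu> S h x = (SUP k\<in>S. (\<integral>\<^sup>+z. h z * indicator (star 2 k (cell k x)) z \<partial>\<mu>) / emeasure \<mu> (cube k (cell k x)))"

lemma measurable_maxfn [measurable]:
  "maxfn \<mu> S h \<in> borel_measurable lebesgue"
  unfolding maxfn_def
  by (rule borel_measurable_SUP) (auto intro: borel_measurable_of_cell[where F = "\<lambda>c. (\<integral>\<^sup>+z. h z * indicator (star 2 _ c) z \<partial>\<mu>) / emeasure \<mu> (cube _ c)"])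

locale doubling_measure =
  fixes \<mu> :: "(real ^ 'n) measure" and D :: real
  assumes sets_mu [measurable_cong]: "sets \<mu> = sets lebesgue"
    and D: "1 \<le> D"
    and star_le: "\<And>k m. emeasure \<mu> (star 2 k m) \<le> ennreal D * emeasure \<mu> (cube k m)"
    and cube_pos: "\<And>k m. emeasure \<mu> (cube k m) \<noteq> 0"
    and cube_fin: "\<And>k m. emeasure \<mu> (cube k m) \<noteq> top"
begin

lemma space_mu [simp]: "space \<mu> = UNIV"
  using sets_eq_imp_space_eq[OF sets_mu] by simp

lemma UNIV_in_sets [simp]: "UNIV \<in> sets \<mu>"
  by (simp add: sets_mu)

lemma sets_level: "u \<in> borel_measurable \<mu> \<Longrightarrow> {x. c < u x} \<in> sets \<mu>" for u :: "_ \<Rightarrow> ennreal"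
  using borel_measurable_less[of "\<lambda>_. c" \<mu> u] by simp

lemma meas_cube [measurable]: "cube k m \<in> sets \<mu>" and meas_star [measurable]: "star r k m \<in> sets \<mu>"
  by (simp_all add: sets_mu)

lemma measurable_maxfn' [measurable]: "maxfn \<nu> S h \<in> borel_measurable \<mu>"
  using measurable_maxfn[of \<nu> S h] measurable_cong_sets[OF sets_mu refl] by blast

lemma sigma_finite_mu: "sigma_finite_measure \<mu>"
proof
  show "\<exists>A. countable A \<and> A \<subseteq> sets \<mu> \<and> \<Union> A = space \<mu> \<and> (\<forall>a\<in>A. emeasure \<mu> a \<noteq> \<infinity>)"
    using cube_fin by (intro exI[of _ "range (cube 0)"]) auto
qed

text \<open>A star is a union of \<open>5\<^sup>n\<close> cubes, so if \<open>h\<close> has a large integral over the star, then it has a large average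
  over one of these cubes. The stars of the maximal cubes with large average cover the level set, and these
  cubes are disjoint. Maximal cubes exist because the scales are bounded by \<open>K\<close>.\<close>

lemma weak_type:
  assumes [measurable]: "h \<in> borel_measurable \<mu>" and s: "0 < (s::real)"
  shows "emeasure \<mu> {x. ennreal s < maxfn \<mu> {..K} h x} \<le> ennreal (5 ^ CARD('n) * D\<^sup>2 / s) * (\<integral>\<^sup>+x. h x \<partial>\<mu>)"
proof -
  define s' where "s' = s / (5 ^ CARD('n) * D)"
  have s': "0 < s'" using s D by (simp add: s'_def)
  define F where "F k m \<longleftrightarrow> k \<le> K \<and> ennreal s' * emeasure \<mu> (cube k m) < (\<integral>\<^sup>+x\<in>cube k m. h x \<partial>\<mu>)"
    for k and m :: "int ^ 'n"
  let ?I = "maximal_cubes F"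
  have cover: "{x. ennreal s < maxfn \<mu> {..K} h x} \<subseteq> (\<Union>(k, m)\<in>?I. star 2 k m)"
  proof
    fix x assume "x \<in> {x. ennreal s < maxfn \<mu> {..K} h x}"
    then obtain k where k: "k \<le> K"
      "ennreal s < (\<integral>\<^sup>+z. h z * indicator (star 2 k (cell k x)) z \<partial>\<mu>) / emeasure \<mu> (cube k (cell k x))"
      by (auto simp: maxfn_def less_SUP_iff)
    let ?c = "cell k x"
    have big: "ennreal s * emeasure \<mu> (cube k ?c) < (\<integral>\<^sup>+z. h z * indicator (star 2 k ?c) z \<partial>\<mu>)"
      using k(2) by (simp add: ennreal_less_div_iff cube_pos cube_fin)
    have "\<exists>m'. near 2 ?c m' \<and> F k m'"
    proof (rule ccontr)
      assume none: "\<nexists>m'. near 2 ?c m' \<and> F k m'"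
      have fin: "finite {m'. near 2 ?c m'}" and card: "real (card {m'. near 2 ?c m'}) = 5 ^ CARD('n)"
        using near_count[of 2 ?c] by auto
      have "(\<integral>\<^sup>+z. h z * indicator (star 2 k ?c) z \<partial>\<mu>) = emeasure (density \<mu> h) (star 2 k ?c)"
        by (simp add: emeasure_density)
      also have "\<dots> = (\<Sum>m'\<in>{m'. near 2 ?c m'}. emeasure (density \<mu> h) (cube k m'))"
        unfolding star_eq using fin by (intro sum_emeasure[symmetric] disjoint_cubes) auto
      also have "\<dots> = (\<Sum>m'\<in>{m'. near 2 ?c m'}. (\<integral>\<^sup>+x\<in>cube k m'. h x \<partial>\<mu>))"
        by (simp add: emeasure_density)
      also have "\<dots> \<le> (\<Sum>m'\<in>{m'. near 2 ?c m'}. ennreal s' * (ennreal D * emeasure \<mu> (cube k ?c)))"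
      proof (rule sum_mono)
        fix m' assume m': "m' \<in> {m'. near 2 ?c m'}"
        then have "(\<integral>\<^sup>+x\<in>cube k m'. h x \<partial>\<mu>) \<le> ennreal s' * emeasure \<mu> (cube k m')"
          using none k(1) by (auto simp: F_def not_less)
        also have "emeasure \<mu> (cube k m') \<le> emeasure \<mu> (star 2 k ?c)"
          using m' by (intro emeasure_mono) auto
        also have "\<dots> \<le> ennreal D * emeasure \<mu> (cube k ?c)" by (rule star_le)
        finally show "(\<integral>\<^sup>+x\<in>cube k m'. h x \<partial>\<mu>) \<le> ennreal s' * (ennreal D * emeasure \<mu> (cube k ?c))"
          by (simp add: mult_left_mono)
      qed
      also have "\<dots> = ennreal (5 ^ CARD('n)) * (ennreal s' * (ennreal D * emeasure \<mu> (cube k ?c)))"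
        using card by (simp add: ennreal_of_nat_eq_real_of_nat)
      also have "\<dots> = ennreal (5 ^ CARD('n) * s' * D) * emeasure \<mu> (cube k ?c)"
        using s' D by (simp add: ennreal_mult mult.assoc)
      also have "5 ^ CARD('n) * s' * D = s" using D by (simp add: s'_def)
      finally show False using big by simp
    qed
    then obtain m' where m': "near 2 ?c m'" "F k m'" by blast
    obtain d where d: "(k + int d, coarsen d m') \<in> ?I"
      by (rule maximal_cubes_cover[of F K]) (use m' in \<open>auto simp: F_def\<close>)
    have "near 2 (coarsen d m') (coarsen d ?c)" using m'(1) by (intro near_coarsen) (simp add: near_sym)
    then have "x \<in> star 2 (k + int d) (coarsen d m')" by (simp add: cell_coarsen)
    then show "x \<in> (\<Union>(k, m)\<in>?I. star 2 k m)" using d by blast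
  qed
  have "emeasure \<mu> {x. ennreal s < maxfn \<mu> {..K} h x} \<le> emeasure \<mu> (\<Union>(k, m)\<in>?I. star 2 k m)"
    by (intro emeasure_mono cover sets.countable_UN'') auto
  also have "\<dots> \<le> (\<integral>\<^sup>+p. emeasure \<mu> (case p of (k, m) \<Rightarrow> star 2 k m) \<partial>count_space ?I)"
    by (intro emeasure_UN_le_countable) auto
  also have "\<dots> \<le> (\<integral>\<^sup>+p. ennreal (D / s') * emeasure (density \<mu> h) (case p of (k, m) \<Rightarrow> cube k m) \<partial>count_space ?I)"
  proof (rule nn_integral_mono, clarsimp)
    fix k m assume "(k, m) \<in> ?I"
    then have "ennreal s' * emeasure \<mu> (cube k m) \<le> emeasure (density \<mu> h) (cube k m)"
      by (auto simp: maximal_cubes_def F_def emeasure_density)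
    then have "ennreal (D / s') * (ennreal s' * emeasure \<mu> (cube k m)) \<le> ennreal (D / s') * emeasure (density \<mu> h) (cube k m)"
      by (intro mult_left_mono) auto
    also have "ennreal (D / s') * (ennreal s' * emeasure \<mu> (cube k m)) = ennreal D * emeasure \<mu> (cube k m)"
      using s' D by (simp flip: mult.assoc ennreal_mult)
    finally show "emeasure \<mu> (star 2 k m) \<le> ennreal (D / s') * emeasure (density \<mu> h) (cube k m)"
      using star_le order_trans by blast
  qed
  also have "\<dots> = ennreal (D / s') * emeasure (density \<mu> h) (\<Union>p\<in>?I. case p of (k, m) \<Rightarrow> cube k m)"
  proof -
    have "emeasure (density \<mu> h) (\<Union>p\<in>?I. case p of (k, m) \<Rightarrow> cube k m) =
      (\<integral>\<^sup>+p. emeasure (density \<mu> h) (case p of (k, m) \<Rightarrow> cube k m) \<partial>count_space ?I)"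
      by (intro emeasure_UN_countable maximal_cubes_disjoint) auto
    then show ?thesis by (simp add: nn_integral_cmult)
  qed
  also have "\<dots> \<le> ennreal (D / s') * emeasure (density \<mu> h) (space \<mu>)"
    by (intro mult_left_mono emeasure_mono) auto
  also have "\<dots> = ennreal (5 ^ CARD('n) * D\<^sup>2 / s) * (\<integral>\<^sup>+x. h x \<partial>\<mu>)"
    by (simp add: emeasure_density s'_def power2_eq_square mult_ac)
  finally show ?thesis .
qed

lemma maxfn_split:
  assumes [measurable]: "h \<in> borel_measurable \<mu>" and c: "0 \<le> c"
  shows "maxfn \<mu> S h x \<le> maxfn \<mu> S (\<lambda>z. h z * indicator {z. ennreal c < h z} z) x + ennreal (c * D)"
  unfolding maxfn_def
proof (rule SUP_least)
  fix k assume k: "k \<in> S"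
  let ?c = "cell k x"
  let ?g = "\<lambda>z. h z * indicator {z. ennreal c < h z} z"
  have "(\<integral>\<^sup>+z. h z * indicator (star 2 k ?c) z \<partial>\<mu>) \<le>
    (\<integral>\<^sup>+z. ?g z * indicator (star 2 k ?c) z + ennreal c * indicator (star 2 k ?c) z \<partial>\<mu>)"
    by (intro nn_integral_mono) (auto simp: indicator_def not_less)
  also have "\<dots> = (\<integral>\<^sup>+z. ?g z * indicator (star 2 k ?c) z \<partial>\<mu>) + ennreal c * emeasure \<mu> (star 2 k ?c)"
    by (subst nn_integral_add) (auto simp: nn_integral_cmult)
  also have "\<dots> \<le> (\<integral>\<^sup>+z. ?g z * indicator (star 2 k ?c) z \<partial>\<mu>) + ennreal c * (ennreal D * emeasure \<mu> (cube k ?c))"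
    by (intro add_left_mono mult_left_mono star_le) auto
  finally have "(\<integral>\<^sup>+z. h z * indicator (star 2 k ?c) z \<partial>\<mu>) / emeasure \<mu> (cube k ?c) \<le>
    (\<integral>\<^sup>+z. ?g z * indicator (star 2 k ?c) z \<partial>\<mu>) / emeasure \<mu> (cube k ?c) + ennreal (c * D)"
    using c D cube_pos[of k ?c] cube_fin[of k ?c] ennreal_divide_self[of "emeasure \<mu> (cube k ?c)"]
    by (subst ennreal_div_le_iff)
       (auto simp: distrib_right ennreal_mult ennreal_divide_times mult.assoc zero_less_iff_neq_zero less_top)
  also have "\<dots> \<le> (SUP k\<in>S. (\<integral>\<^sup>+z. ?g z * indicator (star 2 k (cell k x)) z \<partial>\<mu>) / emeasure \<mu> (cube k (cell k x))) + ennreal (c * D)"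
    using k by (intro add_right_mono SUP_upper)
  finally show "(\<integral>\<^sup>+z. h z * indicator (star 2 k ?c) z \<partial>\<mu>) / emeasure \<mu> (cube k ?c) \<le> \<dots>" .
qed

text \<open>Marcinkiewicz interpolation between \<open>weak_type\<close> and the trivial bound for bounded functions.\<close>

lemma strong_type_bounded:
  assumes [measurable]: "h \<in> borel_measurable \<mu>" and r: "1 < r"
  shows "(\<integral>\<^sup>+x. ennreal_powr (maxfn \<mu> {..K} h x) r \<partial>\<mu>) \<le>
    ennreal (2 * (5 ^ CARD('n) * D\<^sup>2) * r / (r - 1) * (2 * D) powr (r - 1)) * (\<integral>\<^sup>+x. ennreal_powr (h x) r \<partial>\<mu>)"
    (is "_ \<le> ennreal ?C * _")
proof (cases "(\<integral>\<^sup>+x. ennreal_powr (h x) r \<partial>\<mu>) = top")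
  case True
  have "?C > 0" using r D by auto
  then have "ennreal ?C \<noteq> 0" by (simp only: ennreal_eq_0_iff not_le)
  then show ?thesis unfolding True by (simp only: ennreal_mult_top if_False top_greatest)
next
  case False
  then have "AE x in \<mu>. ennreal_powr (h x) r \<noteq> \<infinity>" by (intro nn_integral_PInf_AE) auto
  then have "AE x in \<mu>. h x \<noteq> \<infinity>" by simp
  then have sf: "sigma_finite_measure (density \<mu> h)"
    using sigma_finite_measure.sigma_finite_iff_density_finite[OF sigma_finite_mu] by simp
  let ?c = "5 ^ CARD('n) * D\<^sup>2"
  have level: "emeasure \<mu> {x. ennreal t < maxfn \<mu> {..K} h x} \<le>
      ennreal (2 * ?c / t) * emeasure (density \<mu> h) {x. ennreal t < ennreal (2 * D) * h x}" if t: "0 < t" for t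
  proof -
    let ?g = "\<lambda>z. h z * indicator {z. ennreal (t / (2 * D)) < h z} z"
    have "{x. ennreal t < maxfn \<mu> {..K} h x} \<subseteq> {x. ennreal (t / 2) < maxfn \<mu> {..K} ?g x}"
    proof safe
      fix x assume lt: "ennreal t < maxfn \<mu> {..K} h x"
      show "ennreal (t / 2) < maxfn \<mu> {..K} ?g x"
      proof (rule ccontr)
        assume "\<not> ?thesis"
        then have "maxfn \<mu> {..K} ?g x + ennreal (t / (2 * D) * D) \<le> ennreal (t / 2) + ennreal (t / 2)"
          using D by (intro add_mono) auto
        also have "\<dots> = ennreal t" using t by (simp flip: ennreal_plus)
        finally have "maxfn \<mu> {..K} ?g x + ennreal (t / (2 * D) * D) \<le> ennreal t" .
        moreover have "maxfn \<mu> {..K} h x \<le> maxfn \<mu> {..K} ?g x + ennreal (t / (2 * D) * D)"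
          using t D by (intro maxfn_split) auto
        ultimately have "maxfn \<mu> {..K} h x \<le> ennreal t" by (rule order_trans[rotated])
        then show False using lt by (simp add: not_le[symmetric])
      qed
    qed
    then have "emeasure \<mu> {x. ennreal t < maxfn \<mu> {..K} h x} \<le> emeasure \<mu> {x. ennreal (t / 2) < maxfn \<mu> {..K} ?g x}"
      by (intro emeasure_mono sets_level) auto
    also have "\<dots> \<le> ennreal (?c / (t / 2)) * (\<integral>\<^sup>+x. ?g x \<partial>\<mu>)"
      using t by (intro weak_type) auto
    also have "(\<integral>\<^sup>+x. ?g x \<partial>\<mu>) = emeasure (density \<mu> h) {z. ennreal (t / (2 * D)) < h z}"
      by (subst emeasure_density) (auto intro: sets_level)
    also have "{z. ennreal (t / (2 * D)) < h z} = {x. ennreal t < ennreal (2 * D) * h x}"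
    proof -
      have "ennreal (t / (2 * D)) < y \<longleftrightarrow> ennreal t < ennreal (2 * D) * y" for y
        using t D by (cases y) (auto simp: ennreal_less_iff field_simps ennreal_mult_top simp flip: ennreal_mult)
      then show ?thesis by auto
    qed
    finally show ?thesis by (simp add: mult_ac)
  qed
  have "(\<integral>\<^sup>+x. ennreal_powr (maxfn \<mu> {..K} h x) r \<partial>\<mu>) =
    (\<integral>\<^sup>+t. ennreal (r * t powr (r - 1)) * indicator {0<..} t * emeasure \<mu> {x. ennreal t < maxfn \<mu> {..K} h x} \<partial>lborel)"
    using r by (subst layer_cake[OF sigma_finite_mu]) auto
  also have "\<dots> \<le> (\<integral>\<^sup>+t. ennreal (2 * ?c * r / (r - 1)) * (ennreal ((r - 1) * t powr (r - 1 - 1)) * indicator {0<..} t *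
    emeasure (density \<mu> h) {x. ennreal t < ennreal (2 * D) * h x}) \<partial>lborel)"
  proof (rule nn_integral_mono)
    fix t :: real
    show "ennreal (r * t powr (r - 1)) * indicator {0<..} t * emeasure \<mu> {x. ennreal t < maxfn \<mu> {..K} h x}
      \<le> ennreal (2 * ?c * r / (r - 1)) * (ennreal ((r - 1) * t powr (r - 1 - 1)) * indicator {0<..} t *
      emeasure (density \<mu> h) {x. ennreal t < ennreal (2 * D) * h x})"
    proof (cases "0 < t")
      case True
      have "ennreal (r * t powr (r - 1)) * emeasure \<mu> {x. ennreal t < maxfn \<mu> {..K} h x} \<le>
        ennreal (r * t powr (r - 1)) * (ennreal (2 * ?c / t) * emeasure (density \<mu> h) {x. ennreal t < ennreal (2 * D) * h x})"
        using True by (intro mult_left_mono level) auto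
      also have "\<dots> = ennreal (r * t powr (r - 1) * (2 * ?c / t)) * emeasure (density \<mu> h) {x. ennreal t < ennreal (2 * D) * h x}"
        using True r D by (subst ennreal_mult) (auto simp: mult.assoc)
      also have "r * t powr (r - 1) * (2 * ?c / t) = (2 * ?c * r / (r - 1)) * ((r - 1) * t powr (r - 1 - 1))"
        using True r by (simp add: powr_diff field_simps power2_eq_square)
      finally show ?thesis using True r D by (subst (asm) ennreal_mult) (auto simp: mult.assoc)
    qed simp
  qed
  also have "\<dots> = ennreal (2 * ?c * r / (r - 1)) * (\<integral>\<^sup>+t. (ennreal ((r - 1) * t powr (r - 1 - 1)) * indicator {0<..} t *
    emeasure (density \<mu> h) {x. ennreal t < ennreal (2 * D) * h x}) \<partial>lborel)"
  proof (rule nn_integral_cmult)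
    have [measurable]: "(\<lambda>t. emeasure (density \<mu> h) {x. ennreal t < ennreal (2 * D) * h x}) \<in> borel_measurable lborel"
      using measurable_distribution[OF sf, of "\<lambda>x. ennreal (2 * D) * h x"] by simp
    show "(\<lambda>t. ennreal ((r - 1) * t powr (r - 1 - 1)) * indicator {0<..} t *
      emeasure (density \<mu> h) {x. ennreal t < ennreal (2 * D) * h x}) \<in> borel_measurable lborel" by measurable
  qed
  also have "(\<integral>\<^sup>+t. (ennreal ((r - 1) * t powr (r - 1 - 1)) * indicator {0<..} t *
    emeasure (density \<mu> h) {x. ennreal t < ennreal (2 * D) * h x}) \<partial>lborel) =
    (\<integral>\<^sup>+x. ennreal_powr (ennreal (2 * D) * h x) (r - 1) \<partial>density \<mu> h)"
    using r by (subst layer_cake[OF sf]) auto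
  also have "\<dots> = ennreal ((2 * D) powr (r - 1)) * (\<integral>\<^sup>+x. ennreal_powr (h x) r \<partial>\<mu>)"
  proof -
    have "h x * ennreal_powr (ennreal (2 * D) * h x) (r - 1) = ennreal ((2 * D) powr (r - 1)) * ennreal_powr (h x) r" for x
    proof (cases "h x")
      case (real a)
      have "a * a powr (r - 1) = a powr r" using real r by (cases "a = 0") (auto simp: powr_diff)
      moreover have "(2 * D * a) powr (r - 1) = (2 * D) powr (r - 1) * a powr (r - 1)"
        by (rule powr_mult)
      ultimately have *: "a * (2 * D * a) powr (r - 1) = (2 * D) powr (r - 1) * a powr r"
        by (simp add: mult.left_commute)
      have e: "ennreal (2 * D) * h x = ennreal (2 * D * a)" using real D by (simp add: ennreal_mult)
      have "ennreal_powr (ennreal (2 * D) * h x) (r - 1) = ennreal ((2 * D * a) powr (r - 1))"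
        unfolding e using real D by (intro ennreal_powr_ennreal) auto
      then have "h x * ennreal_powr (ennreal (2 * D) * h x) (r - 1) = ennreal (a * (2 * D * a) powr (r - 1))"
        using real by (simp only: ennreal_mult powr_ge_zero)
      then show ?thesis unfolding * using real by (simp add: ennreal_powr_ennreal ennreal_mult)
    qed (use r D in \<open>simp add: ennreal_powr_mult ennreal_powr_ennreal ennreal_mult_top\<close>)
    then show ?thesis by (subst nn_integral_density) (auto simp: nn_integral_cmult)
  qed
  finally show ?thesis using r D by (subst (asm) mult.assoc[symmetric], subst (asm) ennreal_mult[symmetric]) auto
qed

lemma strong_type:
  assumes [measurable]: "h \<in> borel_measurable \<mu>" and r: "1 < r"
  shows "(\<integral>\<^sup>+x. ennreal_powr (maxfn \<mu> UNIV h x) r \<partial>\<mu>) \<le>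
    ennreal (2 * (5 ^ CARD('n) * D\<^sup>2) * r / (r - 1) * (2 * D) powr (r - 1)) * (\<integral>\<^sup>+x. ennreal_powr (h x) r \<partial>\<mu>)"
proof -
  have "maxfn \<mu> UNIV h x = (SUP N. maxfn \<mu> {..int N} h x)" for x
  proof -
    have "k \<le> int (nat k)" for k by simp
    then have "(UNIV :: int set) = (\<Union>N. {..int N})" by blast
    then show ?thesis unfolding maxfn_def by (subst \<open>UNIV = _\<close>) (rule SUP_UNION)
  qed
  moreover have "incseq (\<lambda>N x. ennreal_powr (maxfn \<mu> {..int N} h x) r)"
    using r by (auto simp: incseq_def le_fun_def maxfn_def intro!: ennreal_powr_mono SUP_subset_mono)
  ultimately have "(\<integral>\<^sup>+x. ennreal_powr (maxfn \<mu> UNIV h x) r \<partial>\<mu>) = (SUP N. \<integral>\<^sup>+x. ennreal_powr (maxfn \<mu> {..int N} h x) r \<partial>\<mu>)"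
    using r by (simp add: ennreal_powr_SUP nn_integral_monotone_convergence_SUP)
  also have "\<dots> \<le> ennreal (2 * (5 ^ CARD('n) * D\<^sup>2) * r / (r - 1) * (2 * D) powr (r - 1)) * (\<integral>\<^sup>+x. ennreal_powr (h x) r \<partial>\<mu>)"
    by (intro SUP_least strong_type_bounded r) auto
  finally show ?thesis .
qed

end

section \<open>The maximal inequality for Muckenhoupt weights\<close>

(* From here on the measure of a set stays a statement about lebesgue, as in emeasure_cube. *)
declare emeasure_completion [simp del]

context dual_weights
begin

definition ratio_const :: "int \<Rightarrow> real" where
  "ratio_const r = A * (unit_ball_vol CARD('n) * (real CARD('n) * (real_of_int r + 1)) ^ CARD('n)) powr q"

lemma ball_const_pos: "0 \<le> r \<Longrightarrow> 0 < unit_ball_vol (real CARD('n)) * (real CARD('n) * (real_of_int r + 1)) ^ CARD('n)"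
  by (intro mult_pos_pos unit_ball_vol_pos zero_less_power) auto

lemma ratio_const_pos: assumes "0 \<le> r" shows "0 < ratio_const r"
  unfolding ratio_const_def using A ball_const_pos[OF assms]
  by (intro mult_pos_pos) (simp_all only: powr_gt_zero)

lemma cube_in_ball:
  fixes m :: "int ^ 'n"
  assumes "0 \<le> r"
  obtains y R where "0 < R" "star r k m \<subseteq> ball y R" "cube k m \<subseteq> ball y R"
    "ennreal A * ennreal_powr (emeasure lebesgue (ball y R)) q = ennreal (ratio_const r) * ennreal_powr (emeasure lebesgue (cube k m)) q"
proof -
  obtain x where x: "x \<in> cube k m" using cube_nonempty by blast
  let ?R = "CARD('n) * ((of_int r + 1) * 2 powi k)"
  have R: "0 < ?R" using assms by simp
  have st: "star r k m \<subseteq> ball x ?R"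
    using x near_cell_norm[of r k x] by (auto simp: dist_norm)
  then have "cube k m \<subseteq> ball x ?R" using assms by auto
  moreover have "ennreal A * ennreal_powr (emeasure lebesgue (ball x ?R)) q = ennreal (ratio_const r) * ennreal_powr (emeasure lebesgue (cube k m)) q"
  proof -
    let ?c = "unit_ball_vol CARD('n) * (real CARD('n) * (real_of_int r + 1)) ^ CARD('n)"
    have "unit_ball_vol CARD('n) * ?R ^ CARD('n) = ?c * (2 powi k) ^ CARD('n)"
      by (simp add: power_mult_distrib)
    then have "ennreal_powr (emeasure lebesgue (ball x ?R)) q = ennreal ((?c * (2 powi k) ^ CARD('n)) powr q)"
      unfolding lebesgue_ball[OF R] using ball_const_pos[OF assms] by (simp only: ennreal_powr_ennreal mult_nonneg_nonneg less_imp_le zero_less_power zero_less_power_int zero_less_numeral)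
    also have "\<dots> = ennreal (?c powr q) * ennreal (((2 powi k) ^ CARD('n)) powr q)"
      unfolding powr_mult[of ?c] by (intro ennreal_mult powr_ge_zero)
    finally have "ennreal_powr (emeasure lebesgue (ball x ?R)) q = ennreal (?c powr q) * ennreal (((2 powi k) ^ CARD('n)) powr q)" .
    then show ?thesis using A by (simp add: ratio_const_def emeasure_cube ennreal_powr_ennreal ennreal_mult mult.assoc del: emeasure_completion)
  qed
  ultimately show ?thesis using that R st by blast
qed

lemma star_ratio:
  assumes [measurable]: "S \<in> sets lebesgue" and "S \<subseteq> star r k m" and r: "0 \<le> r"
  shows "ennreal_powr (emeasure lebesgue S) q * emeasure (weighted w) (star r k m)
    \<le> ennreal (ratio_const r) * ennreal_powr (emeasure lebesgue (cube k m)) q * emeasure (weighted w) S"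
proof -
  obtain y R where R: "0 < R" "star r k m \<subseteq> ball y R" "cube k m \<subseteq> ball y R"
    "ennreal A * ennreal_powr (emeasure lebesgue (ball y R)) q = ennreal (ratio_const r) * ennreal_powr (emeasure lebesgue (cube k m)) q"
    by (rule cube_in_ball[OF r])
  have "emeasure (weighted w) (star r k m) \<le> emeasure (weighted w) (ball y R)"
    using R by (intro emeasure_mono) auto
  then have "ennreal_powr (emeasure lebesgue S) q * emeasure (weighted w) (star r k m)
    \<le> ennreal_powr (emeasure lebesgue S) q * emeasure (weighted w) (ball y R)"
    by (rule mult_left_mono) simp
  also have "\<dots> \<le> ennreal A * ennreal_powr (emeasure lebesgue (ball y R)) q * emeasure (weighted w) S"
    using assms R by (intro measure_ratio) auto
  finally show ?thesis unfolding R(4) .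
qed

text \<open>Only this quantitative absolute continuity of \<open>w\<close> enters the good-\<open>\<lambda>\<close> inequality and the reverse doubling
  of balls: \<open>B - E\<close> has at least half of the measure of \<open>B\<close>, hence a fixed share of its weighted measure.\<close>

lemma half_measure:
  assumes E[measurable]: "E \<in> sets lebesgue" and B[measurable]: "B \<in> sets lebesgue" and sub: "E \<subseteq> B"
    and v: "0 < v" "emeasure lebesgue B = ennreal v" and half: "emeasure lebesgue E \<le> ennreal (v / 2)"
    and fin: "emeasure (weighted w) B \<noteq> top" and c: "0 \<le> c"
    and ratio: "ennreal_powr (emeasure lebesgue (B - E)) q * emeasure (weighted w) B
      \<le> ennreal c * ennreal_powr (emeasure lebesgue B) q * emeasure (weighted w) (B - E)"
  shows "emeasure (weighted w) E \<le> ennreal (1 - 1 / (2 powr q * c + 1)) * emeasure (weighted w) B"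
proof -
  let ?S = "B - E"
  obtain b where b: "0 \<le> b" "emeasure (weighted w) B = ennreal b" using fin by (cases "emeasure (weighted w) B") auto
  have "emeasure (weighted w) ?S \<le> emeasure (weighted w) B" by (intro emeasure_mono) auto
  then obtain s where s: "0 \<le> s" "emeasure (weighted w) ?S = ennreal s"
    using fin top_unique by (cases "emeasure (weighted w) ?S") auto
  have add: "emeasure (weighted w) B = emeasure (weighted w) E + emeasure (weighted w) ?S"
    using sub by (subst plus_emeasure) (auto simp: Un_absorb1)
  then obtain e where e: "0 \<le> e" "emeasure (weighted w) E = ennreal e" "b = e + s"
    using b s by (cases "emeasure (weighted w) E") (auto simp flip: ennreal_plus)
  have "emeasure lebesgue ?S = emeasure lebesgue B - emeasure lebesgue E"
    using sub half by (intro emeasure_Diff) (auto simp: top_unique)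
  also have "\<dots> \<ge> ennreal v - ennreal (v / 2)"
    unfolding v using half by (intro ennreal_minus_mono) auto
  finally have "ennreal (v / 2) \<le> emeasure lebesgue ?S" using v by (simp add: ennreal_minus)
  then have "ennreal_powr (ennreal (v / 2)) q * emeasure (weighted w) B \<le> ennreal_powr (emeasure lebesgue ?S) q * emeasure (weighted w) B"
    using q by (intro mult_right_mono ennreal_powr_mono) auto
  also note ratio
  finally have "(v / 2) powr q * b \<le> c * v powr q * s"
    unfolding v b s using b s v c by (simp add: ennreal_powr_ennreal flip: ennreal_mult)
  then have "b \<le> 2 powr q * c * s" using v by (simp add: powr_divide field_simps)
  also have "\<dots> \<le> (2 powr q * c + 1) * s" using s by (simp add: distrib_right)
  finally have "b / (2 powr q * c + 1) \<le> s"
    using c by (simp add: divide_le_eq mult.commute add_nonneg_pos)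
  then have le: "e \<le> (1 - 1 / (2 powr q * c + 1)) * b" using e(3) by (simp add: left_diff_distrib)
  have "0 \<le> 1 - 1 / (2 powr q * c + 1)" using c by (simp add: divide_le_eq add_nonneg_pos)
  with ennreal_leI[OF le] show ?thesis using e b by (simp add: ennreal_mult)
qed

lemma cube_null: "emeasure lebesgue (cube k m) \<noteq> 0" "emeasure lebesgue (cube k m) \<noteq> top" for m :: "int ^ 'n"
  by (subst emeasure_cube, simp)+

text \<open>Doubling is \<open>star_ratio\<close> for the central cube of the star.\<close>

lemma doubling: "doubling_measure (weighted w) (ratio_const 2 + 1)"
proof
  show "1 \<le> ratio_const 2 + 1" using ratio_const_pos[of 2] by simp
  fix k and m :: "int ^ 'n"
  let ?L = "ennreal_powr (emeasure lebesgue (cube k m)) q"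
  have L: "?L \<noteq> 0" "?L \<noteq> top" using cube_null[of k m] q by (auto simp: ennreal_powr_eq_0_iff)
  have "?L * emeasure (weighted w) (star 2 k m) \<le> ?L * (ennreal (ratio_const 2) * emeasure (weighted w) (cube k m))"
  proof -
    have "cube k m \<subseteq> star 2 k m" by auto
    then have "?L * emeasure (weighted w) (star 2 k m) \<le> ennreal (ratio_const 2) * ?L * emeasure (weighted w) (cube k m)"
      by (intro star_ratio) auto
    then show ?thesis by (simp only: ac_simps)
  qed
  then have "emeasure (weighted w) (star 2 k m) \<le> ennreal (ratio_const 2) * emeasure (weighted w) (cube k m)"
    using L by (simp add: ennreal_mult_le_mult_iff)
  also have "\<dots> \<le> ennreal (ratio_const 2 + 1) * emeasure (weighted w) (cube k m)"
    by (intro mult_right_mono ennreal_leI) auto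
  finally show "emeasure (weighted w) (star 2 k m) \<le> ennreal (ratio_const 2 + 1) * emeasure (weighted w) (cube k m)" .
  show "emeasure (weighted w) (cube k m) \<noteq> 0" using weighted_pos(1)[of "cube k m"] cube_null[of k m] by simp
  obtain y R where R: "0 < R" "star 0 k m \<subseteq> ball y R" "cube k m \<subseteq> ball y R"
    "ennreal A * ennreal_powr (emeasure lebesgue (ball y R)) q = ennreal (ratio_const 0) * ennreal_powr (emeasure lebesgue (cube k m)) q"
    by (rule cube_in_ball[OF order_refl, of k m])
  have "emeasure (weighted w) (cube k m) \<le> emeasure (weighted w) (ball y R)"
    using R by (intro emeasure_mono) auto
  also have "\<dots> < top" using ball_finite(1)[OF R(1), of y] by (simp only: less_top)
  finally show "emeasure (weighted w) (cube k m) \<noteq> top" by (simp only: less_top)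
qed (simp only: sets_density)

lemma Aq_cube:
  "emeasure (weighted w) (cube k m) * ennreal_powr (emeasure (weighted \<sigma>) (cube k m)) (q - 1)
    \<le> ennreal (ratio_const 0) * ennreal_powr (emeasure lebesgue (cube k m)) q"
proof -
  obtain y R where R: "0 < R" "star 0 k m \<subseteq> ball y R" "cube k m \<subseteq> ball y R"
    "ennreal A * ennreal_powr (emeasure lebesgue (ball y R)) q = ennreal (ratio_const 0) * ennreal_powr (emeasure lebesgue (cube k m)) q"
    by (rule cube_in_ball[OF order_refl, of k m])
  have "emeasure (weighted v) (cube k m) \<le> emeasure (weighted v) (ball y R)" for v
    using R by (intro emeasure_mono) auto
  then have "emeasure (weighted w) (cube k m) * ennreal_powr (emeasure (weighted \<sigma>) (cube k m)) (q - 1)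
    \<le> emeasure (weighted w) (ball y R) * ennreal_powr (emeasure (weighted \<sigma>) (ball y R)) (q - 1)"
    using q by (intro mult_mono ennreal_powr_mono) auto
  also note Aq[OF R(1)]
  finally show ?thesis unfolding R(4) .
qed

text \<open>Lerner's argument: \<open>Aq_cube\<close> factors a Lebesgue average into an average with respect to \<open>\<sigma>\<close> and one with
  respect to \<open>w\<close>. The Lebesgue maximal function is thus dominated by the composition of two maximal functions,
  each of which is bounded because it is formed with respect to its own doubling measure.\<close>

lemma maxfn_dominated:
  fixes f :: "real ^ 'n \<Rightarrow> ennreal"
  assumes [measurable]: "f \<in> borel_measurable lebesgue"
  defines "u \<equiv> maxfn (weighted \<sigma>) UNIV (\<lambda>x. f x * ennreal (1 / \<sigma> x))"
  shows "ennreal_powr (maxfn lebesgue UNIV f x) (q - 1) \<le>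
    ennreal (ratio_const 0) * maxfn (weighted w) UNIV (\<lambda>z. ennreal_powr (u z) (q - 1) * ennreal (1 / w z)) x"
proof -
  interpret W: doubling_measure "weighted w" "ratio_const 2 + 1" by (rule doubling)
  interpret dl: dual_weights \<sigma> w "q / (q - 1)" "A powr (1 / (q - 1))" by (rule dual)
  interpret S: doubling_measure "weighted \<sigma>" "dl.ratio_const 2 + 1" by (rule dl.doubling)
  have [measurable]: "u \<in> borel_measurable lebesgue" unfolding u_def by measurable
  let ?g = "\<lambda>z. ennreal_powr (u z) (q - 1) * ennreal (1 / w z)"
  have f: "f z = f z * ennreal (1 / \<sigma> z) * ennreal (\<sigma> z)" for z
    using sigma_pos[of z] by (simp add: mult.assoc flip: ennreal_mult')
  have "ennreal_powr ((\<integral>\<^sup>+z. f z * indicator (star 2 k (cell k x)) z \<partial>lebesgue) / emeasure lebesgue (cube k (cell k x))) (q - 1)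
    \<le> ennreal (ratio_const 0) * maxfn (weighted w) UNIV ?g x" for k
  proof -
    let ?Q = "cube k (cell k x)"
    define v where "v = ((2 powi k) ^ CARD('n) :: real)"
    have v: "0 < v" "emeasure lebesgue ?Q = ennreal v" by (simp_all add: v_def emeasure_cube del: emeasure_completion)
    define a where "a = (\<integral>\<^sup>+z. f z * indicator (star 2 k (cell k x)) z \<partial>lebesgue)"
    define t where "t = a / emeasure (weighted \<sigma>) ?Q"
    have a: "a = (\<integral>\<^sup>+z. (f z * ennreal (1 / \<sigma> z)) * indicator (star 2 k (cell k x)) z \<partial>weighted \<sigma>)"
    proof -
      have "f z * indicator S z = ennreal (\<sigma> z) * (f z * ennreal (1 / \<sigma> z) * indicator S z)" for z S
        by (subst f) (simp only: ac_simps)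
      then show ?thesis unfolding a_def by (subst nn_integral_density) auto
    qed
    have t_le: "t \<le> u z" if "z \<in> ?Q" for z
    proof -
      have "t = (\<integral>\<^sup>+y. (f y * ennreal (1 / \<sigma> y)) * indicator (star 2 k (cell k z)) y \<partial>weighted \<sigma>) / emeasure (weighted \<sigma>) (cube k (cell k z))"
        using that by (simp add: t_def a)
      then show ?thesis unfolding u_def maxfn_def by (auto intro: SUP_upper)
    qed
    have at: "a = t * emeasure (weighted \<sigma>) ?Q"
      unfolding t_def using ennreal_divide_self[of "emeasure (weighted \<sigma>) ?Q"] S.cube_pos[of k "cell k x"] S.cube_fin[of k "cell k x"]
      by (simp add: ennreal_divide_times zero_less_iff_neq_zero less_top)
    have "ennreal_powr (a / ennreal v) (q - 1) * emeasure (weighted w) ?Q =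
      ennreal_powr t (q - 1) * ennreal (v powr (1 - q)) * (emeasure (weighted w) ?Q * ennreal_powr (emeasure (weighted \<sigma>) ?Q) (q - 1))"
    proof -
      have "a / ennreal v = t * emeasure (weighted \<sigma>) ?Q * ennreal (1 / v)"
        unfolding at using v by (simp add: divide_ennreal_def inverse_ennreal inverse_eq_divide)
      moreover have "(1 / v) powr (q - 1) = v powr (1 - q)"
        using v by (simp add: powr_divide powr_diff)
      ultimately show ?thesis using q v by (simp add: ennreal_powr_mult ennreal_powr_ennreal mult_ac)
    qed
    also have "\<dots> \<le> ennreal_powr t (q - 1) * ennreal (v powr (1 - q)) * (ennreal (ratio_const 0) * ennreal_powr (ennreal v) q)"
      using Aq_cube[of k "cell k x"] unfolding v by (intro mult_left_mono) auto
    also have "\<dots> = ennreal (ratio_const 0) * (ennreal_powr t (q - 1) * ennreal v)"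
    proof -
      have "ennreal (v powr (1 - q)) * ennreal (v powr q) = ennreal v"
        using v by (simp flip: ennreal_mult' powr_add)
      then have "ennreal_powr t (q - 1) * (ennreal (v powr (1 - q)) * ennreal (v powr q)) * ennreal (ratio_const 0) = ennreal_powr t (q - 1) * ennreal v * ennreal (ratio_const 0)"
        by simp
      then show ?thesis using v by (simp add: ennreal_powr_ennreal) (simp only: ac_simps)
    qed
    also have "ennreal_powr t (q - 1) * ennreal v = (\<integral>\<^sup>+z. ennreal_powr t (q - 1) * indicator ?Q z \<partial>lebesgue)"
      by (subst nn_integral_cmult_indicator) (auto simp: v simp del: emeasure_completion)
    also have "\<dots> \<le> (\<integral>\<^sup>+z. ?g z * indicator (star 2 k (cell k x)) z \<partial>weighted w)"
    proof (subst nn_integral_density)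
      have "ennreal_powr t (q - 1) * indicator ?Q z \<le> ennreal (w z) * (?g z * indicator (star 2 k (cell k x)) z)" for z
      proof (cases "z \<in> ?Q")
        case True
        then have "z \<in> star 2 k (cell k x)" by simp
        have "ennreal (w z) * (?g z * indicator (star 2 k (cell k x)) z) = ennreal_powr (u z) (q - 1) * (ennreal (w z) * ennreal (1 / w z))"
          using \<open>z \<in> star _ _ _\<close> by (simp add: mult_ac)
        also have "ennreal (w z) * ennreal (1 / w z) = 1" using w_pos[of z] by (simp flip: ennreal_mult')
        finally show ?thesis using True t_le[OF True] q by (auto intro!: ennreal_powr_mono)
      qed simp
      then show "(\<integral>\<^sup>+z. ennreal_powr t (q - 1) * indicator ?Q z \<partial>lebesgue) \<le>
        (\<integral>\<^sup>+z. ennreal (w z) * (?g z * indicator (star 2 k (cell k x)) z) \<partial>lebesgue)" by (rule nn_integral_mono)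
    qed auto
    finally have "ennreal_powr (a / ennreal v) (q - 1) * emeasure (weighted w) ?Q \<le>
      ennreal (ratio_const 0) * (\<integral>\<^sup>+z. ?g z * indicator (star 2 k (cell k x)) z \<partial>weighted w)"
      by (simp add: mult_left_mono)
    then have "ennreal_powr (a / ennreal v) (q - 1) \<le>
      ennreal (ratio_const 0) * (\<integral>\<^sup>+z. ?g z * indicator (star 2 k (cell k x)) z \<partial>weighted w) / emeasure (weighted w) ?Q"
      by (subst ennreal_le_div_iff) (use W.cube_pos W.cube_fin in auto)
    also have "\<dots> = ennreal (ratio_const 0) * ((\<integral>\<^sup>+z. ?g z * indicator (star 2 k (cell k x)) z \<partial>weighted w) / emeasure (weighted w) ?Q)"
      by (rule ennreal_times_divide[symmetric])
    also have "\<dots> \<le> ennreal (ratio_const 0) * maxfn (weighted w) UNIV ?g x"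
      unfolding maxfn_def by (intro mult_left_mono SUP_upper) auto
    finally show ?thesis unfolding a_def v .
  qed
  then show ?thesis
    unfolding maxfn_def[of lebesgue] using q by (subst ennreal_powr_SUP) (simp, rule SUP_least)
qed

lemma maximal_bounded:
  "\<exists>C>0. \<forall>f::real ^ 'n \<Rightarrow> ennreal. f \<in> borel_measurable lebesgue \<longrightarrow>
    (\<integral>\<^sup>+x. ennreal_powr (maxfn lebesgue UNIV f x) q \<partial>weighted w) \<le> ennreal C * (\<integral>\<^sup>+x. ennreal_powr (f x) q \<partial>weighted w)"
proof -
  interpret W: doubling_measure "weighted w" "ratio_const 2 + 1" by (rule doubling)
  interpret dl: dual_weights \<sigma> w "q / (q - 1)" "A powr (1 / (q - 1))" by (rule dual)
  interpret S: doubling_measure "weighted \<sigma>" "dl.ratio_const 2 + 1" by (rule dl.doubling)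
  let ?p = "q / (q - 1)"
  have p: "1 < ?p" "0 < ?p" using conj_exponent(1) by auto
  obtain C1 where C1: "\<And>h. h \<in> borel_measurable (weighted w) \<Longrightarrow>
    (\<integral>\<^sup>+x. ennreal_powr (maxfn (weighted w) UNIV h x) ?p \<partial>weighted w) \<le> ennreal C1 * (\<integral>\<^sup>+x. ennreal_powr (h x) ?p \<partial>weighted w)"
    using W.strong_type[OF _ p(1)] by blast
  obtain C2 where C2: "\<And>h. h \<in> borel_measurable (weighted \<sigma>) \<Longrightarrow>
    (\<integral>\<^sup>+x. ennreal_powr (maxfn (weighted \<sigma>) UNIV h x) q \<partial>weighted \<sigma>) \<le> ennreal C2 * (\<integral>\<^sup>+x. ennreal_powr (h x) q \<partial>weighted \<sigma>)"
    using S.strong_type[OF _ q] by blast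
  define C0 where "C0 = ratio_const 0 powr ?p"
  have C0: "0 \<le> C0" by (simp add: C0_def)
  show ?thesis
  proof (intro exI[of _ "C0 * (\<bar>C1\<bar> * \<bar>C2\<bar>) + 1"] conjI allI impI)
    show "0 < C0 * (\<bar>C1\<bar> * \<bar>C2\<bar>) + 1" using C0 by (intro add_nonneg_pos mult_nonneg_nonneg) auto
    fix f :: "real ^ 'n \<Rightarrow> ennreal"
    assume f[measurable]: "f \<in> borel_measurable lebesgue"
    define u where "u = maxfn (weighted \<sigma>) UNIV (\<lambda>x. f x * ennreal (1 / \<sigma> x))"
    have [measurable]: "u \<in> borel_measurable lebesgue" unfolding u_def by measurable
    let ?g = "\<lambda>z. ennreal_powr (u z) (q - 1) * ennreal (1 / w z)"
    have "(\<integral>\<^sup>+x. ennreal_powr (maxfn lebesgue UNIV f x) q \<partial>weighted w) \<le>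
      (\<integral>\<^sup>+x. ennreal C0 * ennreal_powr (maxfn (weighted w) UNIV ?g x) ?p \<partial>weighted w)"
    proof (rule nn_integral_mono)
      fix x
      have "ennreal_powr (maxfn lebesgue UNIV f x) q = ennreal_powr (ennreal_powr (maxfn lebesgue UNIV f x) (q - 1)) ?p"
        using q by (simp add: ennreal_powr_powr)
      also have "\<dots> \<le> ennreal_powr (ennreal (ratio_const 0) * maxfn (weighted w) UNIV ?g x) ?p"
        unfolding u_def using p by (intro ennreal_powr_mono maxfn_dominated) auto
      also have "\<dots> = ennreal C0 * ennreal_powr (maxfn (weighted w) UNIV ?g x) ?p"
        unfolding C0_def using p ratio_const_pos[of 0] by (intro ennreal_powr_cmult) auto
      finally show "ennreal_powr (maxfn lebesgue UNIV f x) q \<le> ennreal C0 * ennreal_powr (maxfn (weighted w) UNIV ?g x) ?p" .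
    qed
    also have "\<dots> = ennreal C0 * (\<integral>\<^sup>+x. ennreal_powr (maxfn (weighted w) UNIV ?g x) ?p \<partial>weighted w)"
      by (rule nn_integral_cmult) measurable
    also have "\<dots> \<le> ennreal C0 * (ennreal C1 * (\<integral>\<^sup>+x. ennreal_powr (?g x) ?p \<partial>weighted w))"
      by (intro mult_left_mono C1) auto
    also have "(\<integral>\<^sup>+x. ennreal_powr (?g x) ?p \<partial>weighted w) = (\<integral>\<^sup>+x. ennreal_powr (u x) q \<partial>weighted \<sigma>)"
    proof -
      have "ennreal (w x) * ennreal_powr (?g x) ?p = ennreal (\<sigma> x) * ennreal_powr (u x) q" for x
      proof -
        have e: "1 - ?p = - 1 / (q - 1)" "(q - 1) * ?p = q" using q by (auto simp: field_simps)
        have "w x * (1 / w x) powr ?p = w x powr (1 - ?p)"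
          using w_pos[of x] by (simp add: powr_divide powr_diff)
        also have "\<dots> = \<sigma> x" by (simp only: sigma e)
        finally have "ennreal (w x) * ennreal ((1 / w x) powr ?p) = ennreal (\<sigma> x)"
          using w_pos[of x] by (simp flip: ennreal_mult')
        moreover have "ennreal_powr (?g x) ?p = ennreal_powr (u x) q * ennreal ((1 / w x) powr ?p)"
          using p w_pos[of x] by (subst ennreal_powr_mult) (simp_all only: ennreal_powr_powr e, simp add: ennreal_powr_ennreal less_imp_le)
        ultimately show ?thesis by (metis mult.assoc mult.commute)
      qed
      then show ?thesis by (simp add: nn_integral_density)
    qed
    also have "\<dots> \<le> ennreal C2 * (\<integral>\<^sup>+x. ennreal_powr (f x * ennreal (1 / \<sigma> x)) q \<partial>weighted \<sigma>)"
      unfolding u_def by (rule C2) measurable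
    also have "(\<integral>\<^sup>+x. ennreal_powr (f x * ennreal (1 / \<sigma> x)) q \<partial>weighted \<sigma>) = (\<integral>\<^sup>+x. ennreal_powr (f x) q \<partial>weighted w)"
    proof -
      have "ennreal (\<sigma> x) * ennreal_powr (f x * ennreal (1 / \<sigma> x)) q = ennreal (w x) * ennreal_powr (f x) q" for x
      proof -
        have e: "(1 - q) * (- 1 / (q - 1)) = 1" using q by (simp add: field_simps)
        have "\<sigma> x * (1 / \<sigma> x) powr q = \<sigma> x powr (1 - q)"
          using sigma_pos[of x] by (simp add: powr_divide powr_diff)
        also have "\<dots> = w x powr ((- 1 / (q - 1)) * (1 - q))" by (simp only: sigma powr_powr)
        also have "\<dots> = w x" using w_pos[of x] e by (simp only: mult.commute[of _ "1 - q"]) simp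
        finally have "ennreal (\<sigma> x) * ennreal ((1 / \<sigma> x) powr q) = ennreal (w x)"
          using sigma_pos[of x] by (simp flip: ennreal_mult')
        then show ?thesis using q sigma_pos[of x]
          by (simp add: ennreal_powr_mult ennreal_powr_ennreal less_imp_le) (metis mult.assoc mult.commute)
      qed
      then show ?thesis by (simp add: nn_integral_density)
    qed
    finally have "(\<integral>\<^sup>+x. ennreal_powr (maxfn lebesgue UNIV f x) q \<partial>weighted w) \<le>
      ennreal C0 * (ennreal C1 * (ennreal C2 * (\<integral>\<^sup>+x. ennreal_powr (f x) q \<partial>weighted w)))"
      by (simp add: mult_left_mono)
    also have "\<dots> \<le> ennreal C0 * (ennreal \<bar>C1\<bar> * (ennreal \<bar>C2\<bar> * (\<integral>\<^sup>+x. ennreal_powr (f x) q \<partial>weighted w)))"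
      by (intro mult_mono ennreal_leI) auto
    also have "\<dots> = ennreal (C0 * (\<bar>C1\<bar> * \<bar>C2\<bar>)) * (\<integral>\<^sup>+x. ennreal_powr (f x) q \<partial>weighted w)"
      using C0 by (simp add: ennreal_mult mult.assoc)
    also have "\<dots> \<le> ennreal (C0 * (\<bar>C1\<bar> * \<bar>C2\<bar>) + 1) * (\<integral>\<^sup>+x. ennreal_powr (f x) q \<partial>weighted w)"
      by (intro mult_right_mono ennreal_leI) auto
    finally show "(\<integral>\<^sup>+x. ennreal_powr (maxfn lebesgue UNIV f x) q \<partial>weighted w) \<le>
      ennreal (C0 * (\<bar>C1\<bar> * \<bar>C2\<bar>) + 1) * (\<integral>\<^sup>+x. ennreal_powr (f x) q \<partial>weighted w)" .
  qed
qed

end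

section \<open>Geometric sums and masses\<close>

text \<open>The sum of the series of \<open>2 powr (- \<delta> * d)\<close> over \<open>d \<ge> 0\<close>.\<close>

definition geo :: "real \<Rightarrow> real" where "geo \<delta> = 1 / (1 - 2 powr (- \<delta>))"

lemma geo_pos: "0 < \<delta> \<Longrightarrow> 0 < geo \<delta>"
  by (simp add: geo_def powr_less_one)

lemma geo_sum_nat:
  assumes "0 < \<delta>" "finite S"
  shows "(\<Sum>d\<in>S. 2 powr (- \<delta> * real d)) \<le> geo \<delta>"
proof -
  have x: "norm (2 powr (- \<delta>)) < (1::real)" using assms by (simp add: powr_less_one)
  have "(\<Sum>d\<in>S. 2 powr (- \<delta> * real d)) = (\<Sum>d\<in>S. (2 powr (- \<delta>)) ^ d)"
    by (simp add: powr_powr flip: powr_realpow)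
  also have "\<dots> \<le> (\<Sum>d. (2 powr (- \<delta>)) ^ d)"
    using assms x by (intro sum_le_suminf summable_geometric) auto
  also have "\<dots> = geo \<delta>" using x by (simp add: suminf_geometric geo_def)
  finally show ?thesis .
qed

lemma geo_sum_below:
  assumes "0 < \<delta>" "finite S" "\<And>j. j \<in> S \<Longrightarrow> j \<le> (k::int)"
  shows "(\<Sum>j\<in>S. 2 powr (\<delta> * of_int (j - k))) \<le> geo \<delta>"
proof -
  have "(\<Sum>j\<in>S. 2 powr (\<delta> * of_int (j - k))) = (\<Sum>d\<in>(\<lambda>j. nat (k - j)) ` S. 2 powr (- \<delta> * real d))"
  proof (subst sum.reindex)
    show "inj_on (\<lambda>j. nat (k - j)) S"
    proof (rule inj_onI)
      fix x y assume "x \<in> S" "y \<in> S" "nat (k - x) = nat (k - y)"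
      then show "x = y" using assms(3)[of x] assms(3)[of y] by simp
    qed
    have "- \<delta> * real (nat (k - j)) = \<delta> * of_int (j - k)" if "j \<in> S" for j
      using assms(3)[OF that] by (simp add: algebra_simps)
    then show "(\<Sum>j\<in>S. 2 powr (\<delta> * of_int (j - k))) = sum ((\<lambda>d. 2 powr (- \<delta> * real d)) \<circ> (\<lambda>j. nat (k - j))) S"
      by (intro sum.cong) auto
  qed
  also have "\<dots> \<le> geo \<delta>" using assms by (intro geo_sum_nat) auto
  finally show ?thesis .
qed

lemma geo_sum_above:
  assumes "0 < \<delta>" "finite S" "\<And>k. k \<in> S \<Longrightarrow> (j::int) \<le> k"
  shows "(\<Sum>k\<in>S. 2 powr (\<delta> * of_int (j - k))) \<le> geo \<delta>"
proof -
  have "(\<Sum>k\<in>S. 2 powr (\<delta> * of_int (j - k))) = (\<Sum>k\<in>uminus ` S. 2 powr (\<delta> * of_int (k - (- j))))"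
    by (subst sum.reindex) (auto simp: inj_on_def)
  also have "\<dots> \<le> geo \<delta>" using assms by (intro geo_sum_below) auto
  finally show ?thesis .
qed

lemma powi_ratio: "2 powi j / 2 powi k = (2::real) powr of_int (j - k)"
  by (subst powr_real_of_int') (simp_all add: power_int_diff)

lemma vol_ratio: "(2 powi j) ^ n = (2 powi k) ^ n * (2::real) powr (real n * of_int (j - k))"
proof -
  have "(2 powi j / 2 powi k) ^ n = (2::real) powr (real n * of_int (j - k))"
    unfolding powi_ratio by (simp add: powr_powr mult.commute flip: powr_realpow)
  then show ?thesis by (simp add: power_divide field_simps)
qed

definition mass :: "(real ^ 'n \<Rightarrow> complex) \<Rightarrow> (real ^ 'n) set \<Rightarrow> real" where
  "mass f S = (LINT z|lebesgue. indicator S z * norm (f z))"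

lemma mass_integrable:
  fixes f :: "real ^ 'n \<Rightarrow> complex"
  assumes "integrable lebesgue f" "S \<in> sets lebesgue"
  shows "integrable lebesgue (\<lambda>z. indicator S z * norm (f z))"
proof (rule Bochner_Integration.integrable_bound[OF integrable_norm[OF assms(1)]])
  show "(\<lambda>z. indicator S z * norm (f z)) \<in> borel_measurable lebesgue"
    using assms by (intro borel_measurable_times borel_measurable_norm borel_measurable_indicator) auto
qed (auto simp: indicator_def)

lemma mass_nonneg: "0 \<le> mass f S"
  unfolding mass_def by (intro integral_nonneg_AE) auto

lemma mass_sum_le:
  fixes f :: "real ^ 'n \<Rightarrow> complex"
  assumes "integrable lebesgue f" "finite I" "\<And>i. i \<in> I \<Longrightarrow> S i \<in> sets lebesgue" "T \<in> sets lebesgue"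
    and "\<And>z. (\<Sum>i\<in>I. c i * indicator (S i) z) \<le> (C::real) * indicator T z"
  shows "(\<Sum>i\<in>I. c i * mass f (S i)) \<le> C * mass f T"
proof -
  have "(\<Sum>i\<in>I. c i * mass f (S i)) = (LINT z|lebesgue. (\<Sum>i\<in>I. c i * (indicator (S i) z * norm (f z))))"
    unfolding mass_def using assms by (subst Bochner_Integration.integral_sum) (auto intro!: mass_integrable)
  also have "\<dots> \<le> (LINT z|lebesgue. C * (indicator T z * norm (f z)))"
  proof (rule integral_mono)
    show "integrable lebesgue (\<lambda>z. (\<Sum>i\<in>I. c i * (indicator (S i) z * norm (f z))))"
      using assms by (auto intro!: Bochner_Integration.integrable_sum integrable_mult_right mass_integrable)
    show "integrable lebesgue (\<lambda>z. C * (indicator T z * norm (f z)))"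
      using assms by (auto intro!: mass_integrable)
    fix z
    have "(\<Sum>i\<in>I. c i * (indicator (S i) z * norm (f z))) = (\<Sum>i\<in>I. c i * indicator (S i) z) * norm (f z)"
      by (simp add: sum_distrib_right mult.assoc)
    also have "\<dots> \<le> C * indicator T z * norm (f z)" by (intro mult_right_mono assms) auto
    finally show "(\<Sum>i\<in>I. c i * (indicator (S i) z * norm (f z))) \<le> C * (indicator T z * norm (f z))" by (simp add: mult.assoc)
  qed
  also have "\<dots> = C * mass f T" by (simp add: mass_def)
  finally show ?thesis .
qed

lemma mass_mono:
  assumes "integrable lebesgue f" "S \<subseteq> T" "S \<in> sets lebesgue" "T \<in> sets lebesgue"
  shows "mass f S \<le> mass f T"
  using mass_sum_le[of f "{()}" "\<lambda>_. S" T "\<lambda>_. 1" 1] assms by (auto simp: indicator_def)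

section \<open>Kernels adapted to dyadic cubes\<close>

text \<open>Size, smoothness, cancellation and localization of the functions \<open>\<phi>\<^sub>t\<close> with \<open>t\<close> about \<open>2 powi k\<close>, with the
  centre blurred to a cube: one such class serves all points \<open>(y, t)\<close> of a piece of the half space.\<close>

definition kernel :: "real \<Rightarrow> int \<Rightarrow> int ^ 'n \<Rightarrow> (real ^ 'n \<Rightarrow> complex) set" where
  "kernel \<gamma> k m = {\<psi>. \<psi> \<in> borel_measurable lebesgue \<and> (LINT z|lebesgue. \<psi> z) = 0 \<and>
     (\<forall>z. \<psi> z \<noteq> 0 \<longrightarrow> z \<in> star 1 k m) \<and> (\<forall>z. norm (\<psi> z) \<le> 2 / (2 powi k) ^ CARD('n)) \<and>
     (\<forall>z z'. norm (\<psi> z - \<psi> z') \<le> (norm (z - z') / 2 powi k) powr \<gamma> / (2 powi k) ^ CARD('n))}"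

lemma zero_kernel: "(\<lambda>z. 0) \<in> kernel \<gamma> k m"
  by (auto simp: kernel_def)

lemma kernelD:
  assumes "\<psi> \<in> kernel \<gamma> k (m :: int ^ 'n)"
  shows kernel_measurable: "\<psi> \<in> borel_measurable lebesgue"
    and kernel_integral: "(LINT z|lebesgue. \<psi> z) = 0"
    and kernel_support: "\<psi> z \<noteq> 0 \<Longrightarrow> near 1 m (cell k z)"
    and kernel_bound: "norm (\<psi> z) \<le> 2 / (2 powi k) ^ CARD('n)"
    and kernel_Hoelder: "norm (\<psi> z - \<psi> z') \<le> (norm (z - z') / 2 powi k) powr \<gamma> / (2 powi k) ^ CARD('n)"
  using assms unfolding kernel_def by auto

lemma kernel_indicator:
  assumes "\<psi> \<in> kernel \<gamma> k (m :: int ^ 'n)"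
  shows "norm (\<psi> z) \<le> 2 / (2 powi k) ^ CARD('n) * indicator (star 1 k m) z"
  using kernel_bound[OF assms, of z] kernel_support[OF assms, of z] by (auto simp: indicator_def)

lemma integrable_star_indicator: "integrable lebesgue (\<lambda>z. c * indicator (star 1 k m) z :: real)"
  using emeasure_star_finite[of 1 k m] by (intro integrable_mult_right) auto

lemma kernel_integrable:
  assumes "\<psi> \<in> kernel \<gamma> k (m :: int ^ 'n)"
  shows "integrable lebesgue \<psi>" "(LINT z|lebesgue. norm (\<psi> z)) \<le> 2 * 3 ^ CARD('n)"
proof -
  let ?c = "2 / (2 powi k) ^ CARD('n)"
  show i: "integrable lebesgue \<psi>"
    by (rule Bochner_Integration.integrable_bound[OF integrable_star_indicator[of ?c k m]])
       (use kernel_measurable[OF assms] kernel_indicator[OF assms] in auto)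
  have "(LINT z|lebesgue. norm (\<psi> z)) \<le> (LINT z|lebesgue. ?c * indicator (star 1 k m) z)"
    using i by (intro integral_mono integrable_star_indicator kernel_indicator[OF assms] integrable_norm)
  also have "\<dots> = ?c * measure lebesgue (star 1 k m)" by simp
  also have "measure lebesgue (star 1 k m) = 3 ^ CARD('n) * (2 powi k) ^ CARD('n)"
    using emeasure_star[of 1 k m] by (simp add: measure_def)
  finally show "(LINT z|lebesgue. norm (\<psi> z)) \<le> 2 * 3 ^ CARD('n)" by simp
qed

lemma kernel_mult_integrable:
  assumes "\<psi> \<in> kernel \<gamma> k (m :: int ^ 'n)" "integrable lebesgue f"
  shows "integrable lebesgue (\<lambda>z. f z * \<psi> z)"
proof (rule Bochner_Integration.integrable_bound[of _ "\<lambda>z. 2 / (2 powi k) ^ CARD('n) * norm (f z)"])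
  show "(\<lambda>z. f z * \<psi> z) \<in> borel_measurable lebesgue"
    using kernel_measurable[OF assms(1)] assms(2) by (intro borel_measurable_times) auto
  show "AE z in lebesgue. norm (f z * \<psi> z) \<le> norm (2 / (2 powi k) ^ CARD('n) * norm (f z))"
  proof (rule AE_I2)
    fix z show "norm (f z * \<psi> z) \<le> norm (2 / (2 powi k) ^ CARD('n) * norm (f z))"
      using mult_right_mono[OF kernel_bound[OF assms(1), of z], of "norm (f z)"] by (simp add: norm_mult mult.commute)
  qed
qed (use assms in auto)

lemma pairing_bound:
  assumes "\<psi> \<in> kernel \<gamma> k (m :: int ^ 'n)" "integrable lebesgue f"
  shows "norm (LINT z|lebesgue. f z * \<psi> z) \<le> 2 / (2 powi k) ^ CARD('n) * mass f (star 1 k m)"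
proof -
  have "norm (LINT z|lebesgue. f z * \<psi> z) \<le> (LINT z|lebesgue. norm (f z * \<psi> z))"
    by simp
  also have "\<dots> \<le> (LINT z|lebesgue. 2 / (2 powi k) ^ CARD('n) * (indicator (star 1 k m) z * norm (f z)))"
  proof (intro integral_mono integrable_norm kernel_mult_integrable[OF assms] assms integrable_mult_right mass_integrable)
    fix z show "norm (f z * \<psi> z) \<le> 2 / (2 powi k) ^ CARD('n) * (indicator (star 1 k m) z * norm (f z))"
      using mult_right_mono[OF kernel_indicator[OF assms(1), of z], of "norm (f z)"] by (simp add: norm_mult mult_ac)
  qed auto
  finally show ?thesis by (simp add: mass_def)
qed

text \<open>A mean-zero function living at a finer scale sees only the oscillation of the kernel.\<close>

lemma pairing_cancel:
  fixes m :: "int ^ 'n"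
  assumes \<psi>: "\<psi> \<in> kernel \<gamma> k m" and \<gamma>: "0 < \<gamma>" "\<gamma> \<le> 1"
    and b: "integrable lebesgue b" "(LINT z|lebesgue. b z) = 0" "\<And>z. b z \<noteq> 0 \<Longrightarrow> near 1 m0 (cell j z)"
  shows "norm (LINT z|lebesgue. b z * \<psi> z) \<le>
    3 * real CARD('n) * 2 powr (\<gamma> * of_int (j - k)) / (2 powi k) ^ CARD('n) * (LINT z|lebesgue. norm (b z))"
proof (cases "\<exists>z. b z \<noteq> 0")
  case False
  then have "\<And>z. b z = 0" by blast
  then show ?thesis by simp
next
  case True
  then obtain z0 where z0: "b z0 \<noteq> 0" by blast
  let ?K = "3 * real CARD('n) * 2 powr (\<gamma> * of_int (j - k)) / (2 powi k) ^ CARD('n)"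
  have osc: "norm (\<psi> z - \<psi> z0) \<le> ?K" if "b z \<noteq> 0" for z
  proof -
    have "near (1 + 1) (cell j z) (cell j z0)"
      using b(3)[OF that] b(3)[OF z0] near_trans near_sym by blast
    from near_cell_norm[OF this] have "norm (z - z0) \<le> 3 * real CARD('n) * 2 powi j" by simp
    then have "norm (z - z0) / 2 powi k \<le> 3 * real CARD('n) * 2 powi j / 2 powi k"
      by (intro divide_right_mono) auto
    also have "\<dots> = 3 * real CARD('n) * 2 powr of_int (j - k)"
      unfolding powi_ratio[symmetric] by simp
    finally have "(norm (z - z0) / 2 powi k) powr \<gamma> \<le> (3 * real CARD('n) * 2 powr of_int (j - k)) powr \<gamma>"
      using \<gamma> by (intro powr_mono2) auto
    also have "\<dots> = (3 * real CARD('n)) powr \<gamma> * 2 powr (\<gamma> * of_int (j - k))"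
      by (simp add: powr_mult powr_powr mult.commute)
    also have "\<dots> \<le> (3 * real CARD('n)) powr 1 * 2 powr (\<gamma> * of_int (j - k))"
    proof -
      have "1 \<le> real CARD('n)" by (simp add: Suc_le_eq)
      then have "1 \<le> 3 * real CARD('n)" by linarith
      then have "(3 * real CARD('n)) powr \<gamma> \<le> (3 * real CARD('n)) powr 1" by (rule powr_mono[OF \<gamma>(2)])
      then show ?thesis by (intro mult_right_mono) simp_all
    qed
    finally have "(norm (z - z0) / 2 powi k) powr \<gamma> \<le> 3 * real CARD('n) * 2 powr (\<gamma> * of_int (j - k))" by simp
    then have "(norm (z - z0) / 2 powi k) powr \<gamma> / (2 powi k) ^ CARD('n) \<le> ?K" by (intro divide_right_mono) auto
    then show ?thesis using kernel_Hoelder[OF \<psi>, of z z0] by linarith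
  qed
  have i: "integrable lebesgue (\<lambda>z. b z * (\<psi> z - \<psi> z0))"
    using kernel_mult_integrable[OF \<psi> b(1)] b(1) by (simp add: algebra_simps)
  have "(LINT z|lebesgue. b z * \<psi> z) = (LINT z|lebesgue. b z * (\<psi> z - \<psi> z0))"
  proof -
    have "(LINT z|lebesgue. b z * (\<psi> z - \<psi> z0)) = (LINT z|lebesgue. b z * \<psi> z) - (LINT z|lebesgue. b z * \<psi> z0)"
      using kernel_mult_integrable[OF \<psi> b(1)] b(1) by (simp add: right_diff_distrib)
    then show ?thesis using b by simp
  qed
  then have "norm (LINT z|lebesgue. b z * \<psi> z) \<le> (LINT z|lebesgue. norm (b z * (\<psi> z - \<psi> z0)))" by simp
  also have "\<dots> \<le> (LINT z|lebesgue. ?K * norm (b z))"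
  proof (intro integral_mono integrable_norm i integrable_mult_right b)
    fix z show "norm (b z * (\<psi> z - \<psi> z0)) \<le> ?K * norm (b z)"
    proof (cases "b z = 0")
      case False
      then show ?thesis using mult_right_mono[OF osc[OF False], of "norm (b z)"] by (simp only: norm_mult mult.commute norm_ge_zero)
    qed simp
  qed
  finally show ?thesis by simp
qed

section \<open>Almost orthogonality\<close>

lemma sum_by_levels:
  fixes F :: "(int \<times> (int ^ 'n)) set" and h :: "int \<Rightarrow> real"
  assumes "finite S" "\<And>k. finite (T k)" "F \<subseteq> Sigma S T" "\<And>k. 0 \<le> h k"
  shows "(\<Sum>p\<in>F. h (fst p)) \<le> (\<Sum>k\<in>S. real (card (T k)) * h k)"
proof -
  have "(\<Sum>p\<in>F. h (fst p)) \<le> (\<Sum>p\<in>Sigma S T. h (fst p))"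
    using assms by (intro sum_mono2) auto
  also have "\<dots> = (\<Sum>k\<in>S. \<Sum>m\<in>T k. h k)"
    using assms by (subst sum.Sigma) (auto simp: split_beta)
  finally show ?thesis by simp
qed

definition bessel_const :: "'n::finite itself \<Rightarrow> real \<Rightarrow> real" where
  "bessel_const _ \<gamma> = 12 * real CARD('n) * 15 ^ CARD('n) * geo \<gamma>"

text \<open>The bound is the \<open>T T\<^sup>*\<close> principle: expanding \<open>0 \<le> \<integral> \<bar>g - \<tau> \<Sum> d \<psi>\<^sup>-\<bar>\<^sup>2\<close> reduces it to Schur's test for
  the Gram matrix, whose entries decay geometrically in the distance between the scales.\<close>

lemma bessel:
  fixes \<psi> :: "int \<Rightarrow> int ^ 'n \<Rightarrow> real ^ 'n \<Rightarrow> complex"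
  assumes \<gamma>: "0 < \<gamma>" "\<gamma> \<le> 1" and F: "finite F" and \<psi>: "\<And>k m. (k, m) \<in> F \<Longrightarrow> \<psi> k m \<in> kernel \<gamma> k m"
    and g: "integrable lebesgue g" "integrable lebesgue (\<lambda>z. (norm (g z))\<^sup>2)"
  shows "(\<Sum>(k, m)\<in>F. (2 powi k) ^ CARD('n) * (norm (LINT z|lebesgue. g z * \<psi> k m z))\<^sup>2)
    \<le> bessel_const TYPE('n) \<gamma> * (LINT z|lebesgue. (norm (g z))\<^sup>2)"
proof -
  define V :: "int \<Rightarrow> real" where "V k = (2 powi k) ^ CARD('n)" for k
  have V: "0 < V k" for k by (simp add: V_def)
  define P where "P p = \<psi> (fst p) (snd p)" for p
  have P: "P p \<in> kernel \<gamma> (fst p) (snd p)" if "p \<in> F" for p using \<psi> that by (simp add: P_def)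
  define c where "c p = (LINT z|lebesgue. g z * P p z)" for p
  define M where "M p r = norm (LINT z|lebesgue. cnj (P p z) * P r z)" for p r
  define X where "X = (\<Sum>p\<in>F. V (fst p) * (norm (c p))\<^sup>2)"
  have X0: "0 \<le> X" unfolding X_def using V by (intro sum_nonneg mult_nonneg_nonneg) (auto simp: less_imp_le)
  define C0 where "C0 = bessel_const TYPE('n) \<gamma>"
  have C0: "0 < C0" using geo_pos[OF \<gamma>(1)] by (simp add: C0_def bessel_const_def)
  have cP: "(\<lambda>z. cnj (P p z)) \<in> kernel \<gamma> (fst p) (snd p)" if "p \<in> F" for p
    using P[OF that] borel_measurable_continuous_on[OF continuous_on_cnj[OF continuous_on_id]]
    by (auto simp: kernel_def simp flip: complex_cnj_diff)
  have ii: "integrable lebesgue (\<lambda>z. cnj (P p z) * P r z)" if "p \<in> F" "r \<in> F" for p r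
    by (rule kernel_mult_integrable[OF P[OF that(2)] kernel_integrable(1)[OF cP[OF that(1)]]])
  have M_sym: "M p r = M r p" for p r
  proof -
    have "(LINT z|lebesgue. cnj (P p z) * P r z) = (LINT z|lebesgue. cnj (cnj (P r z) * P p z))"
      by (simp add: mult.commute)
    also have "\<dots> = cnj (LINT z|lebesgue. cnj (P r z) * P p z)" by (rule Bochner_Integration.integral_cnj)
    finally show ?thesis by (simp add: M_def)
  qed
  define nr where "nr p r \<longleftrightarrow> fst p \<le> fst r \<and> near 2 (snd r) (coarsen (nat (fst r - fst p)) (snd p))"
    for p r :: "int \<times> (int ^ 'n)"
  let ?K = "6 * real CARD('n) * 3 ^ CARD('n) :: real"
  have M_le: "V (fst r) * M p r \<le> ?K * 2 powr (\<gamma> * of_int (fst p - fst r)) * of_bool (nr p r)"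
    if "p \<in> F" "r \<in> F" "fst p \<le> fst r" for p r
  proof (cases "nr p r")
    case True
    have "M p r \<le> 3 * real CARD('n) * 2 powr (\<gamma> * of_int (fst p - fst r)) / V (fst r) * (LINT z|lebesgue. norm (cnj (P p z)))"
      unfolding M_def V_def
      using kernel_integrable(1)[OF cP[OF that(1)]] kernel_integral[OF cP[OF that(1)]] kernel_support[OF cP[OF that(1)]]
      by (intro pairing_cancel[OF P[OF that(2)] \<gamma>]) auto
    also have "\<dots> \<le> 3 * real CARD('n) * 2 powr (\<gamma> * of_int (fst p - fst r)) / V (fst r) * (2 * 3 ^ CARD('n))"
      using V[of "fst r"] by (intro mult_left_mono kernel_integrable(2)[OF cP[OF that(1)]]) auto
    finally show ?thesis using True V[of "fst r"] by (simp add: field_simps)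
  next
    case False
    have "cnj (P p z) * P r z = 0" for z
    proof (rule ccontr)
      assume "cnj (P p z) * P r z \<noteq> 0"
      then have "near 1 (snd p) (cell (fst p) z)" "near 1 (snd r) (cell (fst r) z)"
        using kernel_support[OF P[OF that(1)], of z] kernel_support[OF P[OF that(2)], of z] by auto
      then have "near 1 (coarsen (nat (fst r - fst p)) (snd p)) (cell (fst r) z)"
        using that(3) near_coarsen by (metis cell_coarsen')
      then have "near (1 + 1) (snd r) (coarsen (nat (fst r - fst p)) (snd p))"
        using \<open>near 1 (snd r) (cell (fst r) z)\<close> near_trans near_sym by blast
      then show False using False that(3) by (simp add: nr_def)
    qed
    then have "(\<lambda>z. cnj (P p z) * P r z) = (\<lambda>z. 0)" by blast
    then have "M p r = 0" unfolding M_def by simp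
    then show ?thesis using False by simp
  qed
  define Y where "Y = (\<Sum>p\<in>F. \<Sum>r\<in>F. V (fst p) * V (fst r) * (norm (c p) * norm (c r)) * M p r)"
  have Y_le: "Y \<le> C0 * X"
  proof -
    let ?T = "\<lambda>p r. V (fst p) * V (fst r) * (norm (c p) * norm (c r)) * M p r"
    let ?e = "\<lambda>p r. 2 powr (\<gamma> * of_int (fst p - fst r)) * of_bool (nr p r) :: real"
    have T_sym: "?T p r = ?T r p" for p r by (simp add: M_sym[of p r] mult_ac)
    have T_le: "?T p r \<le> ?K / 2 * (V (fst p) * (norm (c p))\<^sup>2 * ?e p r + V (fst p) * ?e p r * (norm (c r))\<^sup>2)"
      if "p \<in> F" "r \<in> F" "fst p \<le> fst r" for p r
    proof -
      have "?T p r = V (fst p) * (norm (c p) * norm (c r)) * (V (fst r) * M p r)" by (simp add: mult_ac)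
      also have "\<dots> \<le> V (fst p) * (norm (c p) * norm (c r)) * (?K * ?e p r)"
        using M_le[OF that] V[of "fst p"] by (intro mult_left_mono) (auto simp: mult.assoc)
      also have "\<dots> = ?K * V (fst p) * ?e p r * (norm (c p) * norm (c r))" by (simp add: mult_ac)
      also have "\<dots> \<le> ?K * V (fst p) * ?e p r * (((norm (c p))\<^sup>2 + (norm (c r))\<^sup>2) / 2)"
      proof (rule mult_left_mono)
        show "norm (c p) * norm (c r) \<le> ((norm (c p))\<^sup>2 + (norm (c r))\<^sup>2) / 2"
          using sum_squares_bound[of "norm (c p)" "norm (c r)"] by simp
      qed (use V[of "fst p"] in auto)
      finally show ?thesis by (simp add: algebra_simps)
    qed
    let ?U = "\<lambda>p r. ?K / 2 * (V (fst p) * (norm (c p))\<^sup>2 * ?e p r + V (fst p) * ?e p r * (norm (c r))\<^sup>2)"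
    have U0: "0 \<le> ?U p r" for p r
      using V[of "fst p"] by auto
    have "Y \<le> (\<Sum>p\<in>F. \<Sum>r\<in>F. ?U p r + ?U r p)"
      unfolding Y_def
    proof (intro sum_mono)
      fix p r assume pr: "p \<in> F" "r \<in> F"
      show "?T p r \<le> ?U p r + ?U r p"
      proof (cases "fst p \<le> fst r")
        case True
        show ?thesis using T_le[OF pr True] U0[of r p] by linarith
      next
        case False
        then have "fst r \<le> fst p" by simp
        from T_le[OF pr(2) pr(1) this] show ?thesis using U0[of p r] T_sym[of p r] by linarith
      qed
    qed
    also have "\<dots> = 2 * (\<Sum>p\<in>F. \<Sum>r\<in>F. ?U p r)"
      by (simp only: sum.distrib sum.swap[of "\<lambda>p r. ?U r p" F F] mult_2)
    also have "(\<Sum>p\<in>F. \<Sum>r\<in>F. ?U p r) = ?K / 2 * ((\<Sum>p\<in>F. V (fst p) * (norm (c p))\<^sup>2 * (\<Sum>r\<in>F. ?e p r)) + (\<Sum>r\<in>F. (norm (c r))\<^sup>2 * (\<Sum>p\<in>F. V (fst p) * ?e p r)))"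
    proof -
      have "(\<Sum>p\<in>F. \<Sum>r\<in>F. V (fst p) * ?e p r * (norm (c r))\<^sup>2) = (\<Sum>r\<in>F. \<Sum>p\<in>F. V (fst p) * ?e p r * (norm (c r))\<^sup>2)"
        by (rule sum.swap)
      then show ?thesis
        by (simp only: sum.distrib distrib_left sum_distrib_left[symmetric])
           (simp only: sum_distrib_left sum_distrib_right mult_ac)
    qed
    also have "\<dots> \<le> ?K / 2 * ((\<Sum>p\<in>F. V (fst p) * (norm (c p))\<^sup>2 * (5 ^ CARD('n) * geo \<gamma>)) + (\<Sum>r\<in>F. (norm (c r))\<^sup>2 * (V (fst r) * (5 ^ CARD('n) * geo \<gamma>))))"
    proof (intro mult_left_mono add_mono sum_mono)
      fix p assume "p \<in> F"
      let ?S = "{k \<in> fst ` F. fst p \<le> k}"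
      let ?N = "\<lambda>k. {m. near 2 m (coarsen (nat (k - fst p)) (snd p))}"
      have N: "?N k = {m. near 2 (coarsen (nat (k - fst p)) (snd p)) m}" for k by (simp add: near_sym[of 2])
      have "(\<Sum>r\<in>F. ?e p r) = (\<Sum>r\<in>{r \<in> F. nr p r}. 2 powr (\<gamma> * of_int (fst p - fst r)))"
        using F by (simp add: sum.inter_filter of_bool_def if_distrib cong: if_cong)
      also have "\<dots> \<le> (\<Sum>k\<in>?S. real (card (?N k)) * 2 powr (\<gamma> * of_int (fst p - k)))"
        using F near_count(1)[of 2] unfolding N by (intro sum_by_levels[where h = "\<lambda>k. 2 powr (\<gamma> * of_int (fst p - k))"]) (auto simp: nr_def near_sym[of 2] intro: rev_image_eqI)
      also have "\<dots> = 5 ^ CARD('n) * (\<Sum>k\<in>?S. 2 powr (\<gamma> * of_int (fst p - k)))"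
        unfolding N by (subst near_count(2)) (auto simp: sum_distrib_left)
      also have "\<dots> \<le> 5 ^ CARD('n) * geo \<gamma>"
        using F \<gamma> by (intro mult_left_mono geo_sum_above) auto
      finally show "(\<Sum>r\<in>F. ?e p r) \<le> 5 ^ CARD('n) * geo \<gamma>" .
      show "0 \<le> V (fst p) * (norm (c p))\<^sup>2" using V[of "fst p"] by simp
    next
      fix r assume "r \<in> F"
      let ?S = "{k \<in> fst ` F. k \<le> fst r}"
      let ?N = "\<lambda>k. {m. near 2 (snd r) (coarsen (nat (fst r - k)) m)}"
      have "(\<Sum>p\<in>F. V (fst p) * ?e p r) = (\<Sum>p\<in>{p \<in> F. nr p r}. V (fst p) * 2 powr (\<gamma> * of_int (fst p - fst r)))"
        using F by (simp add: sum.inter_filter of_bool_def if_distrib cong: if_cong)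
      also have "\<dots> \<le> (\<Sum>k\<in>?S. real (card (?N k)) * (V k * 2 powr (\<gamma> * of_int (k - fst r))))"
        using F near_coarsen_count(1)[of 2] V
        by (intro sum_by_levels[where h = "\<lambda>k. V k * 2 powr (\<gamma> * of_int (k - fst r))"]) (auto simp: nr_def less_imp_le intro: rev_image_eqI)
      also have "\<dots> = (\<Sum>k\<in>?S. V (fst r) * 5 ^ CARD('n) * 2 powr (\<gamma> * of_int (k - fst r)))"
      proof (rule sum.cong[OF refl])
        fix k assume k: "k \<in> ?S"
        have "(2::real) ^ nat (fst r - k) * 2 powi k = 2 powi (fst r)"
          using k power_int_add[of "2::real" k "fst r - k"] by (simp add: power_int_def[of _ "fst r - k"] mult.commute)
        then have "(2 ^ nat (fst r - k)) ^ CARD('n) * V k = V (fst r)"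
          by (simp add: V_def flip: power_mult_distrib)
        then show "real (card (?N k)) * (V k * 2 powr (\<gamma> * of_int (k - fst r))) = V (fst r) * 5 ^ CARD('n) * 2 powr (\<gamma> * of_int (k - fst r))"
          by (subst near_coarsen_count(2)) (auto simp: power_mult_distrib mult_ac)
      qed
      also have "\<dots> = V (fst r) * 5 ^ CARD('n) * (\<Sum>k\<in>?S. 2 powr (\<gamma> * of_int (k - fst r)))"
        by (simp add: sum_distrib_left)
      also have "\<dots> \<le> V (fst r) * 5 ^ CARD('n) * geo \<gamma>"
        using F \<gamma> V[of "fst r"] by (intro mult_left_mono geo_sum_below) auto
      finally show "(\<Sum>p\<in>F. V (fst p) * ?e p r) \<le> V (fst r) * (5 ^ CARD('n) * geo \<gamma>)" by simp
    qed auto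
    also have "\<dots> = ?K * (5 ^ CARD('n) * geo \<gamma>) * X"
    proof -
      have "(\<Sum>p\<in>F. V (fst p) * (norm (c p))\<^sup>2 * (5 ^ CARD('n) * geo \<gamma>)) = X * (5 ^ CARD('n) * geo \<gamma>)"
        by (simp only: X_def sum_distrib_right)
      moreover have "(\<Sum>r\<in>F. (norm (c r))\<^sup>2 * (V (fst r) * (5 ^ CARD('n) * geo \<gamma>))) = X * (5 ^ CARD('n) * geo \<gamma>)"
        unfolding X_def sum_distrib_right by (intro sum.cong refl) (simp only: ac_simps)
      ultimately show ?thesis by (simp only:) simp
    qed
    also have "2 * (?K * (5 ^ CARD('n) * geo \<gamma>) * X) = C0 * X"
    proof -
      have "(15::real) ^ CARD('n) = 3 ^ CARD('n) * 5 ^ CARD('n)" by (simp flip: power_mult_distrib)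
      then show ?thesis by (simp add: C0_def bessel_const_def)
    qed
    finally show ?thesis by simp
  qed
  define \<tau> where "\<tau> = 1 / C0"
  define d where "d p = of_real (V (fst p)) * c p" for p
  define h where "h z = (\<Sum>p\<in>F. d p * cnj (P p z))" for z
  have Re1: "norm (g z - of_real \<tau> * h z)^2 = norm (g z)^2 - 2 * \<tau> * Re (g z * cnj (h z)) + \<tau>^2 * Re (h z * cnj (h z))" for z
    by (simp add: cmod_power2) (simp add: power2_eq_square algebra_simps)
  have gh: "g z * cnj (h z) = (\<Sum>p\<in>F. cnj (d p) * (g z * P p z))" for z
    by (simp add: h_def sum_distrib_left mult_ac)
  have hh: "h z * cnj (h z) = (\<Sum>p\<in>F. \<Sum>r\<in>F. d p * cnj (d r) * (cnj (P p z) * P r z))" for z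
    by (simp add: h_def sum_product mult_ac)
  have igh: "integrable lebesgue (\<lambda>z. g z * cnj (h z))"
    unfolding gh using kernel_mult_integrable[OF P g(1)] by (intro Bochner_Integration.integrable_sum integrable_mult_right) auto
  have ihh: "integrable lebesgue (\<lambda>z. h z * cnj (h z))"
    unfolding hh using ii by (intro Bochner_Integration.integrable_sum integrable_mult_right) auto
  have Igh: "(LINT z|lebesgue. g z * cnj (h z)) = of_real X"
  proof -
    have "(LINT z|lebesgue. g z * cnj (h z)) = (\<Sum>p\<in>F. cnj (d p) * c p)"
      unfolding gh c_def using kernel_mult_integrable[OF P g(1)]
      by (subst Bochner_Integration.integral_sum) (auto intro!: integrable_mult_right)
    also have "\<dots> = (\<Sum>p\<in>F. of_real (V (fst p) * (norm (c p))\<^sup>2))"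
      by (intro sum.cong refl) (simp add: d_def complex_norm_square mult.commute mult.left_commute del: of_real_power)
    finally show ?thesis by (simp add: X_def)
  qed
  have Ihh: "Re (LINT z|lebesgue. h z * cnj (h z)) \<le> Y"
  proof -
    have "(LINT z|lebesgue. h z * cnj (h z)) = (\<Sum>p\<in>F. \<Sum>r\<in>F. d p * cnj (d r) * (LINT z|lebesgue. cnj (P p z) * P r z))"
      unfolding hh using ii
      by (subst Bochner_Integration.integral_sum, auto intro!: Bochner_Integration.integrable_sum integrable_mult_right)
    then have "Re (LINT z|lebesgue. h z * cnj (h z)) \<le> norm (\<Sum>p\<in>F. \<Sum>r\<in>F. d p * cnj (d r) * (LINT z|lebesgue. cnj (P p z) * P r z))"
      by (metis complex_Re_le_cmod)
    also have "\<dots> \<le> (\<Sum>p\<in>F. \<Sum>r\<in>F. norm (d p * cnj (d r) * (LINT z|lebesgue. cnj (P p z) * P r z)))"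
      by (rule order_trans[OF norm_sum sum_mono[OF norm_sum]])
    also have "\<dots> = Y" unfolding Y_def
      by (intro sum.cong refl) (use V in \<open>simp add: d_def norm_mult M_def less_imp_le mult_ac\<close>)
    finally show ?thesis .
  qed
  have "0 \<le> (LINT z|lebesgue. norm (g z - of_real \<tau> * h z)^2)" by (intro integral_nonneg_AE) auto
  also have "\<dots> = (LINT z|lebesgue. (norm (g z))\<^sup>2) - 2 * \<tau> * (LINT z|lebesgue. Re (g z * cnj (h z))) + \<tau>^2 * (LINT z|lebesgue. Re (h z * cnj (h z)))"
  proof -
    have "(LINT z|lebesgue. u z - s * v z + r * t z) = (LINT z|lebesgue. u z) - s * (LINT z|lebesgue. v z) + r * (LINT z|lebesgue. t z)"
      if "integrable lebesgue u" "integrable lebesgue v" "integrable lebesgue t" for u v t :: "real ^ 'n \<Rightarrow> real" and s r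
      using that by simp
    then show ?thesis unfolding Re1 using g(2) integrable_Re[OF igh] integrable_Re[OF ihh] by blast
  qed
  also have "(LINT z|lebesgue. Re (g z * cnj (h z))) = X" using igh Igh by (subst integral_Re) auto
  also have "(LINT z|lebesgue. Re (h z * cnj (h z))) = Re (LINT z|lebesgue. h z * cnj (h z))" using ihh by (rule integral_Re)
  finally have "2 * \<tau> * X \<le> (LINT z|lebesgue. (norm (g z))\<^sup>2) + \<tau>^2 * Re (LINT z|lebesgue. h z * cnj (h z))" by linarith
  also have "\<tau>^2 * Re (LINT z|lebesgue. h z * cnj (h z)) \<le> \<tau>^2 * (C0 * X)"
    using Ihh Y_le by (intro mult_left_mono) auto
  also have "\<tau>^2 * (C0 * X) = \<tau> * X" using C0 by (simp add: \<tau>_def power2_eq_square)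
  finally have "\<tau> * X \<le> (LINT z|lebesgue. (norm (g z))\<^sup>2)" by (simp add: mult.commute)
  then have "X \<le> C0 * (LINT z|lebesgue. (norm (g z))\<^sup>2)" using C0 by (simp add: \<tau>_def field_simps)
  then show ?thesis by (simp add: X_def C0_def c_def P_def V_def split_beta)
qed

section \<open>Square functions of a family of kernels\<close>

text \<open>The cubes \<open>d\<close> scales below whose ancestor is the cube with index \<open>m\<close> or one of its neighbours.\<close>

definition desc :: "nat \<Rightarrow> int ^ 'n \<Rightarrow> (int ^ 'n) set" where
  "desc d m = {m'. near 1 m (coarsen d m')}"

lemma finite_desc [simp]: "finite (desc d m)"
  unfolding desc_def by (rule near_coarsen_count) simp

lemma star_multiplicity:
  fixes z :: "real ^ 'n"
  assumes "0 \<le> r" "finite I"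
  shows "(\<Sum>m\<in>I. indicator (star r j m) z) \<le> (2 * of_int r + 1 :: real) ^ CARD('n)"
proof -
  have "(\<Sum>m\<in>I. indicator (star r j m) z) = real (card (I \<inter> {m. z \<in> star r j m}))"
    using assms by (simp add: indicator_def sum.If_cases)
  also have "card (I \<inter> {m. z \<in> star r j m}) \<le> card {m. near r (cell j z) m}"
    using near_count(1)[OF assms(1), of "cell j z"] by (intro card_mono) (auto simp: near_sym[of r])
  finally show ?thesis using near_count(2)[OF assms(1), of "cell j z"] by simp
qed

lemma sum_squares_le_square_sum:
  assumes "finite I" "\<And>i. i \<in> I \<Longrightarrow> 0 \<le> (x i :: real)"
  shows "(\<Sum>i\<in>I. (x i)\<^sup>2) \<le> (\<Sum>i\<in>I. x i)\<^sup>2"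
proof -
  have "(\<Sum>i\<in>I. (x i)\<^sup>2) \<le> (\<Sum>i\<in>I. x i * (\<Sum>i\<in>I. x i))"
    unfolding power2_eq_square using assms by (intro sum_mono mult_left_mono member_le_sum) auto
  then show ?thesis by (simp add: power2_eq_square sum_distrib_right)
qed

text \<open>One kernel for each cube; the scales below \<open>- N\<close> are cut off in order to keep all sums finite.\<close>

locale kernel_family =
  fixes \<gamma> lam :: real and \<psi> :: "int \<Rightarrow> int ^ 'n \<Rightarrow> real ^ 'n \<Rightarrow> complex" and N :: int
  assumes \<gamma>: "0 < \<gamma>" "\<gamma> \<le> 1" and lam: "2 < lam" and \<psi>: "\<And>k m. \<psi> k m \<in> kernel \<gamma> k m"
begin

definition vol :: "int \<Rightarrow> real" where "vol k = (2 powi k) ^ CARD('n)"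

definition coef :: "(real ^ 'n \<Rightarrow> complex) \<Rightarrow> int \<Rightarrow> int ^ 'n \<Rightarrow> complex" where
  "coef f k m = (LINT z|lebesgue. f z * \<psi> k m z)"

text \<open>The contribution to the square of the discretized function at a point \<open>x\<close> of the cube \<open>(k, m)\<close> that comes from
  the cubes which are close to \<open>x\<close> at scale \<open>k\<close>.\<close>

definition beta :: "(real ^ 'n \<Rightarrow> complex) \<Rightarrow> int \<Rightarrow> int ^ 'n \<Rightarrow> real" where
  "beta f k m = (\<Sum>j\<in>{-N..k}. \<Sum>m'\<in>desc (nat (k - j)) m. 2 powr (lam * real CARD('n) * of_int (j - k)) * (norm (coef f j m'))\<^sup>2)"

lemma vol_pos [simp]: "0 < vol k"
  by (simp add: vol_def)

lemma vol_eq: "vol j = vol k * 2 powr (real CARD('n) * of_int (j - k))"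
  unfolding vol_def by (rule vol_ratio)

lemma vol_nonzero [simp]: "vol k \<noteq> 0"
  using vol_pos[of k] by linarith

lemma inverse_vol: "1 / vol j = 2 powr (- real CARD('n) * of_int (j - k)) / vol k"
  by (subst vol_eq[of j k]) (simp add: powr_minus_divide)

lemma measure_cube: "measure lebesgue (cube k (m :: int ^ 'n)) = vol k"
  using emeasure_cube[of k m] by (simp add: measure_def vol_def)

lemma measure_star: "0 \<le> r \<Longrightarrow> measure lebesgue (star r k (m :: int ^ 'n)) = (2 * of_int r + 1) ^ CARD('n) * vol k"
  using emeasure_star[of r k m] by (simp add: measure_def vol_def)

lemma beta_nonneg: "0 \<le> beta f k m"
  unfolding beta_def by (intro sum_nonneg) auto

lemma coef_le: "integrable lebesgue f \<Longrightarrow> norm (coef f k m) \<le> 2 / vol k * mass f (star 1 k m)"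
  unfolding coef_def vol_def by (rule pairing_bound[OF \<psi>])

lemma desc_star:
  assumes "m' \<in> desc (nat (k - j)) m" "j \<le> k" "near 1 m' (cell j z)"
  shows "near 2 m (cell k z)"
proof -
  have "near 1 (coarsen (nat (k - j)) m') (cell k z)"
    using near_coarsen[OF assms(3), of "nat (k - j)"] assms(2) by (simp add: cell_coarsen'[symmetric])
  with assms(1) have "near (1 + 1) m (cell k z)" unfolding desc_def by (blast intro: near_trans)
  then show ?thesis by simp
qed

lemma sum_coef_le:
  assumes f: "integrable lebesgue f" and "j \<le> k"
  shows "(\<Sum>m'\<in>desc (nat (k - j)) m. norm (coef f j m')) \<le> 2 * 3 ^ CARD('n) / vol j * mass f (star 2 k m)"
proof -
  have "(\<Sum>m'\<in>desc (nat (k - j)) m. norm (coef f j m')) \<le> (\<Sum>m'\<in>desc (nat (k - j)) m. 2 / vol j * mass f (star 1 j m'))"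
    by (intro sum_mono coef_le f)
  also have "\<dots> = 2 / vol j * (\<Sum>m'\<in>desc (nat (k - j)) m. 1 * mass f (star 1 j m'))"
    by (simp add: sum_distrib_left)
  also have "(\<Sum>m'\<in>desc (nat (k - j)) m. 1 * mass f (star 1 j m')) \<le> 3 ^ CARD('n) * mass f (star 2 k m)"
  proof (rule mass_sum_le[OF f])
    fix z
    show "(\<Sum>m'\<in>desc (nat (k - j)) m. 1 * indicator (star 1 j m') z) \<le> 3 ^ CARD('n) * indicat_real (star 2 k m) z"
    proof (cases "near 2 m (cell k z)")
      case True
      then show ?thesis using star_multiplicity[of 1 "desc (nat (k - j)) m" j z] by simp
    next
      case False
      then have "indicat_real (star 1 j m') z = 0" if "m' \<in> desc (nat (k - j)) m" for m'
        using desc_star[OF that assms(2)] by (auto simp: indicator_def)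
      then show ?thesis using False by simp
    qed
  qed auto
  finally show ?thesis by (simp add: mult_left_mono divide_right_mono less_imp_le)
qed

text \<open>The coefficients of scale \<open>j\<close> can exceed the average of \<open>\<bar>f\<bar>\<close> at scale \<open>k\<close> by the ratio
  \<open>2 powr (n (k - j))\<close> of the volumes. The weights absorb the square of this ratio because \<open>lam > 2\<close>.\<close>

lemma beta_le:
  assumes f: "integrable lebesgue f"
  shows "beta f k m \<le> 4 * 9 ^ CARD('n) * geo ((lam - 2) * real CARD('n)) * (mass f (star 2 k m) / vol k)\<^sup>2"
proof -
  let ?M = "mass f (star 2 k m) / vol k"
  have "beta f k m = (\<Sum>j\<in>{-N..k}. 2 powr (lam * real CARD('n) * of_int (j - k)) * (\<Sum>m'\<in>desc (nat (k - j)) m. (norm (coef f j m'))\<^sup>2))"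
    by (simp add: beta_def sum_distrib_left)
  also have "\<dots> \<le> (\<Sum>j\<in>{-N..k}. 4 * 9 ^ CARD('n) * ?M\<^sup>2 * 2 powr ((lam - 2) * real CARD('n) * of_int (j - k)))"
  proof (rule sum_mono)
    fix j assume j: "j \<in> {-N..k}"
    have "(\<Sum>m'\<in>desc (nat (k - j)) m. (norm (coef f j m'))\<^sup>2) \<le> (\<Sum>m'\<in>desc (nat (k - j)) m. norm (coef f j m'))\<^sup>2"
      by (intro sum_squares_le_square_sum) auto
    also have "\<dots> \<le> (2 * 3 ^ CARD('n) / vol j * mass f (star 2 k m))\<^sup>2"
      using j by (intro power_mono sum_coef_le f sum_nonneg) auto
    also have "2 * 3 ^ CARD('n) / vol j * mass f (star 2 k m) = 2 * 3 ^ CARD('n) * ?M * 2 powr (- real CARD('n) * of_int (j - k))"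
    proof -
      have "2 * 3 ^ CARD('n) / vol j * mass f (star 2 k m) = 2 * 3 ^ CARD('n) * mass f (star 2 k m) * (1 / vol j)" by simp
      then show ?thesis by (simp only: inverse_vol[of j k]) simp
    qed
    also have "(2 * 3 ^ CARD('n) * ?M * 2 powr (- real CARD('n) * of_int (j - k)))\<^sup>2 = 4 * 9 ^ CARD('n) * ?M\<^sup>2 * 2 powr (- 2 * real CARD('n) * of_int (j - k))"
    proof -
      have "((3::real) ^ CARD('n))\<^sup>2 = 9 ^ CARD('n)" by (simp add: power2_eq_square flip: power_mult_distrib)
      moreover have "(2 powr (- real CARD('n) * of_int (j - k)))\<^sup>2 = (2::real) powr (- 2 * real CARD('n) * of_int (j - k))"
        by (simp add: power2_eq_square mult.assoc flip: powr_add)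
      ultimately show ?thesis by (simp only: power_mult_distrib) simp
    qed
    finally have "2 powr (lam * real CARD('n) * of_int (j - k)) * (\<Sum>m'\<in>desc (nat (k - j)) m. (norm (coef f j m'))\<^sup>2)
      \<le> 2 powr (lam * real CARD('n) * of_int (j - k)) * (4 * 9 ^ CARD('n) * ?M\<^sup>2 * 2 powr (- 2 * real CARD('n) * of_int (j - k)))"
      by (intro mult_left_mono) auto
    also have "\<dots> = 4 * 9 ^ CARD('n) * ?M\<^sup>2 * (2 powr (lam * real CARD('n) * of_int (j - k)) * 2 powr (- 2 * real CARD('n) * of_int (j - k)))"
      by (simp only: ac_simps)
    also have "2 powr (lam * real CARD('n) * of_int (j - k)) * 2 powr (- 2 * real CARD('n) * of_int (j - k)) = (2::real) powr ((lam - 2) * real CARD('n) * of_int (j - k))"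
    proof -
      have "lam * real CARD('n) * of_int (j - k) + - 2 * real CARD('n) * of_int (j - k) = (lam - 2) * real CARD('n) * of_int (j - k)"
        by (simp add: algebra_simps)
      then show ?thesis by (simp only: powr_add[symmetric])
    qed
    finally show "2 powr (lam * real CARD('n) * of_int (j - k)) * (\<Sum>m'\<in>desc (nat (k - j)) m. (norm (coef f j m'))\<^sup>2)
      \<le> 4 * 9 ^ CARD('n) * ?M\<^sup>2 * 2 powr ((lam - 2) * real CARD('n) * of_int (j - k))" .
  qed
  also have "\<dots> = 4 * 9 ^ CARD('n) * ?M\<^sup>2 * (\<Sum>j\<in>{-N..k}. 2 powr ((lam - 2) * real CARD('n) * of_int (j - k)))"
    by (simp add: sum_distrib_left)
  also have "\<dots> \<le> 4 * 9 ^ CARD('n) * ?M\<^sup>2 * geo ((lam - 2) * real CARD('n))"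
    using lam by (intro mult_left_mono geo_sum_below) auto
  finally show ?thesis by (simp add: mult_ac)
qed

end

section \<open>Calderon-Zygmund decomposition along Whitney cubes\<close>

text \<open>\<open>E\<close> is a set on which the averages of \<open>\<bar>f\<bar>\<close> at all scales are at most \<open>a\<close>. The cubes of the Whitney
  decomposition of the complement of \<open>E\<close>, together with cubes of the smallest scale \<open>2 powi (-N)\<close>, partition the
  star of the top cube; they carry a Calderon-Zygmund decomposition of \<open>f\<close> at height \<open>a\<close>.\<close>

locale whitney = kernel_family \<gamma> lam \<psi> N
  for \<gamma> lam :: real and \<psi> :: "int \<Rightarrow> int ^ 'n \<Rightarrow> real ^ 'n \<Rightarrow> complex" and N :: int +
  fixes f :: "real ^ 'n \<Rightarrow> complex" and E :: "(real ^ 'n) set" and K :: int and mP :: "int ^ 'n" and a :: real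
  assumes f: "integrable lebesgue f" and E: "E \<subseteq> cube K mP" "E \<noteq> {}" and a: "0 \<le> a"
    and averages: "\<And>x k. x \<in> E \<Longrightarrow> mass f (star 2 k (cell k x)) \<le> a * vol k" and NK: "-N \<le> K"
begin

definition good :: "int \<Rightarrow> int ^ 'n \<Rightarrow> bool" where
  "good k m \<longleftrightarrow> -N < k \<and> (\<exists>x\<in>E. near 2 m (cell k x))"

text \<open>The maximal cubes under the top star that are not good, that is, not close to \<open>E\<close> relative to their size. At
  scale \<open>- N\<close> no cube is good, so every point of the top star lies in such a cube.\<close>

definition W :: "(int \<times> (int ^ 'n)) set" where
  "W = {(s, m). s \<in> {-N..K} \<and> near 2 mP (coarsen (nat (K - s)) m) \<and> \<not> good s m \<and> (s = K \<or> good (s + 1) (coarsen 1 m))}"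

abbreviation top_star :: "(real ^ 'n) set" where "top_star \<equiv> star 2 K mP"

abbreviation Q :: "int \<times> (int ^ 'n) \<Rightarrow> (real ^ 'n) set" where "Q I \<equiv> cube (fst I) (snd I)"

lemma finite_W: "finite W"
proof (rule finite_subset)
  show "W \<subseteq> Sigma {-N..K} (\<lambda>s. {m. near 2 mP (coarsen (nat (K - s)) m)})" by (auto simp: W_def)
  show "finite (Sigma {-N..K} (\<lambda>s. {m. near 2 mP (coarsen (nat (K - s)) m)}))"
    by (intro finite_SigmaI near_coarsen_count(1)) auto
qed

lemma good_up:
  assumes "good k (cell k z)" "k \<le> k'" shows "good k' (cell k' z)"
  using assms near_cell_mono[of 2 k z _ k'] by (auto simp: good_def)

lemma W_level: "I \<in> W \<Longrightarrow> -N \<le> fst I \<and> fst I \<le> K"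
  by (auto simp: W_def)

lemma W_subset:
  assumes "I \<in> W" "z \<in> Q I" shows "z \<in> top_star"
proof -
  have 1: "fst I \<le> K" and 2: "near 2 mP (coarsen (nat (K - fst I)) (snd I))"
    using assms(1) by (auto simp: W_def)
  have "cell K z = coarsen (nat (K - fst I)) (snd I)" using cell_coarsen'[OF 1, of z] assms(2) by simp
  then show ?thesis using 2 by simp
qed

lemma W_cover:
  assumes "z \<in> top_star" obtains I where "I \<in> W" "z \<in> Q I"
proof -
  let ?S = "{s \<in> {-N..K}. \<not> good s (cell s z)}"
  have "finite ?S" by (rule finite_subset[OF _ finite_atLeastAtMost_int[of "-N" K]]) blast
  moreover have "-N \<in> ?S" using NK by (simp add: good_def)
  ultimately have s: "Max ?S \<in> ?S" "\<And>t. t \<in> ?S \<Longrightarrow> t \<le> Max ?S"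
    using Max_in[of ?S] Max_ge[of ?S] by blast+
  define s where "s = Max ?S"
  have 1: "s \<in> {-N..K}" "\<not> good s (cell s z)" using s(1) by (auto simp: s_def)
  have 2: "s = K \<or> good (s + 1) (cell (s + 1) z)"
  proof (rule ccontr)
    assume "\<not> ?thesis"
    then have "s + 1 \<in> ?S" using 1 by auto
    then show False using s(2)[of "s + 1"] by (simp add: s_def)
  qed
  have "cell (s + 1) z = coarsen 1 (cell s z)" using cell_coarsen[of s 1 z] by simp
  moreover have "near 2 mP (coarsen (nat (K - s)) (cell s z))"
    using assms 1(1) cell_coarsen'[of s K z] by simp
  ultimately have "(s, cell s z) \<in> W"
    using 1 2 by (auto simp: W_def)
  then show ?thesis using that by force
qed

lemma W_disjoint:
  assumes "I \<in> W" "J \<in> W" "z \<in> Q I" "z \<in> Q J" shows "I = J"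
proof -
  have *: "fst I = fst J" if "I \<in> W" "J \<in> W" "z \<in> Q I" "z \<in> Q J" "fst I \<le> fst J" for I J
  proof (rule ccontr)
    assume "fst I \<noteq> fst J"
    then have "fst I < fst J" using that(5) by simp
    moreover have "fst J \<le> K" using W_level[OF that(2)] by simp
    ultimately have "good (fst I + 1) (coarsen 1 (snd I))" using that(1) by (auto simp: W_def)
    then have "good (fst I + 1) (cell (fst I + 1) z)" using cell_coarsen[of "fst I" 1 z] that(3) by simp
    then have "good (fst J) (cell (fst J) z)" using good_up[of "fst I + 1" z "fst J"] \<open>fst I < fst J\<close> by simp
    then show False using that(2,4) by (auto simp: W_def)
  qed
  have "fst I = fst J" using *[of I J] *[of J I] assms by linarith
  then show ?thesis using assms(3,4) by (auto simp: prod_eq_iff)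
qed

lemma W_indicator:
  assumes "F \<subseteq> W" "\<And>I. I \<in> F \<Longrightarrow> Q I \<subseteq> T"
  shows "(\<Sum>I\<in>F. indicator (Q I) z) \<le> (indicator T z :: real)"
proof (cases "\<exists>I\<in>F. z \<in> Q I")
  case True
  then obtain I where I: "I \<in> F" "z \<in> Q I" by blast
  have fF: "finite F" using assms(1) finite_W finite_subset by blast
  have "(\<Sum>J\<in>F. indicator (Q J) z) = (\<Sum>J\<in>F. if J = I then 1 else 0 :: real)"
  proof (rule sum.cong[OF refl])
    fix J assume "J \<in> F"
    then show "indicator (Q J) z = (if J = I then 1 else 0 :: real)"
      using W_disjoint[of I J z] I assms(1) by (cases "J = I") (auto simp: indicator_def)
  qed
  then show ?thesis using I assms(2)[OF I(1)] fF by (auto simp: indicator_def)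
next
  case False
  then show ?thesis by (auto simp: indicator_def)
qed

lemma W_indicator_top: "(\<Sum>I\<in>W. indicator (Q I) z) = (indicator top_star z :: real)"
proof (cases "z \<in> top_star")
  case True
  then obtain I where I: "I \<in> W" "z \<in> Q I" by (rule W_cover)
  have "(\<Sum>J\<in>W. indicator (Q J) z) = (\<Sum>J\<in>W. if J = I then 1 else 0 :: real)"
  proof (rule sum.cong[OF refl])
    fix J assume "J \<in> W"
    then show "indicator (Q J) z = (if J = I then 1 else 0 :: real)"
      using W_disjoint[of I J z] I by (cases "J = I") (auto simp: indicator_def)
  qed
  then show ?thesis using I True finite_W by (simp add: indicator_def)
next
  case False
  then have "indicator (Q I) z = (0::real)" if "I \<in> W" for I using W_subset[OF that] by (auto simp: indicator_def)
  then show ?thesis using False by simp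
qed

lemma mass_sum_W:
  assumes "F \<subseteq> W" "\<And>I. I \<in> F \<Longrightarrow> Q I \<subseteq> T" "T \<in> sets lebesgue"
  shows "(\<Sum>I\<in>F. mass f (Q I)) \<le> mass f T"
  using mass_sum_le[OF f, of F Q T "\<lambda>_. 1" 1] W_indicator[OF assms(1,2)] assms finite_subset[OF assms(1) finite_W] by simp

lemma vol_sum_W:
  assumes "F \<subseteq> W" "\<And>I. I \<in> F \<Longrightarrow> Q I \<subseteq> star 1 j m'"
  shows "(\<Sum>I\<in>F. vol (fst I)) \<le> 3 ^ CARD('n) * vol j"
proof -
  have fF: "finite F" using assms(1) finite_W finite_subset by blast
  have ci: "integrable lebesgue (indicat_real (cube k m))" for k and m :: "int ^ 'n"
    by (simp add: emeasure_cube)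
  have "(\<Sum>I\<in>F. vol (fst I)) = (LINT z|lebesgue. (\<Sum>I\<in>F. indicator (Q I) z))"
    using ci by (subst Bochner_Integration.integral_sum) (auto simp: measure_cube)
  also have "\<dots> \<le> (LINT z|lebesgue. indicator (star 1 j m') z)"
    using ci W_indicator[OF assms] integrable_star_indicator[of 1 j m']
    by (intro integral_mono Bochner_Integration.integrable_sum) auto
  also have "\<dots> = 3 ^ CARD('n) * vol j" using measure_star[of 1 j m'] by simp
  finally show ?thesis .
qed

lemma mass_top: "mass f top_star \<le> a * vol K"
proof -
  obtain x where "x \<in> E" using E by blast
  then show ?thesis using averages[of x K] E by auto
qed

text \<open>The parent of a Whitney cube is close to \<open>E\<close>, so it lies in a star over which the average is at most \<open>a\<close>.\<close>

lemma mass_W: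
  assumes "I \<in> W" shows "mass f (Q I) \<le> a * 2 ^ CARD('n) * vol (fst I)"
proof -
  obtain s m where I: "I = (s, m)" by force
  show ?thesis
  proof (cases "s = K")
    case True
    have "mass f (Q I) \<le> mass f top_star" using W_subset[OF assms] by (intro mass_mono f) auto
    also have "\<dots> \<le> a * vol K" by (rule mass_top)
    also have "\<dots> \<le> a * 2 ^ CARD('n) * vol K"
      using a by (intro mult_right_mono) (auto simp: mult_le_cancel_left1 less_imp_le)
    finally show ?thesis using True I by simp
  next
    case False
    then obtain x where x: "x \<in> E" "near 2 (coarsen 1 m) (cell (s + 1) x)"
      using assms I by (auto simp: W_def good_def)
    have "Q I \<subseteq> star 2 (s + 1) (cell (s + 1) x)"
    proof
      fix z assume "z \<in> Q I"
      then have "cell (s + 1) z = coarsen 1 m" using cell_coarsen[of s 1 z] I by simp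
      then show "z \<in> star 2 (s + 1) (cell (s + 1) x)" using x(2) by (simp add: near_sym[of 2 "cell (s + 1) x"])
    qed
    then have "mass f (Q I) \<le> mass f (star 2 (s + 1) (cell (s + 1) x))" by (intro mass_mono f) auto
    also have "\<dots> \<le> a * vol (s + 1)" by (rule averages[OF x(1)])
    also have "vol (s + 1) = 2 ^ CARD('n) * vol s"
      by (simp add: vol_def power_int_add power_mult_distrib)
    finally show ?thesis using I by (simp add: mult_ac)
  qed
qed

definition avg :: "int \<times> (int ^ 'n) \<Rightarrow> complex" where
  "avg I = (LINT z|lebesgue. indicator (Q I) z *\<^sub>R f z) / of_real (vol (fst I))"

definition bad :: "int \<times> (int ^ 'n) \<Rightarrow> real ^ 'n \<Rightarrow> complex" where
  "bad I z = indicator (Q I) z *\<^sub>R (f z - avg I)"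

definition flat :: "real ^ 'n \<Rightarrow> complex" where
  "flat z = (\<Sum>I\<in>W. indicator (Q I) z *\<^sub>R avg I)"

lemma norm_avg: "norm (avg I) * vol (fst I) \<le> mass f (Q I)"
proof -
  have "norm (avg I) * vol (fst I) = norm (LINT z|lebesgue. indicator (Q I) z *\<^sub>R f z)"
    by (simp add: avg_def norm_divide less_imp_le)
  also have "\<dots> \<le> (LINT z|lebesgue. norm (indicator (Q I) z *\<^sub>R f z))" by (rule integral_norm_bound)
  also have "\<dots> = mass f (Q I)" by (simp add: mass_def)
  finally show ?thesis .
qed

lemma integrable_const_cube: "integrable lebesgue (\<lambda>z. indicator (cube k (m :: int ^ 'n)) z *\<^sub>R (c :: complex))"
  by (intro integrable_scaleR_left integrable_real_indicator) (auto simp: emeasure_cube)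

lemma bad_eq: "bad I z = indicator (Q I) z *\<^sub>R f z - indicator (Q I) z *\<^sub>R avg I"
  by (simp add: bad_def scaleR_diff_right)

lemma integrable_bad: "integrable lebesgue (bad I)"
  unfolding bad_eq[abs_def] by (intro Bochner_Integration.integrable_diff integrable_mult_indicator f integrable_const_cube) auto

lemma integral_bad: "(LINT z|lebesgue. bad I z) = 0"
proof -
  have "(LINT z|lebesgue. bad I z) = (LINT z|lebesgue. indicator (Q I) z *\<^sub>R f z) - (LINT z|lebesgue. indicator (Q I) z *\<^sub>R avg I)"
    unfolding bad_eq by (intro Bochner_Integration.integral_diff integrable_mult_indicator f integrable_const_cube) auto
  also have "(LINT z|lebesgue. indicator (Q I) z *\<^sub>R avg I) = vol (fst I) *\<^sub>R avg I"
    by (simp add: measure_cube emeasure_cube)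
  finally show ?thesis by (simp add: avg_def scaleR_conv_of_real)
qed

lemma norm_bad: "(LINT z|lebesgue. norm (bad I z)) \<le> 2 * mass f (Q I)"
proof -
  have "(LINT z|lebesgue. norm (bad I z)) \<le> (LINT z|lebesgue. indicator (Q I) z * norm (f z) + indicator (Q I) z * norm (avg I))"
  proof (rule integral_mono)
    have "integrable lebesgue (\<lambda>z. indicat_real (Q I) z * norm (avg I))"
      by (intro integrable_mult_left integrable_real_indicator) (auto simp: emeasure_cube)
    then show "integrable lebesgue (\<lambda>z. indicator (Q I) z * norm (f z) + indicator (Q I) z * norm (avg I))"
      by (intro Bochner_Integration.integrable_add mass_integrable[OF f]) auto
    show "norm (bad I z) \<le> indicator (Q I) z * norm (f z) + indicator (Q I) z * norm (avg I)" for z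
      unfolding bad_def by (auto simp: indicator_def norm_triangle_ineq4)
  qed (intro integrable_norm integrable_bad)
  also have "\<dots> = mass f (Q I) + vol (fst I) * norm (avg I)"
    unfolding mass_def
    by (subst Bochner_Integration.integral_add) (auto simp: measure_cube emeasure_cube intro!: mass_integrable f integrable_mult_left)
  finally show ?thesis using norm_avg[of I] by (simp add: mult.commute)
qed

lemma mass_bad_le: "S \<in> sets lebesgue \<Longrightarrow> mass (bad I) S \<le> 2 * mass f (Q I)"
proof -
  assume S: "S \<in> sets lebesgue"
  have "mass (bad I) S \<le> (LINT z|lebesgue. norm (bad I z))"
    unfolding mass_def using S integrable_bad[of I]
    by (intro integral_mono mass_integrable integrable_norm) (auto simp: indicator_def)
  then show ?thesis using norm_bad[of I] by simp
qed

lemma flat_measurable [measurable]: "flat \<in> borel_measurable lebesgue"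
  unfolding flat_def[abs_def] by (intro borel_measurable_sum borel_measurable_scaleR borel_measurable_indicator) auto

lemma norm_flat: "norm (flat z) \<le> a * 2 ^ CARD('n) * indicator top_star z"
proof -
  have av: "norm (avg I) \<le> a * 2 ^ CARD('n)" if "I \<in> W" for I
  proof -
    have "norm (avg I) * vol (fst I) \<le> a * 2 ^ CARD('n) * vol (fst I)"
      using norm_avg[of I] mass_W[OF that] by linarith
    then show ?thesis by (simp add: mult_le_cancel_right)
  qed
  have "norm (flat z) \<le> (\<Sum>I\<in>W. indicator (Q I) z * norm (avg I))"
    unfolding flat_def by (rule order_trans[OF norm_sum]) simp
  also have "\<dots> \<le> (\<Sum>I\<in>W. indicator (Q I) z * (a * 2 ^ CARD('n)))"
    using av by (intro sum_mono mult_left_mono) auto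
  also have "\<dots> = a * 2 ^ CARD('n) * indicator top_star z"
    by (simp add: W_indicator_top[symmetric] sum_distrib_left mult.commute)
  finally show ?thesis .
qed

lemma decomposition: "indicator top_star z *\<^sub>R f z = flat z + (\<Sum>I\<in>W. bad I z)"
proof -
  have "flat z + (\<Sum>I\<in>W. bad I z) = (\<Sum>I\<in>W. indicator (Q I) z *\<^sub>R f z)"
    unfolding flat_def bad_eq by (simp add: sum_subtractf)
  also have "\<dots> = (\<Sum>I\<in>W. indicator (Q I) z) *\<^sub>R f z" by (simp add: scaleR_sum_left)
  finally show ?thesis by (simp add: W_indicator_top)
qed

lemma integrable_top: "integrable lebesgue (\<lambda>z. (a * 2 ^ CARD('n)) * indicat_real top_star z)"
  using emeasure_star_finite[of 2 K mP] by (intro integrable_mult_right) auto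

lemma integrable_flat: "integrable lebesgue flat"
  by (rule Bochner_Integration.integrable_bound[OF integrable_top]) (use norm_flat in \<open>auto intro: order_trans[OF _ abs_ge_self]\<close>)

lemma flat_square:
  "integrable lebesgue (\<lambda>z. (norm (flat z))\<^sup>2)" "(LINT z|lebesgue. (norm (flat z))\<^sup>2) \<le> 20 ^ CARD('n) * a\<^sup>2 * vol K"
proof -
  have le: "(norm (flat z))\<^sup>2 \<le> (a * 2 ^ CARD('n))\<^sup>2 * indicator top_star z" for z
    using power_mono[OF norm_flat[of z], of 2] by (auto simp: indicator_def split: if_splits)
  have i: "integrable lebesgue (\<lambda>z. (a * 2 ^ CARD('n))\<^sup>2 * indicat_real top_star z)"
    using emeasure_star_finite[of 2 K mP] by (intro integrable_mult_right) auto
  show 1: "integrable lebesgue (\<lambda>z. (norm (flat z))\<^sup>2)"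
    by (rule Bochner_Integration.integrable_bound[OF i]) (use le in \<open>auto intro: order_trans[OF _ abs_ge_self]\<close>)
  have "(LINT z|lebesgue. (norm (flat z))\<^sup>2) \<le> (LINT z|lebesgue. (a * 2 ^ CARD('n))\<^sup>2 * indicator top_star z)"
    by (rule integral_mono[OF 1 i le])
  also have "\<dots> = (a * 2 ^ CARD('n))\<^sup>2 * (5 ^ CARD('n) * vol K)" using measure_star[of 2 K mP] by simp
  also have "\<dots> = 20 ^ CARD('n) * a\<^sup>2 * vol K"
  proof -
    have "(2 ^ CARD('n))\<^sup>2 * 5 ^ CARD('n) = ((2::real)\<^sup>2 * 5) ^ CARD('n)"
      by (simp only: power_mult_distrib power_mult[symmetric] mult.commute)
    then show ?thesis by (simp add: power_mult_distrib mult_ac)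
  qed
  finally show "(LINT z|lebesgue. (norm (flat z))\<^sup>2) \<le> 20 ^ CARD('n) * a\<^sup>2 * vol K" .
qed

lemma coef_decomposition:
  assumes "m' \<in> desc (nat (K - j)) mP" "j \<le> K"
  shows "coef f j m' = coef flat j m' + (\<Sum>I\<in>W. coef (bad I) j m')"
proof -
  have "f z * \<psi> j m' z = flat z * \<psi> j m' z + (\<Sum>I\<in>W. bad I z * \<psi> j m' z)" for z
  proof (cases "\<psi> j m' z = 0")
    case False
    then have "z \<in> top_star" using desc_star[OF assms(1,2)] kernel_support[OF \<psi>] by auto
    then have "f z = flat z + (\<Sum>I\<in>W. bad I z)" using decomposition[of z] by simp
    then show ?thesis by (simp add: distrib_right sum_distrib_right)
  qed simp
  then have "coef f j m' = (LINT z|lebesgue. flat z * \<psi> j m' z + (\<Sum>I\<in>W. bad I z * \<psi> j m' z))"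
    by (simp add: coef_def)
  also have "\<dots> = coef flat j m' + (\<Sum>I\<in>W. coef (bad I) j m')"
    unfolding coef_def using kernel_mult_integrable[OF \<psi> integrable_bad] kernel_mult_integrable[OF \<psi> integrable_flat]
    by (subst Bochner_Integration.integral_add) (auto simp: Bochner_Integration.integral_sum)
  finally show ?thesis .
qed

text \<open>The mean of \<open>bad I\<close> vanishes, and the kernel oscillates little over a cube of smaller scale.\<close>

lemma coef_bad_small:
  assumes "I \<in> W" "fst I \<le> j"
  shows "norm (coef (bad I) j m') \<le>
    6 * real CARD('n) / vol j * (2 powr (\<gamma> * of_int (fst I - j)) * mass f (Q I)) * of_bool (near 1 m' (coarsen (nat (j - fst I)) (snd I)))"
proof (cases "near 1 m' (coarsen (nat (j - fst I)) (snd I))")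
  case True
  have "norm (coef (bad I) j m') \<le> 3 * real CARD('n) * 2 powr (\<gamma> * of_int (fst I - j)) / vol j * (LINT z|lebesgue. norm (bad I z))"
    unfolding coef_def vol_def
    by (rule pairing_cancel[OF \<psi> \<gamma> integrable_bad integral_bad, where ?m0.0 = "snd I"]) (auto simp: bad_def indicator_def split: if_splits)
  also have "\<dots> \<le> 3 * real CARD('n) * 2 powr (\<gamma> * of_int (fst I - j)) / vol j * (2 * mass f (Q I))"
    by (intro mult_left_mono norm_bad) (auto simp: less_imp_le)
  finally show ?thesis using True by (simp add: mult_ac)
next
  case False
  have "bad I z * \<psi> j m' z = 0" for z
  proof (rule ccontr)
    assume "\<not> ?thesis"
    then have "cell (fst I) z = snd I" "near 1 m' (cell j z)"
      using kernel_support[OF \<psi>, of j m' z] by (auto simp: bad_def indicator_def split: if_splits)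
    then show False using False assms(2) by (simp add: cell_coarsen'[of "fst I" j z])
  qed
  then have "(\<lambda>z. bad I z * \<psi> j m' z) = (\<lambda>z. 0)" by blast
  then have "coef (bad I) j m' = 0" unfolding coef_def by simp
  then show ?thesis using False by simp
qed

end

section \<open>The local square function estimate\<close>

lemma sum_triangle:
  fixes g :: "int \<Rightarrow> int \<Rightarrow> real"
  shows "(\<Sum>k\<in>{a..b}. \<Sum>j\<in>{a..k}. g j k) = (\<Sum>j\<in>{a..b}. \<Sum>k\<in>{j..b}. g j k)"
proof -
  have "(\<Sum>k\<in>{a..b}. \<Sum>j\<in>{a..k}. g j k) = (\<Sum>k\<in>{a..b}. \<Sum>j\<in>{j \<in> {a..b}. j \<le> k}. g j k)"
    by (intro sum.cong) auto
  also have "\<dots> = (\<Sum>j\<in>{a..b}. \<Sum>k\<in>{k \<in> {a..b}. j \<le> k}. g j k)"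
    by (rule sum.swap_restrict) auto
  also have "\<dots> = (\<Sum>j\<in>{a..b}. \<Sum>k\<in>{j..b}. g j k)"
    by (intro sum.cong) auto
  finally show ?thesis .
qed

text \<open>Double counting: each \<open>t\<close> is counted for at most \<open>(2 r + 1)\<^sup>n\<close> indices \<open>m\<close>.\<close>

lemma sum_near_le:
  fixes A :: "'b \<Rightarrow> real"
  assumes "finite C" "finite T" "\<And>m. m \<in> C \<Longrightarrow> D m \<subseteq> T" "\<And>t. 0 \<le> A t" "0 \<le> r"
    and D: "\<And>m t. m \<in> C \<Longrightarrow> t \<in> D m \<Longrightarrow> near r (m :: int ^ 'n) (c t)"
  shows "(\<Sum>m\<in>C. \<Sum>t\<in>D m. A t) \<le> (2 * of_int r + 1) ^ CARD('n) * (\<Sum>t\<in>T. A t)"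
proof -
  have "(\<Sum>m\<in>C. \<Sum>t\<in>D m. A t) = (\<Sum>m\<in>C. \<Sum>t\<in>{t \<in> T. t \<in> D m}. A t)"
    using assms(3) by (intro sum.cong) auto
  also have "\<dots> = (\<Sum>t\<in>T. \<Sum>m\<in>{m \<in> C. t \<in> D m}. A t)"
    using assms by (intro sum.swap_restrict) auto
  also have "\<dots> \<le> (\<Sum>t\<in>T. (2 * of_int r + 1) ^ CARD('n) * A t)"
  proof (rule sum_mono)
    fix t assume "t \<in> T"
    have "card {m \<in> C. t \<in> D m} \<le> card {m. near r (c t) m}"
      using D near_count(1)[OF assms(5), of "c t"] by (intro card_mono) (auto simp: near_sym[of r "c t"])
    then have "real (card {m \<in> C. t \<in> D m}) \<le> (2 * of_int r + 1) ^ CARD('n)"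
      using near_count(2)[OF assms(5), of "c t"] by linarith
    then show "(\<Sum>m\<in>{m \<in> C. t \<in> D m}. A t) \<le> (2 * of_int r + 1) ^ CARD('n) * A t"
      using assms(4) by (simp add: mult_right_mono)
  qed
  finally show ?thesis by (simp add: sum_distrib_left)
qed

definition local_const :: "'n::finite itself \<Rightarrow> real \<Rightarrow> real \<Rightarrow> real" where
  "local_const _ \<gamma> lam = 3 * (3 ^ CARD('n) * geo ((lam - 1) * real CARD('n)) * (bessel_const TYPE('n) \<gamma> * 20 ^ CARD('n))
     + 3 ^ CARD('n) * geo ((lam - 1) * real CARD('n)) * (36 * (real CARD('n))\<^sup>2 * 6 ^ CARD('n) * (3 ^ CARD('n) * geo \<gamma>))
     + 16 * 9 ^ CARD('n) * (5 ^ CARD('n) * (geo ((lam - 2) * real CARD('n)))\<^sup>2))"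

lemma local_const_pos:
  assumes "0 < \<gamma>" "2 < lam" shows "0 < local_const TYPE('n::finite) \<gamma> lam"
proof -
  have "0 < geo ((lam - 1) * real CARD('n))" "0 < geo ((lam - 2) * real CARD('n))" "0 < geo \<gamma>"
    using assms by (auto intro!: geo_pos)
  then show ?thesis unfolding local_const_def bessel_const_def by (intro mult_pos_pos add_pos_pos zero_less_power) auto
qed

context whitney
begin

abbreviation cells :: "int \<Rightarrow> (int ^ 'n) set" where "cells k \<equiv> cell k ` E"

definition small :: "int \<Rightarrow> int ^ 'n \<Rightarrow> real" where
  "small j m' = (\<Sum>I\<in>{I \<in> W. fst I \<le> j}. norm (coef (bad I) j m'))"

definition large :: "int \<Rightarrow> int ^ 'n \<Rightarrow> real" where
  "large j m' = (\<Sum>I\<in>{I \<in> W. j < fst I}. norm (coef (bad I) j m'))"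

lemma small_nonneg: "0 \<le> small j m'" and large_nonneg: "0 \<le> large j m'"
  by (auto simp: small_def large_def intro: sum_nonneg)

lemma coef_split:
  assumes "m' \<in> desc (nat (K - j)) mP" "j \<le> K"
  shows "(norm (coef f j m'))\<^sup>2 \<le> 3 * ((norm (coef flat j m'))\<^sup>2 + (small j m')\<^sup>2 + (large j m')\<^sup>2)"
proof -
  have "norm (coef f j m') \<le> norm (coef flat j m') + norm (\<Sum>I\<in>W. coef (bad I) j m')"
    unfolding coef_decomposition[OF assms] by (rule norm_triangle_ineq)
  also have "norm (\<Sum>I\<in>W. coef (bad I) j m') \<le> (\<Sum>I\<in>W. norm (coef (bad I) j m'))" by (rule norm_sum)
  also have "\<dots> = small j m' + large j m'"
  proof -
    have "W = {I \<in> W. fst I \<le> j} \<union> {I \<in> W. j < fst I}" by auto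
    then show ?thesis unfolding small_def large_def using finite_W
      by (subst sum.union_disjoint[symmetric]) auto
  qed
  finally have "norm (coef f j m') \<le> norm (coef flat j m') + (small j m' + large j m')" by simp
  then have "(norm (coef f j m'))\<^sup>2 \<le> (norm (coef flat j m') + (small j m' + large j m'))\<^sup>2"
    by (intro power_mono) auto
  also have "\<dots> \<le> 3 * ((norm (coef flat j m'))\<^sup>2 + (small j m')\<^sup>2 + (large j m')\<^sup>2)"
  proof -
    have "(x + (y + z))\<^sup>2 \<le> 3 * (x\<^sup>2 + y\<^sup>2 + z\<^sup>2)" for x y z :: real
      using zero_le_power2[of "x - y"] zero_le_power2[of "y - z"] zero_le_power2[of "x - z"]
      by (simp add: power2_eq_square algebra_simps)
    then show ?thesis .
  qed
  finally show ?thesis .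
qed

lemma cell_K: "x \<in> E \<Longrightarrow> k \<le> K \<Longrightarrow> coarsen (nat (K - k)) (cell k x) = mP"
  using E cell_coarsen'[of k K x] by auto

lemma finite_cells: "k \<le> K \<Longrightarrow> finite (cells k)"
  by (rule finite_subset[OF _ near_coarsen_count(1)[of 0 mP "nat (K - k)"]]) (auto simp: cell_K)

lemma desc_top:
  assumes "m \<in> cells k" "k \<le> K" "j \<le> k" "m' \<in> desc (nat (k - j)) m"
  shows "m' \<in> desc (nat (K - j)) mP"
proof -
  have "near 1 (coarsen (nat (K - k)) m) (coarsen (nat (K - k)) (coarsen (nat (k - j)) m'))"
    using assms(4) by (auto simp: desc_def intro: near_coarsen)
  moreover have "coarsen (nat (K - k)) (coarsen (nat (k - j)) m') = coarsen (nat (K - j)) m'"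
  proof -
    have "nat (k - j) + nat (K - k) = nat (K - j)" using assms by simp
    then show ?thesis by (simp add: coarsen_coarsen)
  qed
  ultimately show ?thesis using assms(1,2) cell_K by (auto simp: desc_def)
qed

text \<open>Changing the order of summation turns \<open>vol k * 2 powr (lam n (j - k))\<close> into
  \<open>vol j * 2 powr ((lam - 1) n (j - k))\<close>, which is summable in \<open>k \<ge> j\<close>. What remains is an unweighted sum over
  all cubes below the top star.\<close>

lemma total_le:
  assumes A: "\<And>j m'. 0 \<le> A j m'"
  shows "(\<Sum>k\<in>{-N..K}. \<Sum>m\<in>cells k. vol k * (\<Sum>j\<in>{-N..k}. \<Sum>m'\<in>desc (nat (k - j)) m. 2 powr (lam * real CARD('n) * of_int (j - k)) * A j m'))
    \<le> 3 ^ CARD('n) * geo ((lam - 1) * real CARD('n)) * (\<Sum>j\<in>{-N..K}. \<Sum>m'\<in>desc (nat (K - j)) mP. vol j * A j m')"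
proof -
  let ?\<delta> = "(lam - 1) * real CARD('n)"
  define S where "S j = (\<Sum>m'\<in>desc (nat (K - j)) mP. A j m')" for j
  have S0: "0 \<le> S j" for j unfolding S_def using A by (intro sum_nonneg)
  have "(\<Sum>m\<in>cells k. vol k * (\<Sum>j\<in>{-N..k}. \<Sum>m'\<in>desc (nat (k - j)) m. 2 powr (lam * real CARD('n) * of_int (j - k)) * A j m'))
    \<le> (\<Sum>j\<in>{-N..k}. 3 ^ CARD('n) * (vol j * S j * 2 powr (?\<delta> * of_int (j - k))))" if k: "k \<in> {-N..K}" for k
  proof -
    have "(\<Sum>m\<in>cells k. vol k * (\<Sum>j\<in>{-N..k}. \<Sum>m'\<in>desc (nat (k - j)) m. 2 powr (lam * real CARD('n) * of_int (j - k)) * A j m'))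
      = (\<Sum>m\<in>cells k. \<Sum>j\<in>{-N..k}. vol k * 2 powr (lam * real CARD('n) * of_int (j - k)) * (\<Sum>m'\<in>desc (nat (k - j)) m. A j m'))"
      by (simp add: sum_distrib_left mult.assoc)
    also have "\<dots> = (\<Sum>j\<in>{-N..k}. vol k * 2 powr (lam * real CARD('n) * of_int (j - k)) * (\<Sum>m\<in>cells k. \<Sum>m'\<in>desc (nat (k - j)) m. A j m'))"
      by (subst sum.swap) (simp add: sum_distrib_left)
    also have "\<dots> \<le> (\<Sum>j\<in>{-N..k}. vol k * 2 powr (lam * real CARD('n) * of_int (j - k)) * (3 ^ CARD('n) * S j))"
    proof (intro sum_mono mult_left_mono)
      fix j assume j: "j \<in> {-N..k}"
      have "(\<Sum>m\<in>cells k. \<Sum>m'\<in>desc (nat (k - j)) m. A j m') \<le> (2 * of_int 1 + 1) ^ CARD('n) * (\<Sum>m'\<in>desc (nat (K - j)) mP. A j m')"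
      proof (rule sum_near_le[where c = "\<lambda>m'. coarsen (nat (k - j)) m'"])
        show "desc (nat (k - j)) m \<subseteq> desc (nat (K - j)) mP" if "m \<in> cells k" for m
          using desc_top[OF that, of j] k j by auto
        show "near 1 m (coarsen (nat (k - j)) t)" if "t \<in> desc (nat (k - j)) m" for m t
          using that by (simp add: desc_def)
      qed (use k A finite_cells[of k] in auto)
      then show "(\<Sum>m\<in>cells k. \<Sum>m'\<in>desc (nat (k - j)) m. A j m') \<le> 3 ^ CARD('n) * S j" by (simp add: S_def)
    qed (simp add: less_imp_le)
    also have "\<dots> = (\<Sum>j\<in>{-N..k}. 3 ^ CARD('n) * (vol j * S j * 2 powr (?\<delta> * of_int (j - k))))"
    proof (intro sum.cong refl)
      fix j
      have "real CARD('n) * of_int (j - k) + ?\<delta> * of_int (j - k) = lam * real CARD('n) * of_int (j - k)"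
        by (simp add: algebra_simps)
      then have "vol k * 2 powr (lam * real CARD('n) * of_int (j - k)) = vol j * 2 powr (?\<delta> * of_int (j - k))"
        unfolding vol_eq[of j k] by (simp only: powr_add[symmetric] mult.assoc)
      then show "vol k * 2 powr (lam * real CARD('n) * of_int (j - k)) * (3 ^ CARD('n) * S j)
        = 3 ^ CARD('n) * (vol j * S j * 2 powr (?\<delta> * of_int (j - k)))" by simp
    qed
    finally show ?thesis .
  qed
  then have "(\<Sum>k\<in>{-N..K}. \<Sum>m\<in>cells k. vol k * (\<Sum>j\<in>{-N..k}. \<Sum>m'\<in>desc (nat (k - j)) m. 2 powr (lam * real CARD('n) * of_int (j - k)) * A j m'))
    \<le> (\<Sum>k\<in>{-N..K}. \<Sum>j\<in>{-N..k}. 3 ^ CARD('n) * (vol j * S j * 2 powr (?\<delta> * of_int (j - k))))"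
    by (rule sum_mono)
  also have "\<dots> = (\<Sum>j\<in>{-N..K}. \<Sum>k\<in>{j..K}. 3 ^ CARD('n) * (vol j * S j * 2 powr (?\<delta> * of_int (j - k))))"
    by (rule sum_triangle)
  also have "\<dots> = (\<Sum>j\<in>{-N..K}. 3 ^ CARD('n) * (vol j * S j) * (\<Sum>k\<in>{j..K}. 2 powr (?\<delta> * of_int (j - k))))"
    by (simp add: sum_distrib_left mult.assoc)
  also have "\<dots> \<le> (\<Sum>j\<in>{-N..K}. 3 ^ CARD('n) * (vol j * S j) * geo ?\<delta>)"
    using lam S0 by (intro sum_mono mult_left_mono geo_sum_above) (auto simp: less_imp_le)
  also have "\<dots> = 3 ^ CARD('n) * geo ?\<delta> * (\<Sum>j\<in>{-N..K}. \<Sum>m'\<in>desc (nat (K - j)) mP. vol j * A j m')"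
    by (simp add: S_def sum_distrib_left sum_distrib_right mult_ac)
  finally show ?thesis .
qed

lemma flat_total:
  "(\<Sum>j\<in>{-N..K}. \<Sum>m'\<in>desc (nat (K - j)) mP. vol j * (norm (coef flat j m'))\<^sup>2)
    \<le> bessel_const TYPE('n) \<gamma> * 20 ^ CARD('n) * (a\<^sup>2 * vol K)"
proof -
  let ?F = "Sigma {-N..K} (\<lambda>j. desc (nat (K - j)) mP)"
  have "(\<Sum>j\<in>{-N..K}. \<Sum>m'\<in>desc (nat (K - j)) mP. vol j * (norm (coef flat j m'))\<^sup>2)
    = (\<Sum>(j, m')\<in>?F. (2 powi j) ^ CARD('n) * (norm (LINT z|lebesgue. flat z * \<psi> j m' z))\<^sup>2)"
    unfolding vol_def coef_def by (rule sum.Sigma) auto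
  also have "\<dots> \<le> bessel_const TYPE('n) \<gamma> * (LINT z|lebesgue. (norm (flat z))\<^sup>2)"
    using \<psi> by (intro bessel \<gamma> integrable_flat flat_square) auto
  also have "\<dots> \<le> bessel_const TYPE('n) \<gamma> * (20 ^ CARD('n) * a\<^sup>2 * vol K)"
    using geo_pos[OF \<gamma>(1)] by (intro mult_left_mono flat_square) (auto simp: bessel_const_def)
  finally show ?thesis by (simp add: mult.assoc)
qed

text \<open>One factor of the square is bounded by a multiple of \<open>a\<close>, because the Whitney cubes near a cube are disjoint and
  have averages at most \<open>2\<^sup>n a\<close>; the other factor is linear in the masses and is summed by the decay in \<open>\<gamma>\<close>.\<close>

lemma small_total:
  "(\<Sum>j\<in>{-N..K}. \<Sum>m'\<in>desc (nat (K - j)) mP. vol j * (small j m')\<^sup>2)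
    \<le> 36 * (real CARD('n))\<^sup>2 * 6 ^ CARD('n) * (3 ^ CARD('n) * geo \<gamma>) * (a\<^sup>2 * vol K)"
proof -
  let ?c = "\<lambda>I j. coarsen (nat (j - fst I)) (snd I)"
  let ?g = "\<lambda>I j. 2 powr (\<gamma> * of_int (fst I - j)) * mass f (Q I)"
  define R where "R j m' = (\<Sum>I\<in>{I \<in> W. fst I \<le> j \<and> near 1 m' (?c I j)}. ?g I j)" for j m'
  have R0: "0 \<le> R j m'" for j m' unfolding R_def by (intro sum_nonneg mult_nonneg_nonneg mass_nonneg) auto
  have small_R: "small j m' \<le> 6 * real CARD('n) / vol j * R j m'" for j m'
  proof -
    have "small j m' \<le> (\<Sum>I\<in>{I \<in> W. fst I \<le> j}. 6 * real CARD('n) / vol j * ?g I j * of_bool (near 1 m' (?c I j)))"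
      unfolding small_def by (intro sum_mono coef_bad_small) auto
    also have "\<dots> = (\<Sum>I\<in>{I \<in> {I \<in> W. fst I \<le> j}. near 1 m' (?c I j)}. 6 * real CARD('n) / vol j * ?g I j)"
      using finite_W by (subst sum.inter_filter) (auto intro!: sum.cong)
    also have "\<dots> = 6 * real CARD('n) / vol j * R j m'"
      unfolding R_def sum_distrib_left by (intro sum.cong) auto
    finally show ?thesis .
  qed
  have R_le: "R j m' \<le> a * 6 ^ CARD('n) * vol j" for j m'
  proof -
    let ?F = "{I \<in> W. fst I \<le> j \<and> near 1 m' (?c I j)}"
    have "R j m' \<le> (\<Sum>I\<in>?F. 1 * (a * 2 ^ CARD('n) * vol (fst I)))"
      unfolding R_def
    proof (intro sum_mono mult_mono)
      fix I assume "I \<in> ?F"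
      then have "\<gamma> * of_int (fst I - j) \<le> 0" using \<gamma> by (intro mult_nonneg_nonpos) auto
      then show "2 powr (\<gamma> * of_int (fst I - j)) \<le> (1::real)" using powr_mono[of _ 0 "2::real"] by fastforce
    qed (auto intro: mass_W mass_nonneg)
    also have "\<dots> = a * 2 ^ CARD('n) * (\<Sum>I\<in>?F. vol (fst I))" by (simp add: sum_distrib_left)
    also have "\<dots> \<le> a * 2 ^ CARD('n) * (3 ^ CARD('n) * vol j)"
    proof (intro mult_left_mono vol_sum_W[where m' = m'])
      fix I assume I: "I \<in> ?F"
      show "Q I \<subseteq> star 1 j m'"
      proof
        fix z assume "z \<in> Q I"
        then have "cell j z = ?c I j" using I cell_coarsen'[of "fst I" j z] by simp
        then show "z \<in> star 1 j m'" using I by simp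
      qed
    qed (use a in auto)
    also have "\<dots> = a * 6 ^ CARD('n) * vol j"
      by (simp add: mult.assoc flip: power_mult_distrib)
    finally show ?thesis .
  qed
  have "vol j * (small j m')\<^sup>2 \<le> 36 * (real CARD('n))\<^sup>2 * 6 ^ CARD('n) * a * R j m'" for j m'
  proof -
    have "vol j * (small j m')\<^sup>2 \<le> vol j * (6 * real CARD('n) / vol j * R j m')\<^sup>2"
      using small_R small_nonneg by (intro mult_left_mono power_mono) (auto simp: less_imp_le)
    also have "\<dots> = 36 * (real CARD('n))\<^sup>2 / vol j * R j m' * R j m'" by (simp add: power2_eq_square field_simps)
    also have "\<dots> \<le> 36 * (real CARD('n))\<^sup>2 / vol j * R j m' * (a * 6 ^ CARD('n) * vol j)"
      using R0 by (intro mult_left_mono R_le) (auto simp: less_imp_le)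
    finally show ?thesis by (simp add: mult_ac)
  qed
  then have "(\<Sum>j\<in>{-N..K}. \<Sum>m'\<in>desc (nat (K - j)) mP. vol j * (small j m')\<^sup>2)
    \<le> (\<Sum>j\<in>{-N..K}. \<Sum>m'\<in>desc (nat (K - j)) mP. 36 * (real CARD('n))\<^sup>2 * 6 ^ CARD('n) * a * R j m')"
    by (intro sum_mono)
  also have "\<dots> = 36 * (real CARD('n))\<^sup>2 * 6 ^ CARD('n) * a * (\<Sum>j\<in>{-N..K}. \<Sum>m'\<in>desc (nat (K - j)) mP. R j m')"
    by (simp add: sum_distrib_left)
  also have "\<dots> \<le> 36 * (real CARD('n))\<^sup>2 * 6 ^ CARD('n) * a * (3 ^ CARD('n) * (geo \<gamma> * (a * vol K)))"
  proof (rule mult_left_mono)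
  have "(\<Sum>I\<in>W. \<Sum>j\<in>{j \<in> {-N..K}. fst I \<le> j}. ?g I j) = (\<Sum>I\<in>W. mass f (Q I) * (\<Sum>j\<in>{j \<in> {-N..K}. fst I \<le> j}. 2 powr (\<gamma> * of_int (fst I - j))))"
    by (simp add: sum_distrib_left mult.commute)
  also have "\<dots> \<le> (\<Sum>I\<in>W. mass f (Q I) * geo \<gamma>)"
  proof (intro sum_mono mult_left_mono mass_nonneg geo_sum_above \<gamma>)
    fix I show "finite {j \<in> {-N..K}. fst I \<le> j}" by (rule finite_subset[of _ "{-N..K}"]) auto
  qed auto
  also have "\<dots> = geo \<gamma> * (\<Sum>I\<in>W. mass f (Q I))" by (simp add: sum_distrib_left mult.commute)
  also have "\<dots> \<le> geo \<gamma> * (a * vol K)"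
  proof (intro mult_left_mono)
    have "(\<Sum>I\<in>W. mass f (Q I)) \<le> mass f top_star" using W_subset by (intro mass_sum_W) auto
    then show "(\<Sum>I\<in>W. mass f (Q I)) \<le> a * vol K" using mass_top by linarith
  qed (use geo_pos[OF \<gamma>(1)] in auto)
  finally have inner: "(\<Sum>I\<in>W. \<Sum>j\<in>{j \<in> {-N..K}. fst I \<le> j}. ?g I j) \<le> geo \<gamma> * (a * vol K)" .
  have "(\<Sum>j\<in>{-N..K}. \<Sum>m'\<in>desc (nat (K - j)) mP. R j m') \<le> (\<Sum>j\<in>{-N..K}. (2 * of_int 1 + 1) ^ CARD('n) * (\<Sum>I\<in>{I \<in> W. fst I \<le> j}. ?g I j))"
    unfolding R_def
  proof (rule sum_mono)
    fix j
    show "(\<Sum>m'\<in>desc (nat (K - j)) mP. \<Sum>I\<in>{I \<in> W. fst I \<le> j \<and> near 1 m' (?c I j)}. ?g I j) \<le>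
      (2 * of_int 1 + 1) ^ CARD('n) * (\<Sum>I\<in>{I \<in> W. fst I \<le> j}. ?g I j)"
      using finite_W by (intro sum_near_le[where c = "\<lambda>I. ?c I j"]) (auto intro: mult_nonneg_nonneg mass_nonneg)
  qed
  also have "\<dots> = 3 ^ CARD('n) * (\<Sum>I\<in>W. \<Sum>j\<in>{j \<in> {-N..K}. fst I \<le> j}. ?g I j)"
    using finite_W by (subst sum.swap_restrict[symmetric]) (auto simp: sum_distrib_left)
  also have "\<dots> \<le> 3 ^ CARD('n) * (geo \<gamma> * (a * vol K))" by (intro mult_left_mono inner) simp
  finally show "(\<Sum>j\<in>{-N..K}. \<Sum>m'\<in>desc (nat (K - j)) mP. R j m') \<le> 3 ^ CARD('n) * (geo \<gamma> * (a * vol K))" .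
  qed (use a in simp)
  also have "\<dots> = 36 * (real CARD('n))\<^sup>2 * 6 ^ CARD('n) * (3 ^ CARD('n) * geo \<gamma>) * (a\<^sup>2 * vol K)"
    by (simp add: power2_eq_square mult_ac)
  finally show ?thesis .
qed

text \<open>A Whitney cube whose scale exceeds \<open>k\<close> and that meets the support of a kernel below a cell of \<open>E\<close> of scale \<open>k\<close> would
  be close to \<open>E\<close> relative to its size. So the scale of the Whitney cube lies between \<open>j\<close> and \<open>k\<close>.\<close>

lemma coef_bad_large:
  assumes "m \<in> cells k" "j \<le> k" "m' \<in> desc (nat (k - j)) m" "I \<in> W" "j < fst I" "coef (bad I) j m' \<noteq> 0" "-N \<le> j"
  shows "fst I \<le> k" "near 2 m (coarsen (nat (k - fst I)) (snd I))"
proof -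
  obtain x where x: "x \<in> E" "m = cell k x" using assms(1) by blast
  have "\<exists>z. bad I z * \<psi> j m' z \<noteq> 0"
  proof (rule ccontr)
    assume "\<nexists>z. bad I z * \<psi> j m' z \<noteq> 0"
    then have "(\<lambda>z. bad I z * \<psi> j m' z) = (\<lambda>z. 0)" by blast
    then have "coef (bad I) j m' = 0" unfolding coef_def by simp
    then show False using assms(6) by simp
  qed
  then obtain z where z: "bad I z \<noteq> 0" "\<psi> j m' z \<noteq> 0" by auto
  have cz: "cell (fst I) z = snd I" using z(1) by (auto simp: bad_def indicator_def split: if_splits)
  have nz: "near 2 m (cell k z)" by (rule desc_star[OF assms(3,2) kernel_support[OF \<psi> z(2)]])
  show le: "fst I \<le> k"
  proof (rule ccontr)
    assume "\<not> fst I \<le> k"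
    then have "near 2 (cell (fst I) x) (cell (fst I) z)" using near_cell_mono[of 2 k x z "fst I"] nz x(2) by simp
    then have "near 2 (snd I) (cell (fst I) x)" using cz near_sym by metis
    moreover have "-N < fst I" using assms(5,7) by simp
    ultimately have "good (fst I) (snd I)" using x(1) by (auto simp: good_def)
    then show False using assms(4) by (auto simp: W_def)
  qed
  show "near 2 m (coarsen (nat (k - fst I)) (snd I))" using nz cell_coarsen'[OF le, of z] cz by simp
qed

text \<open>Against a kernel of smaller scale than the bad function there is no cancellation. As in \<open>beta_le\<close>, the weights leave
  the factor \<open>2 powr ((lam - 2) n (j - k))\<close>; with \<open>i\<close> the scale of the Whitney cube it splits into decaying
  factors for the pairs \<open>(j, i)\<close> and \<open>(i, k)\<close>, so that both sums converge.\<close>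

lemma large_total:
  "(\<Sum>k\<in>{-N..K}. \<Sum>m\<in>cells k. vol k * (\<Sum>j\<in>{-N..k}. \<Sum>m'\<in>desc (nat (k - j)) m. 2 powr (lam * real CARD('n) * of_int (j - k)) * (large j m')\<^sup>2))
    \<le> 16 * 9 ^ CARD('n) * (5 ^ CARD('n) * (geo ((lam - 2) * real CARD('n)))\<^sup>2) * (a\<^sup>2 * vol K)"
proof -
  let ?\<delta> = "(lam - 2) * real CARD('n)"
  have \<delta>: "0 < ?\<delta>" using lam by simp
  let ?c = "\<lambda>I k. coarsen (nat (k - fst I)) (snd I)"
  define Z where "Z k m j = {I \<in> {I \<in> W. j < fst I \<and> fst I \<le> k}. near 2 m (?c I k)}" for k m j
  define Y where "Y k m j = (\<Sum>I\<in>Z k m j. mass f (Q I))" for k m j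
  have Y0: "0 \<le> Y k m j" for k m j unfolding Y_def by (intro sum_nonneg mass_nonneg)
  have Z_fin: "finite (Z k m j)" for k m j unfolding Z_def using finite_W by simp
  have sum_large: "(\<Sum>m'\<in>desc (nat (k - j)) m. large j m') \<le> 4 * 3 ^ CARD('n) / vol j * Y k m j"
    if m: "m \<in> cells k" and j: "-N \<le> j" "j \<le> k" for k m j
  proof -
    have "(\<Sum>m'\<in>desc (nat (k - j)) m. large j m') = (\<Sum>I\<in>{I \<in> W. j < fst I}. \<Sum>m'\<in>desc (nat (k - j)) m. norm (coef (bad I) j m'))"
      unfolding large_def by (rule sum.swap)
    also have "\<dots> = (\<Sum>I\<in>Z k m j. \<Sum>m'\<in>desc (nat (k - j)) m. norm (coef (bad I) j m'))"
    proof (rule sum.mono_neutral_right)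
      show "\<forall>I\<in>{I \<in> W. j < fst I} - Z k m j. (\<Sum>m'\<in>desc (nat (k - j)) m. norm (coef (bad I) j m')) = 0"
      proof
        fix I assume I: "I \<in> {I \<in> W. j < fst I} - Z k m j"
        have "norm (coef (bad I) j m') = 0" if "m' \<in> desc (nat (k - j)) m" for m'
        proof (rule ccontr)
          assume "norm (coef (bad I) j m') \<noteq> 0"
          then have "I \<in> Z k m j" using coef_bad_large[OF m j(2) that, of I] I j(1) by (auto simp: Z_def)
          then show False using I by simp
        qed
        then show "(\<Sum>m'\<in>desc (nat (k - j)) m. norm (coef (bad I) j m')) = 0" by simp
      qed
    qed (use finite_W in \<open>auto simp: Z_def\<close>)
    also have "\<dots> \<le> (\<Sum>I\<in>Z k m j. 4 * 3 ^ CARD('n) / vol j * mass f (Q I))"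
    proof (rule sum_mono)
      fix I
      have "(\<Sum>m'\<in>desc (nat (k - j)) m. norm (coef (bad I) j m')) \<le> 2 * 3 ^ CARD('n) / vol j * mass (bad I) (star 2 k m)"
        by (rule sum_coef_le[OF integrable_bad j(2)])
      also have "\<dots> \<le> 2 * 3 ^ CARD('n) / vol j * (2 * mass f (Q I))"
        by (intro mult_left_mono mass_bad_le) (auto simp: less_imp_le)
      finally show "(\<Sum>m'\<in>desc (nat (k - j)) m. norm (coef (bad I) j m')) \<le> 4 * 3 ^ CARD('n) / vol j * mass f (Q I)" by simp
    qed
    finally show ?thesis by (simp add: Y_def sum_distrib_left)
  qed
  have Y_le: "Y k m j \<le> a * vol k" if m: "m \<in> cells k" for k m j
  proof -
    have "Y k m j \<le> mass f (star 2 k m)"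
      unfolding Y_def
    proof (rule mass_sum_W)
      fix I assume I: "I \<in> Z k m j"
      show "Q I \<subseteq> star 2 k m"
      proof
        fix z assume "z \<in> Q I"
        then have "cell k z = ?c I k" using I cell_coarsen'[of "fst I" k z] by (simp add: Z_def)
        then show "z \<in> star 2 k m" using I by (simp add: Z_def)
      qed
    qed (auto simp: Z_def)
    also have "\<dots> \<le> a * vol k" using m averages by auto
    finally show ?thesis .
  qed
  let ?C = "16 * 9 ^ CARD('n) * a"
  have term_le: "vol k * (2 powr (lam * real CARD('n) * of_int (j - k)) * (\<Sum>m'\<in>desc (nat (k - j)) m. (large j m')\<^sup>2)) \<le> ?C * (2 powr (?\<delta> * of_int (j - k)) * Y k m j)"
    if m: "m \<in> cells k" and j: "-N \<le> j" "j \<le> k" for k m j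
  proof -
    have "(\<Sum>m'\<in>desc (nat (k - j)) m. (large j m')\<^sup>2) \<le> (\<Sum>m'\<in>desc (nat (k - j)) m. large j m')\<^sup>2"
      using large_nonneg by (intro sum_squares_le_square_sum) auto
    also have "\<dots> \<le> (4 * 3 ^ CARD('n) / vol j * Y k m j)\<^sup>2"
      using sum_large[OF that] large_nonneg by (intro power_mono sum_nonneg) auto
    also have "\<dots> = (4 * 3 ^ CARD('n) * (1 / vol j))\<^sup>2 * Y k m j * Y k m j" by (simp add: power2_eq_square)
    also have "\<dots> \<le> (4 * 3 ^ CARD('n) * (1 / vol j))\<^sup>2 * Y k m j * (a * vol k)"
      using Y0 by (intro mult_left_mono Y_le m) auto
    finally have "vol k * (2 powr (lam * real CARD('n) * of_int (j - k)) * (\<Sum>m'\<in>desc (nat (k - j)) m. (large j m')\<^sup>2)) \<le>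
      vol k * (2 powr (lam * real CARD('n) * of_int (j - k)) * ((4 * 3 ^ CARD('n) * (1 / vol j))\<^sup>2 * Y k m j * (a * vol k)))"
      by (intro mult_left_mono) (auto simp: less_imp_le)
    also have "\<dots> = (4 * 3 ^ CARD('n))\<^sup>2 * a * ((vol k * (1 / vol j))\<^sup>2 * 2 powr (lam * real CARD('n) * of_int (j - k)) * Y k m j)"
      by (simp add: power_mult_distrib power2_eq_square)
    also have "vol k * (1 / vol j) = 2 powr (- real CARD('n) * of_int (j - k))" by (subst inverse_vol[of j k]) simp
    also have "(2 powr (- real CARD('n) * of_int (j - k)))\<^sup>2 * 2 powr (lam * real CARD('n) * of_int (j - k)) = (2::real) powr (?\<delta> * of_int (j - k))"
    proof -
      have "- real CARD('n) * of_int (j - k) + - real CARD('n) * of_int (j - k) + lam * real CARD('n) * of_int (j - k) = ?\<delta> * of_int (j - k)"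
        by (simp add: algebra_simps)
      then show ?thesis by (simp only: power2_eq_square powr_add[symmetric])
    qed
    also have "(4 * 3 ^ CARD('n))\<^sup>2 = (16 * 9 ^ CARD('n) :: real)"
      by (simp add: power2_eq_square flip: power_mult_distrib)
    finally show ?thesis by (simp add: mult.assoc)
  qed
  have "(\<Sum>k\<in>{-N..K}. \<Sum>m\<in>cells k. vol k * (\<Sum>j\<in>{-N..k}. \<Sum>m'\<in>desc (nat (k - j)) m. 2 powr (lam * real CARD('n) * of_int (j - k)) * (large j m')\<^sup>2))
    = (\<Sum>k\<in>{-N..K}. \<Sum>m\<in>cells k. \<Sum>j\<in>{-N..k}. vol k * (2 powr (lam * real CARD('n) * of_int (j - k)) * (\<Sum>m'\<in>desc (nat (k - j)) m. (large j m')\<^sup>2)))"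
    by (simp add: sum_distrib_left)
  also have "\<dots> \<le> (\<Sum>k\<in>{-N..K}. \<Sum>m\<in>cells k. \<Sum>j\<in>{-N..k}. ?C * (2 powr (?\<delta> * of_int (j - k)) * Y k m j))"
    by (intro sum_mono term_le) auto
  also have "\<dots> = ?C * (\<Sum>k\<in>{-N..K}. \<Sum>j\<in>{-N..k}. 2 powr (?\<delta> * of_int (j - k)) * (\<Sum>m\<in>cells k. Y k m j))"
    unfolding sum_distrib_left by (intro sum.cong refl sum.swap)
  also have "\<dots> \<le> ?C * (\<Sum>k\<in>{-N..K}. \<Sum>j\<in>{-N..k}. 2 powr (?\<delta> * of_int (j - k)) * (5 ^ CARD('n) * (\<Sum>I\<in>{I \<in> W. j < fst I \<and> fst I \<le> k}. mass f (Q I))))"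
  proof (intro mult_left_mono sum_mono)
    fix k j assume k: "k \<in> {-N..K}"
    have "(\<Sum>m\<in>cells k. Y k m j) \<le> (2 * of_int 2 + 1) ^ CARD('n) * (\<Sum>I\<in>{I \<in> W. j < fst I \<and> fst I \<le> k}. mass f (Q I))"
      unfolding Y_def using finite_cells[of k] k finite_W
      by (intro sum_near_le[where c = "\<lambda>I. ?c I k"]) (auto simp: Z_def mass_nonneg)
    then show "(\<Sum>m\<in>cells k. Y k m j) \<le> 5 ^ CARD('n) * (\<Sum>I\<in>{I \<in> W. j < fst I \<and> fst I \<le> k}. mass f (Q I))" by simp
  qed (use a in auto)
  also have "\<dots> \<le> ?C * (5 ^ CARD('n) * ((geo ?\<delta>)\<^sup>2 * (a * vol K)))"
  proof (rule mult_left_mono)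
  have "(\<Sum>k\<in>{-N..K}. \<Sum>j\<in>{-N..k}. \<Sum>I\<in>{I \<in> W. j < fst I \<and> fst I \<le> k}. 2 powr (?\<delta> * of_int (j - k)) * mass f (Q I))
    = (\<Sum>I\<in>W. mass f (Q I) * (\<Sum>k\<in>{-N..K}. \<Sum>j\<in>{-N..k}. of_bool (j < fst I \<and> fst I \<le> k) * 2 powr (?\<delta> * of_int (j - k))))"
  proof -
    have "(\<Sum>I\<in>{I \<in> W. j < fst I \<and> fst I \<le> k}. 2 powr (?\<delta> * of_int (j - k)) * mass f (Q I))
      = (\<Sum>I\<in>W. mass f (Q I) * (of_bool (j < fst I \<and> fst I \<le> k) * 2 powr (?\<delta> * of_int (j - k))))" for k j
      using finite_W by (subst sum.inter_filter) (auto intro!: sum.cong)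
    then show ?thesis
      by (simp only:) (simp only: sum.swap[of _ W] sum_distrib_left)
  qed
  also have "\<dots> \<le> (\<Sum>I\<in>W. mass f (Q I) * (geo ?\<delta>)\<^sup>2)"
  proof (intro sum_mono mult_left_mono mass_nonneg)
    fix I
    let ?A = "{k \<in> {-N..K}. fst I \<le> k}" and ?B = "{j \<in> {-N..K}. j < fst I}"
    have fin: "finite ?A" "finite ?B" by (rule finite_subset[of _ "{-N..K}"]; auto)+
    have "(\<Sum>k\<in>{-N..K}. \<Sum>j\<in>{-N..k}. of_bool (j < fst I \<and> fst I \<le> k) * 2 powr (?\<delta> * of_int (j - k))) \<le>
      (\<Sum>k\<in>{-N..K}. \<Sum>j\<in>{-N..K}. of_bool (j < fst I \<and> fst I \<le> k) * 2 powr (?\<delta> * of_int (j - k)))"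
      by (intro sum_mono sum_mono2) auto
    also have "\<dots> = (\<Sum>k\<in>{-N..K}. \<Sum>j\<in>{-N..K}. of_bool (fst I \<le> k) * 2 powr (?\<delta> * of_int (fst I - k)) * (of_bool (j < fst I) * 2 powr (?\<delta> * of_int (j - fst I))))"
    proof (intro sum.cong refl)
      fix k j
      have "?\<delta> * of_int (fst I - k) + ?\<delta> * of_int (j - fst I) = ?\<delta> * of_int (j - k)" by (simp add: algebra_simps)
      then have "2 powr (?\<delta> * of_int (j - k)) = (2::real) powr (?\<delta> * of_int (fst I - k)) * 2 powr (?\<delta> * of_int (j - fst I))"
        by (simp only: powr_add[symmetric])
      then show "of_bool (j < fst I \<and> fst I \<le> k) * 2 powr (?\<delta> * of_int (j - k)) = of_bool (fst I \<le> k) * 2 powr (?\<delta> * of_int (fst I - k)) * (of_bool (j < fst I) * (2::real) powr (?\<delta> * of_int (j - fst I)))"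
        by (simp only: of_bool_conj ac_simps)
    qed
    also have "\<dots> = (\<Sum>k\<in>{-N..K}. of_bool (fst I \<le> k) * 2 powr (?\<delta> * of_int (fst I - k))) * (\<Sum>j\<in>{-N..K}. of_bool (j < fst I) * 2 powr (?\<delta> * of_int (j - fst I)))"
      by (simp only: sum_product)
    also have "(\<Sum>k\<in>{-N..K}. of_bool (fst I \<le> k) * 2 powr (?\<delta> * of_int (fst I - k))) = (\<Sum>k\<in>?A. 2 powr (?\<delta> * of_int (fst I - k)))"
      unfolding sum.inter_filter[OF finite_atLeastAtMost_int] by (rule sum.cong[OF refl]) simp
    also have "(\<Sum>j\<in>{-N..K}. of_bool (j < fst I) * 2 powr (?\<delta> * of_int (j - fst I))) = (\<Sum>j\<in>?B. 2 powr (?\<delta> * of_int (j - fst I)))"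
      unfolding sum.inter_filter[OF finite_atLeastAtMost_int] by (rule sum.cong[OF refl]) simp
    also have "(\<Sum>k\<in>?A. 2 powr (?\<delta> * of_int (fst I - k))) * (\<Sum>j\<in>?B. 2 powr (?\<delta> * of_int (j - fst I))) \<le> geo ?\<delta> * geo ?\<delta>"
      using \<delta> fin geo_pos[OF \<delta>] by (intro mult_mono geo_sum_above geo_sum_below sum_nonneg) auto
    finally show "(\<Sum>k\<in>{-N..K}. \<Sum>j\<in>{-N..k}. of_bool (j < fst I \<and> fst I \<le> k) * 2 powr (?\<delta> * of_int (j - k))) \<le> (geo ?\<delta>)\<^sup>2"
      by (simp only: power2_eq_square)
  qed
  also have "\<dots> = (geo ?\<delta>)\<^sup>2 * (\<Sum>I\<in>W. mass f (Q I))"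
    unfolding sum_distrib_left by (intro sum.cong refl mult.commute)
  also have "\<dots> \<le> (geo ?\<delta>)\<^sup>2 * (a * vol K)"
  proof (intro mult_left_mono)
    have "(\<Sum>I\<in>W. mass f (Q I)) \<le> mass f top_star" using W_subset by (intro mass_sum_W) auto
    then show "(\<Sum>I\<in>W. mass f (Q I)) \<le> a * vol K" using mass_top by linarith
  qed auto
  finally have inner: "(\<Sum>k\<in>{-N..K}. \<Sum>j\<in>{-N..k}. \<Sum>I\<in>{I \<in> W. j < fst I \<and> fst I \<le> k}. 2 powr (?\<delta> * of_int (j - k)) * mass f (Q I)) \<le> (geo ?\<delta>)\<^sup>2 * (a * vol K)" .
  have "(\<Sum>k\<in>{-N..K}. \<Sum>j\<in>{-N..k}. 2 powr (?\<delta> * of_int (j - k)) * (5 ^ CARD('n) * (\<Sum>I\<in>{I \<in> W. j < fst I \<and> fst I \<le> k}. mass f (Q I))))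
    = 5 ^ CARD('n) * (\<Sum>k\<in>{-N..K}. \<Sum>j\<in>{-N..k}. \<Sum>I\<in>{I \<in> W. j < fst I \<and> fst I \<le> k}. 2 powr (?\<delta> * of_int (j - k)) * mass f (Q I))"
    by (simp add: sum_distrib_left mult_ac)
  also have "\<dots> \<le> 5 ^ CARD('n) * ((geo ?\<delta>)\<^sup>2 * (a * vol K))" by (intro mult_left_mono inner) simp
  finally show "(\<Sum>k\<in>{-N..K}. \<Sum>j\<in>{-N..k}. 2 powr (?\<delta> * of_int (j - k)) * (5 ^ CARD('n) * (\<Sum>I\<in>{I \<in> W. j < fst I \<and> fst I \<le> k}. mass f (Q I))))
    \<le> 5 ^ CARD('n) * ((geo ?\<delta>)\<^sup>2 * (a * vol K))" .
  qed (use a in simp)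
  also have "\<dots> = 16 * 9 ^ CARD('n) * (5 ^ CARD('n) * (geo ?\<delta>)\<^sup>2) * (a\<^sup>2 * vol K)"
    by (simp add: power2_eq_square mult_ac)
  finally show ?thesis .
qed

text \<open>The three parts of the decomposition are controlled by almost orthogonality (\<open>flat_total\<close>), by the
  cancellation of the bad part (\<open>small_total\<close>) and by the decay of the weights \<open>2 powr (lam n (j - k))\<close>
  (\<open>large_total\<close>), respectively.\<close>

lemma local_estimate:
  "(\<Sum>k\<in>{-N..K}. \<Sum>m\<in>cells k. vol k * beta f k m) \<le> local_const TYPE('n) \<gamma> lam * a\<^sup>2 * vol K"
proof -
  define T where "T A = (\<Sum>k\<in>{-N..K}. \<Sum>m\<in>cells k. vol k * (\<Sum>j\<in>{-N..k}. \<Sum>m'\<in>desc (nat (k - j)) m. 2 powr (lam * real CARD('n) * of_int (j - k)) * A j m'))"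
    for A :: "int \<Rightarrow> int ^ 'n \<Rightarrow> real"
  have "(\<Sum>k\<in>{-N..K}. \<Sum>m\<in>cells k. vol k * beta f k m) \<le> T (\<lambda>j m'. 3 * ((norm (coef flat j m'))\<^sup>2 + (small j m')\<^sup>2 + (large j m')\<^sup>2))"
    unfolding T_def beta_def
    by (intro sum_mono mult_left_mono coef_split desc_top) (auto simp: less_imp_le)
  also have "\<dots> = 3 * (T (\<lambda>j m'. (norm (coef flat j m'))\<^sup>2) + T (\<lambda>j m'. (small j m')\<^sup>2) + T (\<lambda>j m'. (large j m')\<^sup>2))"
    unfolding T_def by (simp add: sum.distrib sum_distrib_left distrib_left mult_ac)
  also have "\<dots> \<le> 3 * (3 ^ CARD('n) * geo ((lam - 1) * real CARD('n)) * (bessel_const TYPE('n) \<gamma> * 20 ^ CARD('n) * (a\<^sup>2 * vol K))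
    + 3 ^ CARD('n) * geo ((lam - 1) * real CARD('n)) * (36 * (real CARD('n))\<^sup>2 * 6 ^ CARD('n) * (3 ^ CARD('n) * geo \<gamma>) * (a\<^sup>2 * vol K))
    + 16 * 9 ^ CARD('n) * (5 ^ CARD('n) * (geo ((lam - 2) * real CARD('n)))\<^sup>2) * (a\<^sup>2 * vol K))"
  proof (intro mult_left_mono add_mono)
    have g: "0 \<le> 3 ^ CARD('n) * geo ((lam - 1) * real CARD('n))"
      using lam geo_pos[of "(lam - 1) * real CARD('n)"] by simp
    show "T (\<lambda>j m'. (norm (coef flat j m'))\<^sup>2) \<le> 3 ^ CARD('n) * geo ((lam - 1) * real CARD('n)) * (bessel_const TYPE('n) \<gamma> * 20 ^ CARD('n) * (a\<^sup>2 * vol K))"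
      unfolding T_def by (rule order_trans[OF total_le mult_left_mono[OF flat_total g]]) simp
    show "T (\<lambda>j m'. (small j m')\<^sup>2) \<le> 3 ^ CARD('n) * geo ((lam - 1) * real CARD('n)) * (36 * (real CARD('n))\<^sup>2 * 6 ^ CARD('n) * (3 ^ CARD('n) * geo \<gamma>) * (a\<^sup>2 * vol K))"
      unfolding T_def by (rule order_trans[OF total_le mult_left_mono[OF small_total g]]) simp
    show "T (\<lambda>j m'. (large j m')\<^sup>2) \<le> 16 * 9 ^ CARD('n) * (5 ^ CARD('n) * (geo ((lam - 2) * real CARD('n)))\<^sup>2) * (a\<^sup>2 * vol K)"
      unfolding T_def by (rule large_total)
  qed simp
  also have "\<dots> = local_const TYPE('n) \<gamma> lam * a\<^sup>2 * vol K"
    unfolding local_const_def by (simp only: distrib_left distrib_right mult.assoc)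
  finally show ?thesis .
qed

end

section \<open>The weighted square function estimate\<close>

lemma nn_integral_norm_mass:
  fixes f :: "real ^ 'n \<Rightarrow> complex"
  assumes "integrable lebesgue f" "S \<in> sets lebesgue"
  shows "(\<integral>\<^sup>+z. ennreal (norm (f z)) * indicator S z \<partial>lebesgue) = ennreal (mass f S)"
proof -
  have "(\<integral>\<^sup>+z. ennreal (norm (f z)) * indicator S z \<partial>lebesgue) = (\<integral>\<^sup>+z. ennreal (indicator S z * norm (f z)) \<partial>lebesgue)"
    by (intro nn_integral_cong) (auto simp: indicator_def)
  also have "\<dots> = ennreal (mass f S)"
    unfolding mass_def using assms by (intro nn_integral_eq_integral mass_integrable) auto
  finally show ?thesis .
qed

abbreviation max_avg :: "(real ^ 'n \<Rightarrow> complex) \<Rightarrow> real ^ 'n \<Rightarrow> ennreal" where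
  "max_avg f \<equiv> maxfn lebesgue UNIV (\<lambda>z. ennreal (norm (f z)))"

context kernel_family
begin

definition square :: "(real ^ 'n \<Rightarrow> complex) \<Rightarrow> int \<Rightarrow> real ^ 'n \<Rightarrow> real" where
  "square f K x = (\<Sum>k\<in>{-N..K}. beta f k (cell k x))"

lemma square_nonneg: "0 \<le> square f K x"
  unfolding square_def by (intro sum_nonneg beta_nonneg)

lemma square_measurable [measurable]: "square f K \<in> borel_measurable lebesgue"
  unfolding square_def[abs_def] by (intro borel_measurable_sum borel_measurable_of_cell)

lemma mass_star_max_avg:
  fixes f :: "real ^ 'n \<Rightarrow> complex"
  assumes "integrable lebesgue f"
  shows "ennreal (mass f (star 2 k (cell k x)) / vol k) \<le> max_avg f x"
proof -
  have "ennreal (mass f (star 2 k (cell k x)) / vol k) = ennreal (mass f (star 2 k (cell k x))) / emeasure lebesgue (cube k (cell k x))"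
    by (simp add: emeasure_cube vol_def[symmetric] divide_ennreal mass_nonneg)
  also have "\<dots> = (\<integral>\<^sup>+z. ennreal (norm (f z)) * indicator (star 2 k (cell k x)) z \<partial>lebesgue) / emeasure lebesgue (cube k (cell k x))"
    by (subst nn_integral_norm_mass[OF assms]) auto
  also have "\<dots> \<le> max_avg f x" unfolding maxfn_def by (rule SUP_upper) simp
  finally show ?thesis .
qed

lemma averages_of_max_avg:
  fixes f :: "real ^ 'n \<Rightarrow> complex"
  assumes "integrable lebesgue f" "max_avg f x \<le> ennreal a" "0 \<le> a"
  shows "mass f (star 2 k (cell k x)) \<le> a * vol k"
proof -
  have "ennreal (mass f (star 2 k (cell k x)) / vol k) \<le> ennreal a"
    using mass_star_max_avg[OF assms(1), of k x] assms(2) by (rule order_trans)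
  then have "mass f (star 2 k (cell k x)) / vol k \<le> a" using assms(3) by simp
  then show ?thesis by (simp add: divide_le_eq)
qed

lemma square_local:
  assumes f: "integrable lebesgue f" and E: "E \<in> sets lebesgue" "E \<subseteq> cube K mP" and a: "0 \<le> a"
    and M: "\<And>x. x \<in> E \<Longrightarrow> max_avg f x \<le> ennreal a"
  shows "(\<integral>\<^sup>+x. ennreal (square f K x) * indicator E x \<partial>lebesgue) \<le> ennreal (local_const TYPE('n) \<gamma> lam * a\<^sup>2 * vol K)"
proof (cases "E = {} \<or> K < -N")
  case True
  then have zero: "ennreal (square f K x) * indicator E x = 0" for x by (auto simp: square_def)
  show ?thesis unfolding zero by simp
next
  case False
  interpret whitney \<gamma> lam \<psi> N f E K mP a
    by unfold_locales (use f E a False averages_of_max_avg[OF f M a] in auto)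
  have "ennreal (square f K x) * indicator E x \<le> (\<Sum>k\<in>{-N..K}. \<Sum>m\<in>cells k. ennreal (beta f k m) * indicator (cube k m) x)" for x
  proof (cases "x \<in> E")
    case True
    have "ennreal (beta f k (cell k x)) \<le> (\<Sum>m\<in>cells k. ennreal (beta f k m) * indicator (cube k m) x)" if "k \<in> {-N..K}" for k
      using True finite_cells[of k] that
      by (intro order_trans[OF _ member_le_sum[of "cell k x"]]) auto
    then have "(\<Sum>k\<in>{-N..K}. ennreal (beta f k (cell k x))) \<le> (\<Sum>k\<in>{-N..K}. \<Sum>m\<in>cells k. ennreal (beta f k m) * indicator (cube k m) x)"
      by (rule sum_mono)
    moreover have "ennreal (square f K x) = (\<Sum>k\<in>{-N..K}. ennreal (beta f k (cell k x)))"
      unfolding square_def by (rule sum_ennreal[symmetric]) (rule beta_nonneg)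
    ultimately show ?thesis using True by (simp only: indicator_simps mult_1_right)
  qed simp
  then have "(\<integral>\<^sup>+x. ennreal (square f K x) * indicator E x \<partial>lebesgue) \<le>
    (\<integral>\<^sup>+x. (\<Sum>k\<in>{-N..K}. \<Sum>m\<in>cells k. ennreal (beta f k m) * indicator (cube k m) x) \<partial>lebesgue)"
    by (intro nn_integral_mono)
  also have "\<dots> = (\<Sum>k\<in>{-N..K}. \<Sum>m\<in>cells k. ennreal (beta f k m) * emeasure lebesgue (cube k m))"
    by (simp add: nn_integral_sum nn_integral_cmult)
  also have "\<dots> = (\<Sum>k\<in>{-N..K}. \<Sum>m\<in>cells k. ennreal (vol k * beta f k m))"
    by (intro sum.cong refl) (simp add: emeasure_cube vol_def[symmetric] ennreal_mult beta_nonneg less_imp_le mult.commute)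
  also have "\<dots> = ennreal (\<Sum>k\<in>{-N..K}. \<Sum>m\<in>cells k. vol k * beta f k m)"
    using beta_nonneg by (simp add: sum_ennreal sum_nonneg less_imp_le)
  also have "\<dots> \<le> ennreal (local_const TYPE('n) \<gamma> lam * a\<^sup>2 * vol K)"
    by (intro ennreal_leI local_estimate)
  finally show ?thesis .
qed

lemma square_le_max_avg:
  assumes "integrable lebesgue f"
  shows "ennreal (square f K x) \<le> ennreal (real (card {-N..K}) * (4 * 9 ^ CARD('n) * geo ((lam - 2) * real CARD('n)))) * (max_avg f x)\<^sup>2"
proof -
  let ?c = "4 * 9 ^ CARD('n) * geo ((lam - 2) * real CARD('n))"
  have c: "0 \<le> ?c" using lam geo_pos[of "(lam - 2) * real CARD('n)"] by simp
  have "ennreal (square f K x) = (\<Sum>k\<in>{-N..K}. ennreal (beta f k (cell k x)))"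
    unfolding square_def by (simp add: beta_nonneg sum_ennreal)
  also have "\<dots> \<le> (\<Sum>k\<in>{-N..K}. ennreal ?c * (max_avg f x)\<^sup>2)"
  proof (rule sum_mono)
    fix k
    let ?M = "mass f (star 2 k (cell k x)) / vol k"
    have "ennreal (beta f k (cell k x)) \<le> ennreal (?c * ?M\<^sup>2)" by (intro ennreal_leI beta_le assms)
    also have "\<dots> = ennreal ?c * (ennreal ?M)\<^sup>2" using c by (simp add: ennreal_mult ennreal_power mass_nonneg less_imp_le)
    also have "\<dots> \<le> ennreal ?c * (max_avg f x)\<^sup>2"
      by (intro mult_left_mono power_mono mass_star_max_avg assms) auto
    finally show "ennreal (beta f k (cell k x)) \<le> ennreal ?c * (max_avg f x)\<^sup>2" .
  qed
  also have "\<dots> = ennreal (real (card {-N..K}) * ?c) * (max_avg f x)\<^sup>2"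
    using c by (simp add: ennreal_mult ennreal_of_nat_eq_real_of_nat mult.assoc del: card_atLeastAtMost_int)
  finally show ?thesis .
qed

end

context dual_weights
begin

definition \<theta> :: real where "\<theta> = 1 - 1 / (2 powr q * ratio_const 0 + 1)"

lemma theta: "0 < \<theta>" "\<theta> < 1"
proof -
  have "0 < 2 powr q * ratio_const 0" using ratio_const_pos[of 0] by simp
  then show "0 < \<theta>" "\<theta> < 1" unfolding \<theta>_def by (simp_all add: field_simps)
qed

lemma half_cube:
  assumes E[measurable]: "E \<in> sets lebesgue" and sub: "E \<subseteq> cube k m" and half: "emeasure lebesgue E \<le> ennreal ((2 powi k) ^ CARD('n) / 2)"
  shows "emeasure (weighted w) E \<le> ennreal \<theta> * emeasure (weighted w) (cube k m)"
  unfolding \<theta>_def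
proof (rule half_measure[OF E _ sub _ emeasure_cube half])
  interpret W: doubling_measure "weighted w" "ratio_const 2 + 1" by (rule doubling)
  show "emeasure (weighted w) (cube k m) \<noteq> top" by (rule W.cube_fin)
  have "star 0 k m = cube k m" by (auto simp: near_def vec_eq_iff)
  then show "ennreal_powr (emeasure lebesgue (cube k m - E)) q * emeasure (weighted w) (cube k m)
      \<le> ennreal (ratio_const 0) * ennreal_powr (emeasure lebesgue (cube k m)) q * emeasure (weighted w) (cube k m - E)"
    using star_ratio[of "cube k m - E" 0 k m] by simp
qed (use ratio_const_pos[of 0] in auto)

text \<open>The level set of \<open>u\<close> at \<open>s\<close> is the disjoint union of the maximal cubes, of scale \<open>k\<close> say, on which the scales from
  \<open>k\<close> upwards alone exceed \<open>s\<^sup>2\<close>. By maximality the scales above such a cube contribute at most \<open>s\<^sup>2\<close>, so at a point with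
  \<open>u > \<kappa> s\<close> the scales up to \<open>k\<close> contribute at least \<open>(\<kappa>\<^sup>2 - 1) s\<^sup>2\<close>; where \<open>max_avg f\<close> is at most \<open>e s\<close>, this happens
  on at most half of the cube, by \<open>square_local\<close>. Since only the fraction \<open>\<theta>\<close> is gained in weighted measure, \<open>\<kappa>\<close> is left free: the
  application takes it so close to \<open>1\<close> that \<open>\<kappa> powr q * \<theta> < 1\<close>.\<close>

lemma good_lambda:
  fixes N K :: int
  assumes "kernel_family \<gamma> lam (\<psi> :: int \<Rightarrow> int ^ 'n \<Rightarrow> real ^ 'n \<Rightarrow> complex)" and f: "integrable lebesgue f"
    and \<kappa>: "1 < \<kappa>" and e: "0 < e" "2 * local_const TYPE('n) \<gamma> lam * e\<^sup>2 \<le> \<kappa>\<^sup>2 - 1" and s: "0 < s"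
  defines "u \<equiv> (\<lambda>x. sqrt (kernel_family.square lam \<psi> N f K x))"
  shows "emeasure (weighted w) {x. \<kappa> * s < u x \<and> max_avg f x \<le> ennreal (e * s)} \<le> ennreal \<theta> * emeasure (weighted w) {x. s < u x}"
proof -
  interpret kernel_family \<gamma> lam \<psi> N by fact
  have u2: "t < u x \<longleftrightarrow> t\<^sup>2 < square f K x" if "0 \<le> t" for t x
    unfolding u_def using that real_less_rsqrt real_sqrt_less_iff[of "t\<^sup>2"] by simp
  have [measurable]: "u \<in> borel_measurable lebesgue" unfolding u_def by measurable
  define F where "F k m \<longleftrightarrow> k \<le> K \<and> s\<^sup>2 < (\<Sum>k'\<in>{k..K}. beta f k' (coarsen (nat (k' - k)) m))"
    for k and m :: "int ^ 'n"
  let ?I = "maximal_cubes F" and ?C = "\<lambda>p. case p of (k, m) \<Rightarrow> cube k m"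
  have F_cell: "F k (cell k x) \<longleftrightarrow> k \<le> K \<and> s\<^sup>2 < (\<Sum>k'\<in>{k..K}. beta f k' (cell k' x))" for k x
    unfolding F_def by (auto simp: cell_coarsen'[of k _ x, symmetric])
  have beta0: "beta f k m = 0" if "k < -N" for k m using that by (simp add: beta_def)
  have part: "(\<Sum>k'\<in>{k..K}. beta f k' (cell k' x)) \<le> square f K x" for k x
  proof -
    have "(\<Sum>k'\<in>{k..K}. beta f k' (cell k' x)) = (\<Sum>k'\<in>{k..K} \<inter> {-N..K}. beta f k' (cell k' x))"
      by (rule sum.mono_neutral_right) (auto simp: beta0)
    also have "\<dots> \<le> square f K x" unfolding square_def using beta_nonneg by (intro sum_mono2) auto
    finally show ?thesis .
  qed
  have split: "square f K x \<le> square f k x + (\<Sum>k'\<in>{k + 1..K}. beta f k' (cell k' x))" for k x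
  proof -
    have "square f K x \<le> (\<Sum>k'\<in>{-N..k} \<union> {k + 1..K}. beta f k' (cell k' x))"
      unfolding square_def using beta_nonneg by (intro sum_mono2) auto
    also have "\<dots> = square f k x + (\<Sum>k'\<in>{k + 1..K}. beta f k' (cell k' x))"
      unfolding square_def by (rule sum.union_disjoint) auto
    finally show ?thesis .
  qed
  have U: "{x. s < u x} = (\<Union>p\<in>?I. ?C p)"
  proof (intro equalityI subsetI)
    fix x assume "x \<in> {x. s < u x}"
    then have big: "s\<^sup>2 < square f K x" using s u2 by simp
    have "-N \<le> K"
    proof (rule ccontr)
      assume "\<not> ?thesis" then have "square f K x = 0" by (simp add: square_def)
      then show False using big s by simp
    qed
    then have "F (-N) (cell (-N) x)" using big unfolding F_cell square_def by simp
    then obtain d where d: "(- N + int d, coarsen d (cell (- N) x)) \<in> ?I"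
      by (rule maximal_cubes_cover[of F K, rotated]) (auto simp: F_def)
    have "x \<in> cube (- N + int d) (coarsen d (cell (- N) x))" by (simp only: mem_cube cell_coarsen)
    then show "x \<in> (\<Union>p\<in>?I. ?C p)" using d by force
  next
    fix x assume "x \<in> (\<Union>p\<in>?I. ?C p)"
    then obtain k where "(k, cell k x) \<in> ?I" by auto
    then have "F k (cell k x)" by (auto simp: maximal_cubes_def)
    then have "s\<^sup>2 < square f K x" using part[of x k] unfolding F_cell by linarith
    then show "x \<in> {x. s < u x}" using s u2 by simp
  qed
  define E where "E = {x. \<kappa> * s < u x \<and> max_avg f x \<le> ennreal (e * s)}"
  have [measurable]: "E \<in> sets lebesgue"
  proof -
    have "{x \<in> space lebesgue. \<kappa> * s < u x \<and> max_avg f x \<le> ennreal (e * s)} \<in> sets lebesgue" by measurable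
    then show ?thesis unfolding E_def space_completion space_lborel space_borel by (simp only: UNIV_I simp_thms)
  qed
  have "E \<subseteq> {x. s < u x}"
  proof
    fix x assume "x \<in> E"
    moreover have "s < \<kappa> * s" using \<kappa> s by simp
    ultimately show "x \<in> {x. s < u x}" unfolding E_def mem_Collect_eq by linarith
  qed
  then have EU: "E = (\<Union>p\<in>?I. E \<inter> ?C p)" unfolding U by blast
  have local: "emeasure (weighted w) (E \<inter> cube k m) \<le> ennreal \<theta> * emeasure (weighted w) (cube k m)"
    if I: "(k, m) \<in> ?I" for k m
  proof (rule half_cube)
    let ?E = "E \<inter> cube k m" and ?c = "(\<kappa>\<^sup>2 - 1) * s\<^sup>2"
    have c: "0 < ?c" using \<kappa> s by (simp add: one_less_power)
    have large: "?c \<le> square f k x" if x: "x \<in> ?E" for x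
    proof -
      have "\<not> F (k + 1) (cell (k + 1) x)"
      proof -
        have "\<forall>d>0. \<not> F (k + int d) (coarsen d m)" using I by (auto simp: maximal_cubes_def)
        then have "\<not> F (k + int 1) (coarsen 1 m)" by (meson less_one)
        moreover have "cell (k + int 1) x = coarsen 1 m" using x unfolding cell_coarsen by simp
        ultimately show ?thesis by (simp only: of_nat_1 not_False_eq_True)
      qed
      then have "(\<Sum>k'\<in>{k + 1..K}. beta f k' (cell k' x)) \<le> s\<^sup>2"
        unfolding F_cell by (cases "k + 1 \<le> K") auto
      moreover have "(\<kappa> * s)\<^sup>2 < square f K x" using x u2[of "\<kappa> * s" x] \<kappa> s by (simp add: E_def)
      ultimately have "(\<kappa> * s)\<^sup>2 - s\<^sup>2 \<le> square f k x" using split[of x k] by linarith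
      then show ?thesis by (simp add: power_mult_distrib left_diff_distrib)
    qed
    have "ennreal ?c * emeasure lebesgue ?E = (\<integral>\<^sup>+x. ennreal ?c * indicator ?E x \<partial>lebesgue)"
      by (simp add: nn_integral_cmult_indicator)
    also have "\<dots> \<le> (\<integral>\<^sup>+x. ennreal (square f k x) * indicator ?E x \<partial>lebesgue)"
      using large by (intro nn_integral_mono) (auto simp: indicator_def intro!: ennreal_leI)
    also have "\<dots> \<le> ennreal (local_const TYPE('n) \<gamma> lam * (e * s)\<^sup>2 * vol k)"
    proof (rule square_local[OF f, where mP = m])
      show "max_avg f x \<le> ennreal (e * s)" if "x \<in> ?E" for x using that unfolding E_def by blast
      show "0 \<le> e * s" using e s by simp
      show "?E \<in> sets lebesgue" by measurable
    qed simp
    also have "\<dots> \<le> ennreal (?c * (vol k / 2))"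
    proof (rule ennreal_leI)
      have "local_const TYPE('n) \<gamma> lam * e\<^sup>2 \<le> (\<kappa>\<^sup>2 - 1) / 2" using e(2) by (simp add: field_simps)
      then have "local_const TYPE('n) \<gamma> lam * e\<^sup>2 * (s\<^sup>2 * vol k) \<le> (\<kappa>\<^sup>2 - 1) / 2 * (s\<^sup>2 * vol k)"
        by (intro mult_right_mono) (auto simp: less_imp_le)
      then show "local_const TYPE('n) \<gamma> lam * (e * s)\<^sup>2 * vol k \<le> ?c * (vol k / 2)"
        by (simp add: power_mult_distrib mult_ac)
    qed
    also have "\<dots> = ennreal ?c * ennreal (vol k / 2)" using c by (intro ennreal_mult) (auto simp: less_imp_le)
    finally have le: "ennreal ?c * emeasure lebesgue ?E \<le> ennreal ?c * ennreal (vol k / 2)" .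
    have "ennreal ?c \<noteq> 0" using c by (simp only: ennreal_eq_0_iff not_le)
    then show "emeasure lebesgue ?E \<le> ennreal ((2 powi k) ^ CARD('n) / 2)"
      using le by (simp only: ennreal_mult_le_mult_iff ennreal_neq_top vol_def not_False_eq_True)
  qed auto
  have "emeasure (weighted w) E = emeasure (weighted w) (\<Union>p\<in>?I. E \<inter> ?C p)" using EU by simp
  also have "\<dots> \<le> (\<integral>\<^sup>+p. emeasure (weighted w) (E \<inter> ?C p) \<partial>count_space ?I)"
    by (rule emeasure_UN_le_countable) auto
  also have "\<dots> \<le> (\<integral>\<^sup>+p. ennreal \<theta> * emeasure (weighted w) (?C p) \<partial>count_space ?I)"
    using local by (intro nn_integral_mono) auto
  also have "\<dots> = ennreal \<theta> * (\<integral>\<^sup>+p. emeasure (weighted w) (?C p) \<partial>count_space ?I)"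
    by (simp add: nn_integral_cmult)
  also have "(\<integral>\<^sup>+p. emeasure (weighted w) (?C p) \<partial>count_space ?I) = emeasure (weighted w) (\<Union>p\<in>?I. ?C p)"
    by (intro emeasure_UN_countable[symmetric] maximal_cubes_disjoint) auto
  finally show ?thesis unfolding U[symmetric] E_def .
qed

text \<open>Integration of \<open>good_lambda\<close> over all levels. The choice of \<open>\<kappa>\<close> makes the coefficient \<open>\<theta>\<close> of the weighted norm on
  the right smaller than its coefficient \<open>(1 + \<theta>) / 2\<close> on the left, so that the term can be absorbed.\<close>

lemma square_bounded:
  assumes \<gamma>: "0 < \<gamma>" "\<gamma> \<le> 1" and lam: "2 < lam"
  shows "\<exists>C>0. \<forall>\<psi> N K (f :: real ^ 'n \<Rightarrow> complex). kernel_family \<gamma> lam \<psi> \<longrightarrow> integrable lebesgue f \<longrightarrow>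
    (\<integral>\<^sup>+x. ennreal_powr (ennreal (kernel_family.square lam \<psi> N f K x)) (q / 2) \<partial>weighted w)
      \<le> ennreal C * (\<integral>\<^sup>+x. ennreal_powr (ennreal (norm (f x))) q \<partial>weighted w)"
proof -
  interpret W: doubling_measure "weighted w" "ratio_const 2 + 1" by (rule doubling)
  obtain CM where CM: "0 < CM" "\<And>f::real ^ 'n \<Rightarrow> ennreal. f \<in> borel_measurable lebesgue \<Longrightarrow>
    (\<integral>\<^sup>+x. ennreal_powr (maxfn lebesgue UNIV f x) q \<partial>weighted w) \<le> ennreal CM * (\<integral>\<^sup>+x. ennreal_powr (f x) q \<partial>weighted w)"
    using maximal_bounded by blast
  define \<kappa> where "\<kappa> = ((1 + \<theta>) / 2) powr (- 1 / q)"
  have \<kappa>: "1 < \<kappa>" "(1 / \<kappa>) powr q = (1 + \<theta>) / 2"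
  proof -
    have "((1 + \<theta>) / 2) powr 0 < ((1 + \<theta>) / 2) powr (- 1 / q)"
      using theta q by (intro powr_less_mono') auto
    then show "1 < \<kappa>" using theta by (simp add: \<kappa>_def)
    have "1 / \<kappa> = ((1 + \<theta>) / 2) powr (1 / q)" by (simp add: \<kappa>_def powr_minus_divide)
    then show "(1 / \<kappa>) powr q = (1 + \<theta>) / 2" using theta q by (simp add: powr_powr)
  qed
  let ?L = "local_const TYPE('n) \<gamma> lam"
  have L: "0 < ?L" using \<gamma> lam by (intro local_const_pos)
  define e where "e = sqrt ((\<kappa>\<^sup>2 - 1) / (2 * ?L))"
  have "1 < \<kappa>\<^sup>2" using \<kappa> by (simp add: one_less_power)
  then have e: "0 < e" "2 * ?L * e\<^sup>2 \<le> \<kappa>\<^sup>2 - 1" using L by (auto simp: e_def)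
  define B where "B = (1 / e) powr q * CM"
  have B: "0 < B" using e CM by (simp add: B_def)
  have main: "(\<integral>\<^sup>+x. ennreal_powr (ennreal (kernel_family.square lam \<psi> N f K x)) (q / 2) \<partial>weighted w)
      \<le> ennreal (2 * B / (1 - \<theta>)) * (\<integral>\<^sup>+x. ennreal_powr (ennreal (norm (f x))) q \<partial>weighted w)"
    if kf: "kernel_family \<gamma> lam \<psi>" and f: "integrable lebesgue f" for \<psi> N K and f :: "real ^ 'n \<Rightarrow> complex"
  proof (cases "(\<integral>\<^sup>+x. ennreal_powr (ennreal (norm (f x))) q \<partial>weighted w) = top")
    case True
    have "ennreal (2 * B / (1 - \<theta>)) \<noteq> 0" using B theta by simp
    then show ?thesis unfolding True by (simp only: ennreal_mult_top if_False top_greatest)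
  next
    case False
    interpret kernel_family \<gamma> lam \<psi> N by fact
    let ?F = "\<integral>\<^sup>+x. ennreal_powr (ennreal (norm (f x))) q \<partial>weighted w"
    have [measurable]: "f \<in> borel_measurable lebesgue" using f by auto
    define u where "u x = ennreal (sqrt (square f K x))" for x
    have [measurable]: "u \<in> borel_measurable lebesgue" unfolding u_def by measurable
    have uq: "ennreal_powr (ennreal (square f K x)) (q / 2) = ennreal_powr (u x) q" for x
    proof -
      have "u x = ennreal_powr (ennreal (square f K x)) (1 / 2)"
        using square_nonneg by (simp add: u_def ennreal_powr_ennreal powr_half_sqrt)
      then show ?thesis by (simp add: ennreal_powr_powr)
    qed
    define X where "X = (\<integral>\<^sup>+x. ennreal_powr (u x) q \<partial>weighted w)"
    let ?M = "max_avg f"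
    have Mq: "(\<integral>\<^sup>+x. ennreal_powr (?M x) q \<partial>weighted w) \<le> ennreal CM * ?F" by (rule CM) measurable
    \<comment> \<open>A crude bound, dependent on \<open>N\<close> and \<open>K\<close>, suffices for the finiteness that the absorption requires.\<close>
    have X_fin: "X \<noteq> top"
    proof -
      let ?c = "real (card {-N..K}) * (4 * 9 ^ CARD('n) * geo ((lam - 2) * real CARD('n)))"
      have "X \<le> (\<integral>\<^sup>+x. ennreal_powr (ennreal ?c) (q / 2) * ennreal_powr (?M x) q \<partial>weighted w)"
        unfolding X_def
      proof (rule nn_integral_mono)
        fix x
        have "ennreal_powr (u x) q = ennreal_powr (ennreal (square f K x)) (q / 2)" by (rule uq[symmetric])
        also have "\<dots> \<le> ennreal_powr (ennreal ?c * (?M x)\<^sup>2) (q / 2)"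
          using q by (intro ennreal_powr_mono square_le_max_avg f) auto
        also have "\<dots> = ennreal_powr (ennreal ?c) (q / 2) * ennreal_powr (?M x) q"
          using q by (simp add: ennreal_powr_mult ennreal_powr_two[symmetric] ennreal_powr_powr)
        finally show "ennreal_powr (u x) q \<le> ennreal_powr (ennreal ?c) (q / 2) * ennreal_powr (?M x) q" .
      qed
      also have "\<dots> = ennreal_powr (ennreal ?c) (q / 2) * (\<integral>\<^sup>+x. ennreal_powr (?M x) q \<partial>weighted w)"
        by (rule nn_integral_cmult) measurable
      also have "\<dots> \<le> ennreal_powr (ennreal ?c) (q / 2) * (ennreal CM * ?F)" by (intro mult_left_mono Mq) auto
      also have "\<dots> < top" using False CM by (simp add: ennreal_mult_eq_top_iff less_top[symmetric])
      finally show ?thesis by simp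
    qed
    have sets_eq: "{x \<in> space (weighted w). P x} = {x. P x}" for P by simp
    have dist[measurable]: "(\<lambda>t. emeasure (weighted w) {x. ennreal t < g x}) \<in> borel_measurable lborel"
      if "g \<in> borel_measurable lebesgue" for g
      using measurable_distribution[OF W.sigma_finite_mu, of g] that by (simp add: sets_eq)
    have lc: "(\<integral>\<^sup>+x. ennreal_powr (g x) q \<partial>weighted w) =
      (\<integral>\<^sup>+t. ennreal (q * t powr (q - 1)) * indicator {0<..} t * emeasure (weighted w) {x. ennreal t < g x} \<partial>lborel)"
      if "g \<in> borel_measurable lebesgue" for g
      using layer_cake[OF W.sigma_finite_mu, of g q] that q by (simp add: sets_eq)
    let ?g1 = "\<lambda>x. ennreal (1 / \<kappa>) * u x" and ?g2 = "\<lambda>x. ennreal (1 / e) * ?M x"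
    have scale: "ennreal t < ennreal (1 / r) * y \<longleftrightarrow> ennreal (r * t) < y" if "0 < r" "0 \<le> t" for r t y
      using that by (cases y) (auto simp: ennreal_less_iff field_simps ennreal_mult_top simp flip: ennreal_mult)
    have "ennreal ((1 + \<theta>) / 2) * X = (\<integral>\<^sup>+x. ennreal_powr (?g1 x) q \<partial>weighted w)"
      unfolding X_def \<kappa>(2)[symmetric] using \<kappa>(1) q by (simp add: ennreal_powr_cmult nn_integral_cmult)
    also have "\<dots> = (\<integral>\<^sup>+t. ennreal (q * t powr (q - 1)) * indicator {0<..} t * emeasure (weighted w) {x. ennreal t < ?g1 x} \<partial>lborel)"
      by (rule lc) measurable
    also have "\<dots> \<le> (\<integral>\<^sup>+t. ennreal \<theta> * (ennreal (q * t powr (q - 1)) * indicator {0<..} t * emeasure (weighted w) {x. ennreal t < u x})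
       + ennreal (q * t powr (q - 1)) * indicator {0<..} t * emeasure (weighted w) {x. ennreal t < ?g2 x} \<partial>lborel)"
    proof (rule nn_integral_mono)
      fix t :: real
      let ?h = "ennreal (q * t powr (q - 1)) * indicator {0<..} t"
      show "?h * emeasure (weighted w) {x. ennreal t < ?g1 x} \<le> ennreal \<theta> * (?h * emeasure (weighted w) {x. ennreal t < u x})
        + ?h * emeasure (weighted w) {x. ennreal t < ?g2 x}"
      proof (cases "0 < t")
        case True
        let ?A = "{x. \<kappa> * t < sqrt (square f K x) \<and> ?M x \<le> ennreal (e * t)}"
        have "{x. ennreal t < ?g1 x} \<subseteq> ?A \<union> {x. ennreal t < ?g2 x}"
          using True \<kappa> e by (auto simp: scale u_def ennreal_less_iff not_le)
        moreover have A: "?A \<in> sets (weighted w)"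
        proof -
          have "{x \<in> space lebesgue. \<kappa> * t < sqrt (square f K x) \<and> ?M x \<le> ennreal (e * t)} \<in> sets lebesgue" by measurable
          then show ?thesis unfolding space_completion space_lborel space_borel sets_density by (simp only: UNIV_I simp_thms)
        qed
        moreover have G: "{x. ennreal t < ?g2 x} \<in> sets (weighted w)" by (rule W.sets_level) measurable
        ultimately have "emeasure (weighted w) {x. ennreal t < ?g1 x} \<le> emeasure (weighted w) (?A \<union> {x. ennreal t < ?g2 x})"
          by (intro emeasure_mono sets.Un)
        also have "\<dots> \<le> emeasure (weighted w) ?A + emeasure (weighted w) {x. ennreal t < ?g2 x}"
          by (intro emeasure_subadditive A G)
        also have "emeasure (weighted w) ?A \<le> ennreal \<theta> * emeasure (weighted w) {x. t < sqrt (square f K x)}"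
          by (rule good_lambda[OF kf f \<kappa>(1) e True])
        also have "{x. t < sqrt (square f K x)} = {x. ennreal t < u x}"
          using True by (auto simp: u_def ennreal_less_iff)
        finally have "?h * emeasure (weighted w) {x. ennreal t < ?g1 x} \<le>
          ?h * (ennreal \<theta> * emeasure (weighted w) {x. ennreal t < u x} + emeasure (weighted w) {x. ennreal t < ?g2 x})"
          by (simp add: mult_left_mono)
        then show ?thesis by (simp add: distrib_left mult.left_commute)
      qed simp
    qed
    also have "\<dots> = ennreal \<theta> * (\<integral>\<^sup>+t. ennreal (q * t powr (q - 1)) * indicator {0<..} t * emeasure (weighted w) {x. ennreal t < u x} \<partial>lborel)
       + (\<integral>\<^sup>+t. ennreal (q * t powr (q - 1)) * indicator {0<..} t * emeasure (weighted w) {x. ennreal t < ?g2 x} \<partial>lborel)"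
      by (subst nn_integral_add, measurable, subst nn_integral_cmult, measurable)
    also have "\<dots> = ennreal \<theta> * X + (\<integral>\<^sup>+x. ennreal_powr (?g2 x) q \<partial>weighted w)"
      unfolding X_def by (subst (1 2) lc) measurable
    also have "(\<integral>\<^sup>+x. ennreal_powr (?g2 x) q \<partial>weighted w) \<le> ennreal (B) * ?F"
    proof -
      have "(\<integral>\<^sup>+x. ennreal_powr (?g2 x) q \<partial>weighted w) = ennreal ((1 / e) powr q) * (\<integral>\<^sup>+x. ennreal_powr (?M x) q \<partial>weighted w)"
        using e q by (simp add: ennreal_powr_cmult nn_integral_cmult)
      also have "\<dots> \<le> ennreal ((1 / e) powr q) * (ennreal CM * ?F)" by (intro mult_left_mono Mq) auto
      finally show ?thesis using CM by (simp add: B_def ennreal_mult mult.assoc)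
    qed
    finally have fin: "ennreal ((1 + \<theta>) / 2) * X \<le> ennreal \<theta> * X + ennreal B * ?F" by simp
    obtain x where x: "0 \<le> x" "X = ennreal x" using X_fin by (cases X) auto
    obtain y where y: "0 \<le> y" "?F = ennreal y" using False by (cases ?F) auto
    have "ennreal ((1 + \<theta>) / 2 * x) = ennreal ((1 + \<theta>) / 2) * ennreal x" using x theta by (intro ennreal_mult) auto
    moreover have "ennreal (\<theta> * x + B * y) = ennreal \<theta> * ennreal x + ennreal B * ennreal y"
      using x y theta B by (simp add: ennreal_mult)
    ultimately have "ennreal ((1 + \<theta>) / 2 * x) \<le> ennreal (\<theta> * x + B * y)"
      using fin unfolding x(2) y(2) by (simp only:)
    then have "(1 + \<theta>) / 2 * x \<le> \<theta> * x + B * y"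
      using x y theta B by (subst (asm) ennreal_le_iff) auto
    then have "(1 - \<theta>) * x \<le> 2 * B * y" by (simp add: algebra_simps)
    then have "x \<le> 2 * B / (1 - \<theta>) * y" using theta by (simp add: field_simps)
    then have "ennreal x \<le> ennreal (2 * B / (1 - \<theta>)) * ennreal y"
      using y B theta by (simp flip: ennreal_mult)
    then show ?thesis unfolding uq using x y by (simp add: X_def)
  qed
  show ?thesis
    by (intro exI[of _ "2 * B / (1 - \<theta>)"] conjI allI impI main) (use B theta in auto)
qed

end

section \<open>Discretization of the intrinsic square function\<close>

definition kernel_sup :: "real \<Rightarrow> (real ^ 'n \<Rightarrow> complex) \<Rightarrow> int \<Rightarrow> int ^ 'n \<Rightarrow> ennreal" where
  "kernel_sup \<gamma> f k m = (SUP \<psi>\<in>kernel \<gamma> k m. ennreal (norm (LINT z|lebesgue. f z * \<psi> z)))"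

text \<open>The counterpart of \<open>beta\<close> with the supremum over all kernels in place of one chosen kernel.\<close>

definition level :: "real \<Rightarrow> real \<Rightarrow> int \<Rightarrow> (real ^ 'n \<Rightarrow> complex) \<Rightarrow> int \<Rightarrow> int ^ 'n \<Rightarrow> ennreal" where
  "level \<gamma> lam N f k m = (\<Sum>j\<in>{-N..k}. \<Sum>m'\<in>desc (nat (k - j)) m.
     ennreal (2 powr (lam * real CARD('n) * of_int (j - k))) * (kernel_sup \<gamma> f j m')\<^sup>2)"

lemma kernel_sup_cong:
  assumes "\<And>z. z \<in> star 1 k m \<Longrightarrow> f z = g z"
  shows "kernel_sup \<gamma> f k m = kernel_sup \<gamma> g k m"
  unfolding kernel_sup_def
proof (intro SUP_cong refl arg_cong[where f = "\<lambda>x. ennreal (norm x)"] Bochner_Integration.integral_cong)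
  fix \<psi> z assume "\<psi> \<in> kernel \<gamma> k m"
  then show "f z * \<psi> z = g z * \<psi> z" using assms[of z] kernel_support[of \<psi> \<gamma> k m z] by auto
qed

text \<open>Near-extremal kernels linearize the supremum at the price of a factor \<open>2\<close>.\<close>

lemma kernel_choice:
  fixes \<gamma> :: real and g :: "real ^ 'n \<Rightarrow> complex"
  assumes g: "integrable lebesgue g"
  obtains \<psi> where "\<And>k m. \<psi> k m \<in> kernel \<gamma> k m"
    "\<And>k m. kernel_sup \<gamma> g k m \<le> ennreal (2 * norm (LINT z|lebesgue. g z * \<psi> k m z))"
proof -
  have "\<exists>\<psi>\<in>kernel \<gamma> k m. kernel_sup \<gamma> g k m \<le> ennreal (2 * norm (LINT z|lebesgue. g z * \<psi> z))" for k and m :: "int ^ 'n"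
  proof (cases "kernel_sup \<gamma> g k m = 0")
    case True
    then show ?thesis using zero_kernel[of \<gamma> k m] by (intro bexI[of _ "\<lambda>z. 0"]) auto
  next
    case False
    have "kernel_sup \<gamma> g k m \<le> ennreal (2 / (2 powi k) ^ CARD('n) * mass g (star 1 k m))"
      unfolding kernel_sup_def by (intro SUP_least ennreal_leI pairing_bound g)
    also have "\<dots> < top" by simp
    finally obtain s where s: "0 \<le> s" "kernel_sup \<gamma> g k m = ennreal s" by (cases "kernel_sup \<gamma> g k m") auto
    then have "ennreal (s / 2) < kernel_sup \<gamma> g k m" using False by (simp add: ennreal_less_iff)
    then obtain \<psi> where "\<psi> \<in> kernel \<gamma> k m" "ennreal (s / 2) < ennreal (norm (LINT z|lebesgue. g z * \<psi> z))"
      unfolding kernel_sup_def less_SUP_iff by blast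
    then show ?thesis using s by (intro bexI[of _ \<psi>]) (auto simp: ennreal_less_iff intro!: ennreal_leI)
  qed
  then have "\<exists>\<psi>. \<forall>k m. \<psi> k m \<in> kernel \<gamma> k m \<and> kernel_sup \<gamma> g k m \<le> ennreal (2 * norm (LINT z|lebesgue. g z * \<psi> k m z))"
    by metis
  then show ?thesis using that by blast
qed

lemma level_le_beta:
  fixes f g :: "real ^ 'n \<Rightarrow> complex"
  assumes choice: "\<And>k m. kernel_sup \<gamma> g k m \<le> ennreal (2 * norm (LINT z|lebesgue. g z * \<psi> k m z))"
    and kf: "kernel_family \<gamma> lam \<psi>" and eq: "\<And>z. z \<in> star 2 k m \<Longrightarrow> f z = g z"
  shows "level \<gamma> lam N f k m \<le> ennreal (4 * kernel_family.beta lam \<psi> N g k m)"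
proof -
  interpret kernel_family \<gamma> lam \<psi> N by fact
  have "level \<gamma> lam N f k m \<le> (\<Sum>j\<in>{-N..k}. \<Sum>m'\<in>desc (nat (k - j)) m.
     ennreal (4 * (2 powr (lam * real CARD('n) * of_int (j - k)) * (norm (coef g j m'))\<^sup>2)))"
    unfolding level_def
  proof (intro sum_mono)
    fix j m' assume j: "j \<in> {-N..k}" and m': "m' \<in> desc (nat (k - j)) m"
    have "kernel_sup \<gamma> f j m' = kernel_sup \<gamma> g j m'"
      using desc_star[OF m'] j by (intro kernel_sup_cong eq) auto
    also have "\<dots> \<le> ennreal (2 * norm (coef g j m'))" unfolding coef_def by (rule choice)
    finally have "(kernel_sup \<gamma> f j m')\<^sup>2 \<le> (ennreal (2 * norm (coef g j m')))\<^sup>2" by (intro power_mono) auto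
    then have "ennreal (2 powr (lam * real CARD('n) * of_int (j - k))) * (kernel_sup \<gamma> f j m')\<^sup>2 \<le>
      ennreal (2 powr (lam * real CARD('n) * of_int (j - k))) * (ennreal (2 * norm (coef g j m')))\<^sup>2"
      by (intro mult_left_mono) auto
    also have "\<dots> = ennreal (2 powr (lam * real CARD('n) * of_int (j - k)) * (2 * norm (coef g j m'))\<^sup>2)"
    proof -
      have "(ennreal (2 * norm (coef g j m')))\<^sup>2 = ennreal ((2 * norm (coef g j m'))\<^sup>2)" by (rule ennreal_power) simp
      then show ?thesis by (simp only: ennreal_mult powr_ge_zero zero_le_power2)
    qed
    finally show "ennreal (2 powr (lam * real CARD('n) * of_int (j - k))) * (kernel_sup \<gamma> f j m')\<^sup>2 \<le>
      ennreal (4 * (2 powr (lam * real CARD('n) * of_int (j - k)) * (norm (coef g j m'))\<^sup>2))"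
      by (simp add: power_mult_distrib mult_ac)
  qed
  also have "\<dots> = ennreal (4 * beta g k m)"
    unfolding beta_def by (simp add: sum_ennreal sum_nonneg sum_distrib_left)
  finally show ?thesis .
qed

text \<open>The pairings below a cube only see \<open>f\<close> on its star, where \<open>f\<close> may be taken to be integrable; then \<open>beta_le\<close>
  applies to near-extremal kernels.\<close>

lemma level_le_average:
  fixes f :: "real ^ 'n \<Rightarrow> complex"
  assumes \<gamma>: "0 < \<gamma>" "\<gamma> \<le> 1" and lam: "2 < lam" and [measurable]: "f \<in> borel_measurable lebesgue"
  shows "level \<gamma> lam N f k m \<le> ennreal (16 * 9 ^ CARD('n) * geo ((lam - 2) * real CARD('n))) *
    (ennreal (1 / (2 powi k) ^ CARD('n)) * (\<integral>\<^sup>+z. ennreal (norm (f z)) * indicator (star 2 k m) z \<partial>lebesgue))\<^sup>2"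
    (is "_ \<le> ennreal ?c * (ennreal ?v * ?S)\<^sup>2")
proof (cases "?S = top")
  case True
  have "0 < ?c" using lam by (intro mult_pos_pos geo_pos) auto
  moreover have "0 < ?v" by simp
  ultimately have "ennreal ?c * (ennreal ?v * ?S)\<^sup>2 = top"
    unfolding True by (auto simp: ennreal_mult_eq_top_iff power2_eq_square ennreal_mult_top)
  then show ?thesis by (simp only: top_greatest)
next
  case False
  define g where "g z = indicator (star 2 k m) z *\<^sub>R f z" for z
  have g: "integrable lebesgue g"
  proof (rule integrableI_bounded)
    show "g \<in> borel_measurable lebesgue" unfolding g_def[abs_def] by measurable
    have "(\<integral>\<^sup>+z. ennreal (norm (g z)) \<partial>lebesgue) = ?S"
      by (intro nn_integral_cong) (auto simp: g_def indicator_def)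
    then show "(\<integral>\<^sup>+z. ennreal (norm (g z)) \<partial>lebesgue) < \<infinity>" using False by (simp add: less_top)
  qed
  obtain \<psi> where choice: "\<And>k m. \<psi> k m \<in> kernel \<gamma> k m"
    "\<And>k m. kernel_sup \<gamma> g k m \<le> ennreal (2 * norm (LINT z|lebesgue. g z * \<psi> k m z))"
    by (rule kernel_choice[OF g, where \<gamma> = \<gamma>]) blast
  have kf: "kernel_family \<gamma> lam \<psi>" by (intro kernel_family.intro \<gamma> lam choice(1))
  interpret kernel_family \<gamma> lam \<psi> N by fact
  have S: "?S = ennreal (mass g (star 2 k m))"
    by (subst nn_integral_norm_mass[OF g, symmetric]) (auto intro!: nn_integral_cong simp: g_def indicator_def)
  have "level \<gamma> lam N f k m \<le> ennreal (4 * beta g k m)"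
    by (rule level_le_beta[OF choice(2) kf]) (simp add: g_def)
  also have "\<dots> \<le> ennreal (4 * (4 * 9 ^ CARD('n) * geo ((lam - 2) * real CARD('n)) * (mass g (star 2 k m) / vol k)\<^sup>2))"
    by (intro ennreal_leI mult_left_mono beta_le g) auto
  also have "\<dots> = ennreal (?c * (?v * mass g (star 2 k m))\<^sup>2)" by (simp add: vol_def mult.assoc)
  also have "\<dots> = ennreal ?c * (ennreal ?v * ?S)\<^sup>2"
  proof -
    have c: "0 \<le> ?c" using lam geo_pos[of "(lam - 2) * real CARD('n)"] by simp
    let ?M = "mass g (star 2 k m)"
    have e1: "ennreal ?v * ennreal ?M = ennreal (?v * ?M)" by (rule ennreal_mult[symmetric]) (auto simp: mass_nonneg)
    have e2: "(ennreal (?v * ?M))\<^sup>2 = ennreal ((?v * ?M)\<^sup>2)" by (rule ennreal_power) (simp add: mass_nonneg)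
    show ?thesis unfolding S e1 e2 by (rule ennreal_mult[OF c zero_le_power2])
  qed
  finally show ?thesis .
qed

lemma integral_reflect_scale:
  fixes \<phi> :: "real ^ 'n \<Rightarrow> complex"
  assumes [measurable]: "\<phi> \<in> borel_measurable borel" and t: "0 < t" and zero: "(LINT z|lebesgue. \<phi> z) = 0"
  shows "(LINT z|lebesgue. \<phi> ((1 / t) *\<^sub>R (y - z))) = 0"
proof -
  let ?T = "\<lambda>z. (1 / t) *\<^sub>R y + (- 1 / t) *\<^sub>R z"
  have eq: "(1 / t) *\<^sub>R (y - z) = ?T z" for z by (simp add: scaleR_diff_right)
  have [measurable]: "?T \<in> borel_measurable borel" by measurable
  have "0 = (LINT z|lborel. \<phi> z)" using zero by (simp add: integral_completion)
  also have "\<dots> = (LINT z|density (distr lborel borel ?T) (\<lambda>_. ennreal (\<bar>- 1 / t\<bar> ^ DIM(real ^ 'n))). \<phi> z)"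
    using lborel_affine[of "- 1 / t" "(1 / t) *\<^sub>R y"] t by simp
  also have "\<dots> = (LINT z|distr lborel borel ?T. (\<bar>- 1 / t\<bar> ^ DIM(real ^ 'n)) *\<^sub>R \<phi> z)"
    by (intro integral_density) auto
  also have "\<dots> = (LINT z|lborel. (\<bar>- 1 / t\<bar> ^ DIM(real ^ 'n)) *\<^sub>R \<phi> (?T z))"
    by (intro integral_distr) auto
  also have "\<dots> = (\<bar>- 1 / t\<bar> ^ DIM(real ^ 'n)) *\<^sub>R (LINT z|lborel. \<phi> (?T z))" by simp
  finally have "(LINT z|lborel. \<phi> (?T z)) = 0" using t by simp
  then show ?thesis unfolding eq by (simp add: integral_completion)
qed

lemma Cfam_bound:
  fixes \<phi> :: "real ^ 'n \<Rightarrow> complex"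
  assumes \<phi>: "\<phi> \<in> Cfam \<gamma>" and \<gamma>: "0 < \<gamma>" "\<gamma> \<le> 1"
  shows "\<phi> z \<noteq> 0 \<Longrightarrow> norm z \<le> 1" "norm (\<phi> z) \<le> 5 / 2" "\<phi> \<in> borel_measurable borel"
proof -
  have supp: "norm z \<le> 1" if "\<phi> z \<noteq> 0" for z
  proof -
    have "z \<in> closure {x. \<phi> x \<noteq> 0}" using that closure_subset[of "{x. \<phi> x \<noteq> 0}"] by auto
    then show ?thesis using \<phi> by (auto simp: Cfam_def)
  qed
  then show "\<phi> z \<noteq> 0 \<Longrightarrow> norm z \<le> 1" .
  have H: "norm (\<phi> x - \<phi> x') \<le> norm (x - x') powr \<gamma>" for x x' using \<phi> by (auto simp: Cfam_def)
  show "norm (\<phi> z) \<le> 5 / 2"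
  proof (cases "\<phi> z = 0")
    case False
    \<comment> \<open>A translation by more than the diameter of the unit ball leads to a zero of \<open>\<phi>\<close>.\<close>
    let ?z = "z + (5 / 2) *\<^sub>R axis undefined 1"
    have n: "norm ((5 / 2) *\<^sub>R axis undefined 1 :: real ^ 'n) = 5 / 2" by simp
    have "norm ((5 / 2) *\<^sub>R axis undefined 1 :: real ^ 'n) \<le> norm ?z + norm z"
      using norm_triangle_ineq4[of ?z z] by simp
    then have "1 < norm ?z" using supp[OF False] n by linarith
    then have "\<phi> ?z = 0" using supp[of ?z] by linarith
    then have "norm (\<phi> z) \<le> (5 / 2) powr \<gamma>" using H[of z ?z] n by simp
    also have "\<dots> \<le> (5 / 2) powr 1" using \<gamma> by (intro powr_mono) auto
    finally show ?thesis by simp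
  qed simp
  have "continuous_on UNIV \<phi>"
    unfolding continuous_on_iff
  proof (intro ballI allI impI)
    fix x and e :: real assume "0 < e"
    show "\<exists>d>0. \<forall>x'\<in>UNIV. dist x' x < d \<longrightarrow> dist (\<phi> x') (\<phi> x) < e"
    proof (intro exI[of _ "e powr (1 / \<gamma>)"] conjI ballI impI)
      fix x' assume "dist x' x < e powr (1 / \<gamma>)"
      then have "norm (x' - x) powr \<gamma> < (e powr (1 / \<gamma>)) powr \<gamma>"
        using \<gamma> by (intro powr_less_mono2) (auto simp: dist_norm)
      also have "\<dots> = e" using \<gamma> \<open>0 < e\<close> by (simp add: powr_powr)
      finally show "dist (\<phi> x') (\<phi> x) < e" using H[of x' x] by (simp add: dist_norm)
    qed (use \<open>0 < e\<close> in simp)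
  qed
  then show "\<phi> \<in> borel_measurable borel" by (rule borel_measurable_continuous_onI)
qed

text \<open>Since \<open>t > 2 powi j / 2\<close>, passing from \<open>t\<close> to the scale \<open>2 powi j\<close> costs \<open>2\<^sup>n\<close> in the normalization and at most
  \<open>2\<close> in the Hoelder seminorm; the factor in front compensates both.\<close>

lemma dilate_kernel:
  fixes \<phi> :: "real ^ 'n \<Rightarrow> complex"
  assumes \<phi>: "\<phi> \<in> Cfam \<gamma>" and \<gamma>: "0 < \<gamma>" "\<gamma> \<le> 1" and t: "2 powi j / 2 < t" "t \<le> 2 powi j"
  shows "(\<lambda>z. of_real (1 / 2 ^ (CARD('n) + 1)) * dilate t \<phi> (y - z)) \<in> kernel \<gamma> j (cell j y)"
proof -
  note b = Cfam_bound[OF \<phi> \<gamma>]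
  have H: "norm (\<phi> x - \<phi> x') \<le> norm (x - x') powr \<gamma>" for x x' using \<phi> by (auto simp: Cfam_def)
  let ?s = "2 powi j :: real"
  have s: "0 < ?s" by simp
  have t0: "0 < t" using t(1) s by linarith
  define c where "c = 1 / 2 ^ (CARD('n) + 1) * (1 / t ^ CARD('n))"
  have c: "0 < c" "c \<le> 1 / (2 * ?s ^ CARD('n))"
  proof -
    show "0 < c" using t0 by (simp add: c_def)
    have "(?s / 2) ^ CARD('n) \<le> t ^ CARD('n)" using t s by (intro power_mono) auto
    then have "?s ^ CARD('n) \<le> 2 ^ CARD('n) * t ^ CARD('n)" by (simp add: power_divide field_simps)
    then show "c \<le> 1 / (2 * ?s ^ CARD('n))" using t0 s by (simp add: c_def field_simps)
  qed
  let ?\<psi> = "\<lambda>z. of_real (1 / 2 ^ (CARD('n) + 1)) * dilate t \<phi> (y - z)"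
  have \<psi>: "?\<psi> z = of_real c * \<phi> ((1 / t) *\<^sub>R (y - z))" for z by (simp add: dilate_def c_def)
  have "?\<psi> \<in> borel_measurable lebesgue"
  proof -
    have "(\<lambda>z. \<phi> ((1 / t) *\<^sub>R (y - z))) \<in> borel_measurable borel" using b(3) by measurable
    then have "(\<lambda>z. of_real c * \<phi> ((1 / t) *\<^sub>R (y - z))) \<in> borel_measurable lborel" by simp
    then show ?thesis unfolding \<psi> by (rule measurable_completion)
  qed
  moreover have "(LINT z|lebesgue. ?\<psi> z) = 0"
  proof -
    have "(LINT z|lebesgue. \<phi> z) = 0" using \<phi> by (simp add: Cfam_def)
    then have "(LINT z|lebesgue. \<phi> ((1 / t) *\<^sub>R (y - z))) = 0" by (rule integral_reflect_scale[OF b(3) t0])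
    then show ?thesis unfolding \<psi> by simp
  qed
  moreover have "z \<in> star 1 j (cell j y)" if "?\<psi> z \<noteq> 0" for z
  proof -
    have "\<phi> ((1 / t) *\<^sub>R (y - z)) \<noteq> 0" using that unfolding \<psi> by auto
    then have "norm ((1 / t) *\<^sub>R (y - z)) \<le> 1" by (rule b(1))
    then have "norm (y - z) \<le> of_int 1 * ?s" using t0 t(2) by (simp add: divide_le_eq)
    then have "near 1 (cell j y) (cell j z)" by (rule norm_near_cell)
    then show ?thesis by simp
  qed
  moreover have "norm (?\<psi> z) \<le> 2 / ?s ^ CARD('n)" for z
  proof -
    have "norm (?\<psi> z) = c * norm (\<phi> ((1 / t) *\<^sub>R (y - z)))" unfolding \<psi> using c by (simp add: norm_mult)
    also have "\<dots> \<le> 1 / (2 * ?s ^ CARD('n)) * (5 / 2)" using c b(2) s by (intro mult_mono) auto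
    also have "\<dots> \<le> 2 / ?s ^ CARD('n)" using s by (simp add: field_simps)
    finally show ?thesis .
  qed
  moreover have "norm (?\<psi> z - ?\<psi> z') \<le> (norm (z - z') / ?s) powr \<gamma> / ?s ^ CARD('n)" for z z'
  proof -
    have "norm (?\<psi> z - ?\<psi> z') = c * norm (\<phi> ((1 / t) *\<^sub>R (y - z)) - \<phi> ((1 / t) *\<^sub>R (y - z')))"
      unfolding \<psi> using c by (simp add: norm_mult flip: right_diff_distrib)
    also have "\<dots> \<le> c * norm ((1 / t) *\<^sub>R (y - z) - (1 / t) *\<^sub>R (y - z')) powr \<gamma>"
      using c by (intro mult_left_mono H) auto
    also have "norm ((1 / t) *\<^sub>R (y - z) - (1 / t) *\<^sub>R (y - z')) = norm (z - z') / t"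
    proof -
      have "(1 / t) *\<^sub>R (y - z) - (1 / t) *\<^sub>R (y - z') = (1 / t) *\<^sub>R (z' - z)" by (simp add: algebra_simps)
      then show ?thesis using t0 by (simp add: norm_minus_commute)
    qed
    also have "c * (norm (z - z') / t) powr \<gamma> \<le> 1 / (2 * ?s ^ CARD('n)) * (2 * (norm (z - z') / ?s) powr \<gamma>)"
    proof (intro mult_mono c)
      have "norm (z - z') / t \<le> norm (z - z') / (?s / 2)" using t s by (intro divide_left_mono) auto
      then have "(norm (z - z') / t) powr \<gamma> \<le> (2 * (norm (z - z') / ?s)) powr \<gamma>"
        using \<gamma> t0 by (intro powr_mono2) (auto simp: mult.commute)
      also have "\<dots> = 2 powr \<gamma> * (norm (z - z') / ?s) powr \<gamma>" by (rule powr_mult)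
      also have "\<dots> \<le> 2 powr 1 * (norm (z - z') / ?s) powr \<gamma>" using \<gamma> by (intro mult_right_mono powr_mono) auto
      finally show "(norm (z - z') / t) powr \<gamma> \<le> 2 * (norm (z - z') / ?s) powr \<gamma>" by simp
    qed auto
    finally show ?thesis by simp
  qed
  ultimately show ?thesis unfolding kernel_def by blast
qed

lemma Cfam_sup_le:
  fixes f :: "real ^ 'n \<Rightarrow> complex"
  assumes \<gamma>: "0 < \<gamma>" "\<gamma> \<le> 1" and t: "2 powi j / 2 < t" "t \<le> 2 powi j"
  shows "(SUP \<phi>\<in>Cfam \<gamma>. ennreal (norm (conv f (dilate t \<phi>) y))) \<le> ennreal (2 ^ (CARD('n) + 1)) * kernel_sup \<gamma> f j (cell j y)"
proof (rule SUP_least)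
  fix \<phi> :: "real ^ 'n \<Rightarrow> complex" assume \<phi>: "\<phi> \<in> Cfam \<gamma>"
  let ?\<psi> = "\<lambda>z. of_real (1 / 2 ^ (CARD('n) + 1)) * dilate t \<phi> (y - z)"
  have "f z * dilate t \<phi> (y - z) = of_real (2 ^ (CARD('n) + 1)) * (f z * ?\<psi> z)" for z by simp
  then have "conv f (dilate t \<phi>) y = of_real (2 ^ (CARD('n) + 1)) * (LINT z|lebesgue. f z * ?\<psi> z)"
    unfolding conv_def by (simp only: integral_mult_right_zero)
  then have "norm (conv f (dilate t \<phi>) y) = 2 ^ (CARD('n) + 1) * norm (LINT z|lebesgue. f z * ?\<psi> z)"
    by (simp only: norm_mult norm_of_real) simp
  then have "ennreal (norm (conv f (dilate t \<phi>) y)) = ennreal (2 ^ (CARD('n) + 1)) * ennreal (norm (LINT z|lebesgue. f z * ?\<psi> z))"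
    by (simp add: ennreal_mult del: power_Suc)
  also have "\<dots> \<le> ennreal (2 ^ (CARD('n) + 1)) * kernel_sup \<gamma> f j (cell j y)"
    unfolding kernel_sup_def by (intro mult_left_mono SUP_upper dilate_kernel \<phi> \<gamma> t) auto
  finally show "ennreal (norm (conv f (dilate t \<phi>) y)) \<le> ennreal (2 ^ (CARD('n) + 1)) * kernel_sup \<gamma> f j (cell j y)" .
qed

lemma dyadic_scale:
  fixes t :: real
  assumes "0 < t" obtains j :: int where "2 powi j / 2 < t" "t \<le> 2 powi j"
proof
  define j where "j = \<lceil>log 2 t\<rceil>"
  have pw: "2 powi i = (2::real) powr of_int i" for i by (simp add: powr_real_of_int')
  have "log 2 t \<le> of_int j" unfolding j_def by linarith
  then show "t \<le> 2 powi j" using assms unfolding pw by (simp add: log_le_iff)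
  have "of_int j - 1 < log 2 t" unfolding j_def by linarith
  then have "2 powr (of_int j - 1) < t" using assms by (simp add: less_log_iff)
  then show "2 powi j / 2 < t" unfolding pw by (simp add: powr_diff)
qed

lemma first_near_level:
  fixes x y :: "real ^ 'n"
  assumes t: "2 powi j / 2 < t"
  obtains k where "j \<le> k" "near 1 (cell k x) (cell k y)" "2 powi k / 2 \<le> t + norm (x - y)"
proof -
  let ?P = "\<lambda>d. near 1 (cell (j + int d) x) (cell (j + int d) y)"
  have "\<exists>d. ?P d"
  proof -
    obtain d :: nat where "norm (x - y) / 2 powi j < 2 ^ d" using real_arch_pow[of 2] by auto
    then have "norm (x - y) \<le> of_int 1 * 2 powi (j + int d)" by (simp add: power_int_add field_simps)
    then show ?thesis using norm_near_cell by blast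
  qed
  define d where "d = (LEAST d. ?P d)"
  have d: "?P d" unfolding d_def using \<open>\<exists>d. ?P d\<close> by (rule LeastI_ex)
  have "2 powi (j + int d) / 2 \<le> t + norm (x - y)"
  proof (cases d)
    case 0
    then have "2 powi (j + int d) / 2 < t" using t by simp
    then show ?thesis using norm_ge_zero[of "x - y"] by linarith
  next
    case (Suc e)
    then have "\<not> ?P e" unfolding d_def by (intro not_less_Least) simp
    then have "\<not> norm (x - y) \<le> of_int 1 * 2 powi (j + int e)" using norm_near_cell by blast
    moreover have "2 powi (j + int d) / 2 = (2 powi (j + int e) :: real)" using Suc by (simp add: power_int_add)
    moreover have "0 < t" using t by (rule le_less_trans[rotated]) simp
    ultimately show ?thesis by simp
  qed
  then show ?thesis using d by (intro that[of "j + int d"]) auto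
qed

text \<open>The factors come from \<open>t + \<bar>x - y\<bar> \<ge> 2\<^sup>k / 2\<close>, from \<open>dilate_kernel\<close>, and from \<open>t > 2\<^sup>j / 2\<close> in the measure
  \<open>dy dt / t ^ (n + 1)\<close>.\<close>

definition discr_const :: "'n::finite itself \<Rightarrow> real \<Rightarrow> real" where
  "discr_const _ lam = 2 powr (lam * real CARD('n)) * 4 ^ (CARD('n) + 1) * 2 ^ CARD('n)"

text \<open>A point \<open>(y, t)\<close> of the half space is assigned to the cube \<open>(j, cell j y)\<close> with \<open>2\<^sup>j \<approx> t\<close>, and to the smallest
  scale \<open>k \<ge> j\<close> at which \<open>x\<close> and \<open>y\<close> lie in neighbouring cubes; then \<open>t + \<bar>x - y\<bar> \<approx> 2\<^sup>k\<close>.\<close>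

lemma gstar_le_levels:
  fixes f :: "real ^ 'n \<Rightarrow> complex"
  assumes \<gamma>: "0 < \<gamma>" "\<gamma> \<le> 1" and lam: "0 < lam"
  shows "(gstar lam \<gamma> f x)\<^sup>2 \<le> ennreal (discr_const TYPE('n) lam) * (SUP N::nat. \<Sum>k\<in>{-int N..int N}. level \<gamma> lam (int N) f k (cell k x))"
proof -
  define slab where "slab j m = cube j m \<times> {2 powi j / 2<..2 powi j :: real}" for j and m :: "int ^ 'n"
  define w where "w k j = 2 powr (lam * real CARD('n)) * 2 powr (lam * real CARD('n) * of_int (j - k)) * (4 ^ (CARD('n) + 1) / (2 powi j / 2) ^ (CARD('n) + 1))" for k j :: int
  have w0: "0 \<le> w k j" for k j by (simp add: w_def)
  define step where "step N p = (\<Sum>k\<in>{-int N..int N}. \<Sum>j\<in>{-int N..k}. \<Sum>m'\<in>desc (nat (k - j)) (cell k x).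
      ennreal (w k j) * (kernel_sup \<gamma> f j m')\<^sup>2 * indicator (slab j m') p)" for N :: nat and p :: "(real ^ 'n) \<times> real"
  let ?h = "\<lambda>p. (case p of (y, t) \<Rightarrow> ennreal ((t / (t + norm (x - y))) powr (lam * CARD('n))) *
          (SUP \<phi>\<in>Cfam \<gamma>. ennreal (norm (conv f (dilate t \<phi>) y))) ^ 2 *
          ennreal (1 / t ^ (CARD('n) + 1))) * indicator (UNIV \<times> {0<..}) p"
  have slab_sets[measurable]: "slab j m \<in> sets (lebesgue :: ((real ^ 'n) \<times> real) measure)" for j m
    unfolding slab_def by (rule sets_completionI_sets) (simp add: borel_Times)
  have slab_measure: "emeasure (lebesgue :: ((real ^ 'n) \<times> real) measure) (slab j m) = ennreal ((2 powi j) ^ CARD('n) * (2 powi j / 2))" for j m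
  proof -
    have "emeasure lebesgue (slab j m) = emeasure (lborel \<Otimes>\<^sub>M lborel) (slab j m)"
    proof -
      have "slab j m \<in> sets lborel" by (simp add: slab_def borel_Times)
      then show ?thesis by (simp add: lborel_prod emeasure_completion)
    qed
    also have "\<dots> = emeasure lborel (cube j m) * emeasure lborel {2 powi j / 2<..(2 powi j :: real)}"
      unfolding slab_def by (rule lborel.emeasure_pair_measure_Times) auto
    also have "\<dots> = ennreal ((2 powi j) ^ CARD('n)) * ennreal (2 powi j / 2)"
      by (simp add: cube_measure)
    finally show ?thesis by (subst ennreal_mult) simp_all
  qed
  have bound: "?h p \<le> (SUP N. step N p)" for p
  proof -
    obtain y t where p: "p = (y, t)" by force
    show ?thesis
    proof (cases "0 < t")
      case t: True
      obtain j :: int where j: "2 powi j / 2 < t" "t \<le> 2 powi j" by (rule dyadic_scale[OF t])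
      obtain k where k: "j \<le> k" "near 1 (cell k x) (cell k y)" "2 powi k / 2 \<le> t + norm (x - y)"
        by (rule first_near_level[OF j(1)])
      define N where "N = nat (max \<bar>k\<bar> \<bar>j\<bar>)"
      have N: "k \<in> {-int N..int N}" "j \<in> {-int N..k}" using k(1) by (auto simp: N_def)
      have m': "cell j y \<in> desc (nat (k - j)) (cell k x)"
        using k(2) cell_coarsen'[OF k(1), of y] by (simp add: desc_def)
      let ?s = "2 powi j :: real"
      have s: "0 < ?s" by simp
      have 1: "(t / (t + norm (x - y))) powr (lam * CARD('n)) \<le> 2 powr (lam * real CARD('n)) * 2 powr (lam * real CARD('n) * of_int (j - k))"
      proof -
        have "t / (t + norm (x - y)) \<le> ?s / (2 powi k / 2)" using t j k(3) by (intro frac_le) auto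
        also have "\<dots> = 2 * 2 powr of_int (j - k)" unfolding powi_ratio[of j k, symmetric] by simp
        finally have "(t / (t + norm (x - y))) powr (lam * CARD('n)) \<le> (2 * 2 powr of_int (j - k)) powr (lam * CARD('n))"
          using lam t by (intro powr_mono2) (auto intro!: divide_nonneg_nonneg)
        also have "\<dots> = 2 powr (lam * real CARD('n)) * 2 powr (lam * real CARD('n) * of_int (j - k))"
          unfolding powr_mult powr_powr by (simp add: mult_ac)
        finally show ?thesis .
      qed
      have 2: "1 / t ^ (CARD('n) + 1) \<le> 1 / (?s / 2) ^ (CARD('n) + 1)"
        using j s t by (intro divide_left_mono power_mono mult_pos_pos zero_less_power) auto
      have "?h p = ennreal ((t / (t + norm (x - y))) powr (lam * CARD('n))) * (SUP \<phi>\<in>Cfam \<gamma>. ennreal (norm (conv f (dilate t \<phi>) y))) ^ 2 *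
          ennreal (1 / t ^ (CARD('n) + 1))" using t p by simp
      also have "\<dots> \<le> ennreal (2 powr (lam * real CARD('n)) * 2 powr (lam * real CARD('n) * of_int (j - k))) *
        (ennreal (2 ^ (CARD('n) + 1)) * kernel_sup \<gamma> f j (cell j y)) ^ 2 * ennreal (1 / (?s / 2) ^ (CARD('n) + 1))"
        by (intro mult_mono ennreal_leI 1 2 power_mono Cfam_sup_le \<gamma> j) auto
      also have "\<dots> = ennreal (w k j) * (kernel_sup \<gamma> f j (cell j y))\<^sup>2 * indicator (slab j (cell j y)) p"
      proof -
        have ind: "indicator (slab j (cell j y)) p = (1 :: ennreal)" using p j by (simp add: slab_def)
        have "(ennreal (2 ^ (CARD('n) + 1)))\<^sup>2 = ennreal (4 ^ (CARD('n) + 1))"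
          by (subst ennreal_power) (auto simp: power2_eq_square simp flip: power_mult_distrib)
        then have "ennreal (2 powr (lam * real CARD('n)) * 2 powr (lam * real CARD('n) * of_int (j - k))) *
          (ennreal (2 ^ (CARD('n) + 1)) * kernel_sup \<gamma> f j (cell j y)) ^ 2 * ennreal (1 / (?s / 2) ^ (CARD('n) + 1)) =
          ennreal (2 powr (lam * real CARD('n)) * 2 powr (lam * real CARD('n) * of_int (j - k))) * ennreal (4 ^ (CARD('n) + 1)) *
          ennreal (1 / (?s / 2) ^ (CARD('n) + 1)) * (kernel_sup \<gamma> f j (cell j y))\<^sup>2"
          by (simp only: power_mult_distrib ac_simps)
        also have "ennreal (2 powr (lam * real CARD('n)) * 2 powr (lam * real CARD('n) * of_int (j - k))) * ennreal (4 ^ (CARD('n) + 1)) *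
          ennreal (1 / (?s / 2) ^ (CARD('n) + 1)) = ennreal (w k j)"
          unfolding w_def using s by (subst ennreal_mult[symmetric], simp, simp, subst ennreal_mult[symmetric], simp, simp, simp)
        finally show ?thesis unfolding ind by simp
      qed
      also have "\<dots> \<le> step N p"
        unfolding step_def
        by (rule order_trans[OF _ member_le_sum[OF N(1)]], rule order_trans[OF _ member_le_sum[OF N(2)]],
            rule member_le_sum[OF m']) (auto intro!: sum_nonneg)
      also have "\<dots> \<le> (SUP N. step N p)" by (rule SUP_upper) simp
      finally show ?thesis .
    qed (simp add: p)
  qed
  have inc: "incseq step"
  proof (intro incseq_SucI le_funI)
    fix N p
    have "step N p \<le> (\<Sum>k\<in>{-int N..int N}. \<Sum>j\<in>{-int (Suc N)..k}. \<Sum>m'\<in>desc (nat (k - j)) (cell k x).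
      ennreal (w k j) * (kernel_sup \<gamma> f j m')\<^sup>2 * indicator (slab j m') p)"
      unfolding step_def by (intro sum_mono sum_mono2) auto
    also have "\<dots> \<le> step (Suc N) p" unfolding step_def by (intro sum_mono2) auto
    finally show "step N p \<le> step (Suc N) p" .
  qed
  have step_meas: "step N \<in> borel_measurable lebesgue" for N
    unfolding step_def[abs_def] by measurable
  have step_int: "(\<integral>\<^sup>+p. step N p \<partial>lebesgue) = ennreal (discr_const TYPE('n) lam) * (\<Sum>k\<in>{-int N..int N}. level \<gamma> lam (int N) f k (cell k x))" for N
  proof -
    have "(\<integral>\<^sup>+p. step N p \<partial>lebesgue) = (\<Sum>k\<in>{-int N..int N}. \<Sum>j\<in>{-int N..k}. \<Sum>m'\<in>desc (nat (k - j)) (cell k x).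
      ennreal (w k j) * (kernel_sup \<gamma> f j m')\<^sup>2 * emeasure lebesgue (slab j m'))"
    proof -
      have m: "(\<lambda>p. c * indicator (slab j m') p) \<in> borel_measurable lebesgue" for c :: ennreal and j m'
        by measurable
      show ?thesis unfolding step_def
        by (subst nn_integral_sum, intro borel_measurable_sum m, rule sum.cong[OF refl],
            subst nn_integral_sum, intro borel_measurable_sum m, rule sum.cong[OF refl],
            subst nn_integral_sum, rule m, rule sum.cong[OF refl], rule nn_integral_cmult_indicator[OF slab_sets])
    qed
    also have "\<dots> = (\<Sum>k\<in>{-int N..int N}. \<Sum>j\<in>{-int N..k}. \<Sum>m'\<in>desc (nat (k - j)) (cell k x).
      ennreal (discr_const TYPE('n) lam) * (ennreal (2 powr (lam * real CARD('n) * of_int (j - k))) * (kernel_sup \<gamma> f j m')\<^sup>2))"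
    proof (intro sum.cong refl)
      fix k j m'
      let ?s = "2 powi j :: real"
      have "w k j * (?s ^ CARD('n) * (?s / 2)) = discr_const TYPE('n) lam * 2 powr (lam * real CARD('n) * of_int (j - k))"
        by (simp add: w_def discr_const_def power_divide field_simps)
      then have "ennreal (w k j) * emeasure lebesgue (slab j m') = ennreal (discr_const TYPE('n) lam) * ennreal (2 powr (lam * real CARD('n) * of_int (j - k)))"
        unfolding slab_measure by (simp add: w0 discr_const_def flip: ennreal_mult)
      note e = this
      have "ennreal (w k j) * (kernel_sup \<gamma> f j m')\<^sup>2 * emeasure lebesgue (slab j m') =
        ennreal (w k j) * emeasure lebesgue (slab j m') * (kernel_sup \<gamma> f j m')\<^sup>2" by (simp only: ac_simps)
      then show "ennreal (w k j) * (kernel_sup \<gamma> f j m')\<^sup>2 * emeasure lebesgue (slab j m') =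
        ennreal (discr_const TYPE('n) lam) * (ennreal (2 powr (lam * real CARD('n) * of_int (j - k))) * (kernel_sup \<gamma> f j m')\<^sup>2)"
        unfolding e by (simp only: mult.assoc)
    qed
    finally show ?thesis unfolding level_def by (simp add: sum_distrib_left)
  qed
  have "(gstar lam \<gamma> f x)\<^sup>2 = (\<integral>\<^sup>+p. ?h p \<partial>lebesgue)"
    unfolding gstar_def by (simp add: ennreal_powr_powr flip: ennreal_powr_two)
  also have "\<dots> \<le> (\<integral>\<^sup>+p. (SUP N. step N p) \<partial>lebesgue)" by (intro nn_integral_mono bound)
  also have "\<dots> = (SUP N. \<integral>\<^sup>+p. step N p \<partial>lebesgue)"
    by (rule nn_integral_monotone_convergence_SUP[OF inc step_meas])
  also have "\<dots> = ennreal (discr_const TYPE('n) lam) * (SUP N::nat. \<Sum>k\<in>{-int N..int N}. level \<gamma> lam (int N) f k (cell k x))"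
    unfolding step_int by (rule SUP_mult_left_ennreal[symmetric])
  finally show ?thesis .
qed

section \<open>Estimates on a ball\<close>

text \<open>The integral over a moving open ball is lower semicontinuous in the centre, even for a nonmeasurable integrand;
  this provides the measurability in \<open>y\<close> that the outer norm asks for.\<close>

lemma measurable_ball_integral:
  fixes h :: "real ^ 'n \<Rightarrow> ennreal"
  shows "(\<lambda>y. \<integral>\<^sup>+x. h x * indicator (ball y r) x \<partial>lebesgue) \<in> borel_measurable lebesgue"
proof (rule borel_measurableI_greater)
  fix c :: ennreal
  let ?\<Phi> = "\<lambda>y. \<integral>\<^sup>+x. h x * indicator (ball y r) x \<partial>lebesgue"
  have op: "open {y. c < ?\<Phi> y}"
    unfolding open_contains_ball
  proof safe
    fix y0 assume "c < ?\<Phi> y0"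
    then obtain g where g: "simple_function lebesgue g" "g \<le> (\<lambda>x. h x * indicator (ball y0 r) x)" "c < integral\<^sup>S lebesgue g"
      unfolding nn_integral_def less_SUP_iff by auto
    have [measurable]: "g \<in> borel_measurable lebesgue" using g(1) by (rule borel_measurable_simple_function)
    define G where "G n x = g x * indicator (ball y0 (r - inverse (real (Suc n)))) x" for n x
    have G_meas: "G n \<in> borel_measurable lebesgue" for n
    proof -
      have [measurable]: "ball y0 (r - inverse (real (Suc n))) \<in> sets lebesgue" by auto
      show ?thesis unfolding G_def[abs_def] by measurable
    qed
    have "incseq G"
    proof (intro incseq_SucI le_funI)
      fix n x
      have "inverse (real (Suc (Suc n))) \<le> inverse (real (Suc n))" by (intro le_imp_inverse_le) auto
      then have "ball y0 (r - inverse (real (Suc n))) \<subseteq> ball y0 (r - inverse (real (Suc (Suc n))))"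
        by (intro subset_ball) linarith
      then show "G n x \<le> G (Suc n) x" unfolding G_def
        by (intro mult_left_mono) (auto simp: indicator_def simp del: mem_ball)
    qed
    have SUP_G: "(SUP n. G n x) = g x" for x
    proof (rule antisym)
      show "(SUP n. G n x) \<le> g x" by (rule SUP_least) (auto simp: G_def indicator_def)
      show "g x \<le> (SUP n. G n x)"
      proof (cases "dist y0 x < r")
        case True
        then obtain n where "inverse (real (Suc n)) < r - dist y0 x" using reals_Archimedean[of "r - dist y0 x"] by auto
        then have "G n x = g x" by (auto simp: G_def indicator_def)
        then show ?thesis by (metis SUP_upper UNIV_I)
      next
        case False
        then have z: "h x * indicator (ball y0 r) x = 0" by simp
        have "g x \<le> 0" using le_funD[OF g(2), of x] unfolding z .
        then have "g x = 0" by simp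
        then show ?thesis by simp
      qed
    qed
    have "c < (\<integral>\<^sup>+x. g x \<partial>lebesgue)" using g by (simp add: nn_integral_eq_simple_integral)
    also have "\<dots> = (\<integral>\<^sup>+x. (SUP n. G n x) \<partial>lebesgue)" by (simp add: SUP_G)
    also have "\<dots> = (SUP n. \<integral>\<^sup>+x. G n x \<partial>lebesgue)"
      by (rule nn_integral_monotone_convergence_SUP[OF \<open>incseq G\<close> G_meas])
    finally obtain n where n: "c < (\<integral>\<^sup>+x. G n x \<partial>lebesgue)" by (auto simp: less_SUP_iff)
    show "\<exists>\<delta>>0. ball y0 \<delta> \<subseteq> {y. c < ?\<Phi> y}"
    proof (intro exI[of _ "inverse (real (Suc n))"] conjI subsetI CollectI)
      fix y assume y: "y \<in> ball y0 (inverse (real (Suc n)))"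
      have "(\<integral>\<^sup>+x. G n x \<partial>lebesgue) \<le> ?\<Phi> y"
      proof (rule nn_integral_mono)
        fix x
        show "G n x \<le> h x * indicator (ball y r) x"
        proof (cases "dist y0 x < r - inverse (real (Suc n))")
          case True
          have pos: "0 < inverse (real (Suc n))" by simp
          have "dist y x \<le> dist y y0 + dist y0 x" by (rule dist_triangle)
          moreover have "dist y y0 < inverse (real (Suc n))" using y by (simp add: dist_commute)
          ultimately have "dist y x < r" using True by linarith
          moreover have "dist y0 x < r" using True pos by linarith
          ultimately show ?thesis using True le_funD[OF g(2), of x] by (simp add: G_def)
        qed (simp add: G_def)
      qed
      then show "c < ?\<Phi> y" using n by (rule less_le_trans[rotated])
    qed simp
  qed
  have "{y. c < ?\<Phi> y} \<in> sets lebesgue"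
    by (rule sets_completionI_sets) (simp only: sets_lborel borel_open[OF op])
  then show "{y \<in> space lebesgue. c < ?\<Phi> y} \<in> sets lebesgue"
    unfolding space_completion space_lborel space_borel by (simp only: UNIV_I simp_thms)
qed

definition local_norm :: "(real ^ 'n \<Rightarrow> real) \<Rightarrow> real \<Rightarrow> real \<Rightarrow> (real ^ 'n \<Rightarrow> ennreal) \<Rightarrow> real \<Rightarrow> real ^ 'n \<Rightarrow> ennreal" where
  "local_norm w q e u r y = ennreal (wmeas w (ball y r) powr e) * weighted_Lq_norm w q (\<lambda>x. u x * indicator (ball y r) x)"

lemma powr_indicator:
  "ennreal_powr (a * indicator S x) q * v = ennreal_powr a q * v * indicator S x"
  by (auto simp: indicator_def)

lemma (in dual_weights) wmeas_ball:
  assumes "0 < r"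
  shows "emeasure (weighted w) (ball y r) = ennreal (wmeas w (ball y r))" "0 < wmeas w (ball y r)"
proof -
  have [measurable]: "ball y r \<in> sets lebesgue" by auto
  have "wmeas w (ball y r) = enn2real (\<integral>\<^sup>+x. ennreal (indicator (ball y r) x *\<^sub>R w x) \<partial>lebesgue)"
    unfolding wmeas_def set_lebesgue_integral_def
  proof (rule integral_eq_nn_integral)
    show "(\<lambda>x. indicator (ball y r) x *\<^sub>R w x) \<in> borel_measurable lebesgue" by measurable
    show "AE x in lebesgue. 0 \<le> indicator (ball y r) x *\<^sub>R w x"
      by (rule AE_I2) (simp add: w_pos less_imp_le)
  qed
  also have "(\<integral>\<^sup>+x. ennreal (indicator (ball y r) x *\<^sub>R w x) \<partial>lebesgue) = emeasure (weighted w) (ball y r)"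
  proof -
    have "ennreal (indicator (ball y r) x *\<^sub>R w x) = ennreal (w x) * indicator (ball y r) x" for x
      by (cases "x \<in> ball y r") simp_all
    then show ?thesis by (subst emeasure_density) simp_all
  qed
  finally have eq: "wmeas w (ball y r) = enn2real (emeasure (weighted w) (ball y r))" .
  show 1: "emeasure (weighted w) (ball y r) = ennreal (wmeas w (ball y r))"
    unfolding eq using ball_finite(1)[OF assms, of y] by (simp only: ennreal_enn2real_if if_False)
  have "emeasure (weighted w) (ball y r) \<noteq> 0" using weighted_pos(1) ball_nonnull[OF assms, of y] by auto
  then show "0 < wmeas w (ball y r)" unfolding 1 by (simp add: ennreal_eq_0_iff not_le)
qed

lemma (in dual_weights) measurable_local_norm [measurable]:
  assumes "0 < r" shows "local_norm w q e u r \<in> borel_measurable lebesgue"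
proof -
  have [measurable]: "(\<lambda>y. \<integral>\<^sup>+x. ennreal_powr (u x) q * ennreal (w x) * indicator (ball y r) x \<partial>lebesgue) \<in> borel_measurable lebesgue"
    by (rule measurable_ball_integral)
  have "wmeas w (ball y r) = enn2real (\<integral>\<^sup>+x. ennreal (w x) * indicator (ball y r) x \<partial>lebesgue)" for y
  proof -
    have "emeasure (weighted w) (ball y r) = (\<integral>\<^sup>+x. ennreal (w x) * indicator (ball y r) x \<partial>lebesgue)"
      by (rule emeasure_density) auto
    then have eq: "(\<integral>\<^sup>+x. ennreal (w x) * indicator (ball y r) x \<partial>lebesgue) = ennreal (wmeas w (ball y r))"
      using wmeas_ball(1)[OF assms, of y] by simp
    show ?thesis unfolding eq using wmeas_ball(2)[OF assms, of y] by (simp add: less_imp_le)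
  qed
  moreover have [measurable]: "(\<lambda>y. \<integral>\<^sup>+x. ennreal (w x) * indicator (ball y r) x \<partial>lebesgue) \<in> borel_measurable lebesgue"
    by (rule measurable_ball_integral)
  ultimately show ?thesis
    unfolding local_norm_def[abs_def] weighted_Lq_norm_def powr_indicator by simp
qed

context dual_weights
begin

definition \<eta> :: real where "\<eta> = 1 - 1 / (2 powr q * A + 1)"

lemma eta: "0 < \<eta>" "\<eta> < 1"
proof -
  have "0 < 2 powr q * A" using A by simp
  then show "0 < \<eta>" "\<eta> < 1" unfolding \<eta>_def by (simp_all add: field_simps)
qed

lemma ball_doubling:
  assumes r: "0 < r" and \<rho>: "1 \<le> \<rho>"
  shows "wmeas w (ball y (\<rho> * r)) \<le> A * (\<rho> ^ CARD('n)) powr q * wmeas w (ball y r)"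
proof -
  have R: "0 < \<rho> * r" "r \<le> \<rho> * r" using assms by auto
  define v where "v = unit_ball_vol CARD('n) * r ^ CARD('n)"
  have v: "0 < v" unfolding v_def using r by (intro mult_pos_pos unit_ball_vol_pos) auto
  have L: "emeasure lebesgue (ball y r) = ennreal v" "emeasure lebesgue (ball y (\<rho> * r)) = ennreal (\<rho> ^ CARD('n) * v)"
    unfolding lebesgue_ball[OF r] lebesgue_ball[OF R(1)] by (simp_all add: v_def power_mult_distrib mult_ac)
  have "ennreal_powr (emeasure lebesgue (ball y r)) q * emeasure (weighted w) (ball y (\<rho> * r))
    \<le> ennreal A * ennreal_powr (emeasure lebesgue (ball y (\<rho> * r))) q * emeasure (weighted w) (ball y r)"
    using R by (intro measure_ratio) auto
  then have "v powr q * wmeas w (ball y (\<rho> * r)) \<le> A * (\<rho> ^ CARD('n) * v) powr q * wmeas w (ball y r)"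
    unfolding L wmeas_ball(1)[OF r] wmeas_ball(1)[OF R(1)]
    using v \<rho> A wmeas_ball(2)[OF r, of y] wmeas_ball(2)[OF R(1), of y]
    by (simp add: ennreal_powr_ennreal flip: ennreal_mult)
  then have "v powr q * wmeas w (ball y (\<rho> * r)) \<le> v powr q * (A * (\<rho> ^ CARD('n)) powr q * wmeas w (ball y r))"
    by (simp add: powr_mult mult_ac)
  then show ?thesis using v by simp
qed

text \<open>The complement of the ball in its double has at least half of the volume.\<close>

lemma ball_reverse_doubling:
  assumes r: "0 < r" shows "wmeas w (ball y r) \<le> \<eta> * wmeas w (ball y (2 * r))"
proof -
  have R: "0 < 2 * r" using r by simp
  let ?B = "ball y (2 * r)" and ?b = "ball y r"
  define v where "v = unit_ball_vol CARD('n) * (2 * r) ^ CARD('n)"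
  have v: "0 < v" unfolding v_def using r by (intro mult_pos_pos unit_ball_vol_pos) auto
  have sub: "?b \<subseteq> ?B" using r by auto
  have LB: "emeasure lebesgue ?B = ennreal v" unfolding lebesgue_ball[OF R] v_def ..
  have "(1 / 2 :: real) ^ CARD('n) \<le> (1 / 2) ^ 1" by (rule power_decreasing) (auto simp: Suc_le_eq)
  then have half: "unit_ball_vol CARD('n) * r ^ CARD('n) \<le> v / 2"
  proof -
    have "unit_ball_vol CARD('n) * r ^ CARD('n) = v * (1 / 2) ^ CARD('n)" by (simp add: v_def power_mult_distrib power_divide)
    also have "\<dots> \<le> v * (1 / 2) ^ 1" using v \<open>(1 / 2 :: real) ^ CARD('n) \<le> _\<close> by (intro mult_left_mono) auto
    finally show ?thesis by simp
  qed
  have "emeasure (weighted w) ?b \<le> ennreal \<eta> * emeasure (weighted w) ?B"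
    unfolding \<eta>_def
  proof (rule half_measure[OF _ _ sub v LB])
    show "emeasure lebesgue ?b \<le> ennreal (v / 2)" unfolding lebesgue_ball[OF r] by (rule ennreal_leI[OF half])
    show "ennreal_powr (emeasure lebesgue (?B - ?b)) q * emeasure (weighted w) ?B
      \<le> ennreal A * ennreal_powr (emeasure lebesgue ?B) q * emeasure (weighted w) (?B - ?b)"
      using R by (intro measure_ratio) auto
  qed (use A ball_finite(1)[OF R, of y] in auto)
  then show ?thesis
    unfolding wmeas_ball(1)[OF r] wmeas_ball(1)[OF R] using eta wmeas_ball(2)[OF R, of y]
    by (simp flip: ennreal_mult)
qed

lemma ball_reverse_doubling_iterated:
  assumes r: "0 < r" shows "wmeas w (ball y r) \<le> \<eta> ^ i * wmeas w (ball y (2 ^ i * r))"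
proof (induction i)
  case (Suc i)
  have "\<eta> ^ i * wmeas w (ball y (2 ^ i * r)) \<le> \<eta> ^ i * (\<eta> * wmeas w (ball y (2 * (2 ^ i * r))))"
    using eta r by (intro mult_left_mono ball_reverse_doubling) auto
  then show ?case using Suc by (simp add: mult_ac)
qed simp

lemma wmeas_ball_mono:
  assumes "0 < r" "r \<le> s" shows "wmeas w (ball y r) \<le> wmeas w (ball y s)"
proof -
  have "emeasure (weighted w) (ball y r) \<le> emeasure (weighted w) (ball y s)"
    using assms by (intro emeasure_mono) auto
  then show ?thesis using wmeas_ball[OF assms(1), of y] wmeas_ball[of s y] assms by simp
qed

text \<open>For \<open>x\<close> in a ball of radius about \<open>2\<^sup>K\<close>, the scales up to \<open>K\<close> see only the part of \<open>f\<close> in a larger ball,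
  to which \<open>square_bounded\<close> applies; each larger scale contributes at most an average of \<open>\<bar>f\<bar>\<close>.\<close>

lemma gstar_local:
  assumes \<gamma>: "0 < \<gamma>" "\<gamma> \<le> 1" and lam: "2 < lam"
  shows "\<exists>C>0. \<forall>(f :: real ^ 'n \<Rightarrow> complex) y r K. f \<in> borel_measurable lebesgue \<longrightarrow> 2 powi K / 2 < r \<longrightarrow> r \<le> 2 powi K \<longrightarrow>
    (\<integral>\<^sup>+x. ennreal_powr (ennreal (norm (f x))) q * indicator (ball y (8 * real CARD('n) * r)) x \<partial>weighted w) \<noteq> top \<longrightarrow>
    (\<integral>\<^sup>+x. ennreal_powr (gstar lam \<gamma> f x * indicator (ball y r) x) q * ennreal (w x) \<partial>lebesgue) \<le>
     ennreal C * ((\<integral>\<^sup>+x. ennreal_powr (ennreal (norm (f x))) q * indicator (ball y (8 * real CARD('n) * r)) x \<partial>weighted w)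
       + ennreal_powr (\<Sum>i. ennreal (1 / (2 ^ i * r) ^ CARD('n)) * (\<integral>\<^sup>+x. ennreal (norm (f x)) * indicator (ball y (8 * real CARD('n) * 2 ^ i * r)) x \<partial>lebesgue)) q
         * emeasure (weighted w) (ball y r))"
proof -
  obtain C0 where C0: "0 < C0" "\<And>\<psi> N K (f :: real ^ 'n \<Rightarrow> complex). kernel_family \<gamma> lam \<psi> \<Longrightarrow> integrable lebesgue f \<Longrightarrow>
    (\<integral>\<^sup>+x. ennreal_powr (ennreal (kernel_family.square lam \<psi> N f K x)) (q / 2) \<partial>weighted w)
      \<le> ennreal C0 * (\<integral>\<^sup>+x. ennreal_powr (ennreal (norm (f x))) q \<partial>weighted w)"
    using square_bounded[OF \<gamma> lam] by blast
  let ?n = "real CARD('n)"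
  have n1: "1 \<le> ?n" by (simp add: Suc_le_eq)
  define D where "D = discr_const TYPE('n) lam"
  have D: "0 < D" by (simp add: D_def discr_const_def)
  define c where "c = 16 * 9 ^ CARD('n) * geo ((lam - 2) * ?n)"
  have c: "0 < c" unfolding c_def using lam by (intro mult_pos_pos geo_pos) auto
  define a1 where "a1 = 2 powr (q / 2) * (4 * D) powr (q / 2)"
  define a2 where "a2 = 2 powr (q / 2) * (D * c) powr (q / 2)"
  have a: "0 < a1" "0 < a2" using D c by (auto simp: a1_def a2_def)
  define C where "C = a1 * C0 + a2"
  have C: "0 < C" unfolding C_def using a C0 by (intro add_pos_pos mult_pos_pos) auto
  have main: "(\<integral>\<^sup>+x. ennreal_powr (gstar lam \<gamma> f x * indicator (ball y r) x) q * ennreal (w x) \<partial>lebesgue) \<le>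
     ennreal C * ((\<integral>\<^sup>+x. ennreal_powr (ennreal (norm (f x))) q * indicator (ball y (8 * ?n * r)) x \<partial>weighted w)
       + ennreal_powr (\<Sum>i. ennreal (1 / (2 ^ i * r) ^ CARD('n)) * (\<integral>\<^sup>+x. ennreal (norm (f x)) * indicator (ball y (8 * ?n * 2 ^ i * r)) x \<partial>lebesgue)) q
         * emeasure (weighted w) (ball y r))"
    if f[measurable]: "f \<in> borel_measurable lebesgue" and K: "2 powi K / 2 < r" "r \<le> 2 powi K"
      and fin: "(\<integral>\<^sup>+x. ennreal_powr (ennreal (norm (f x))) q * indicator (ball y (8 * ?n * r)) x \<partial>weighted w) \<noteq> top"
    for f :: "real ^ 'n \<Rightarrow> complex" and y r K
  proof -
    have r: "0 < r" using K(1) by (rule le_less_trans[rotated]) simp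
    define B0 where "B0 = ball y (8 * ?n * r)"
    have R0: "0 < 8 * ?n * r" using r n1 by simp
    have B0[measurable]: "B0 \<in> sets lebesgue" unfolding B0_def by auto
    let ?nf = "\<integral>\<^sup>+x. ennreal_powr (ennreal (norm (f x))) q * indicator B0 x \<partial>weighted w"
    define v where "v i = ennreal (1 / (2 ^ i * r) ^ CARD('n)) * (\<integral>\<^sup>+x. ennreal (norm (f x)) * indicator (ball y (8 * ?n * 2 ^ i * r)) x \<partial>lebesgue)" for i
    define V where "V = (\<Sum>i. v i)"
    \<comment> \<open>All kernels of scale at most \<open>K\<close> that matter for points of \<open>ball y r\<close> live in this star.\<close>
    define S3 where "S3 = star 3 K (cell K y)"
    have S3[measurable]: "S3 \<in> sets lebesgue" by (simp add: S3_def)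
    have S3_sub: "S3 \<subseteq> B0"
    proof
      fix z assume "z \<in> S3"
      then have "near 3 (cell K y) (cell K z)" by (simp add: S3_def)
      then have "norm (y - z) < ?n * (4 * 2 powi K)" using near_cell_norm[of 3 K y z] by simp
      also have "\<dots> < ?n * (4 * (2 * r))" using K(1) n1 by (intro mult_strict_left_mono) auto
      finally show "z \<in> B0" by (simp add: B0_def dist_norm)
    qed
    define f1 where "f1 z = indicator S3 z *\<^sub>R f z" for z
    have f1: "integrable lebesgue f1"
    proof (rule integrableI_bounded)
      show "f1 \<in> borel_measurable lebesgue" unfolding f1_def[abs_def] by measurable
      have "(\<integral>\<^sup>+x. ennreal (norm (f1 x)) \<partial>lebesgue) \<le> (\<integral>\<^sup>+x. ennreal (norm (f x)) * indicator B0 x \<partial>lebesgue)"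
        using S3_sub by (intro nn_integral_mono) (auto simp: f1_def indicator_def)
      also have "\<dots> < \<infinity>"
      proof -
        have "ennreal_powr (\<integral>\<^sup>+x. ennreal (norm (f x)) * indicator B0 x \<partial>lebesgue) q * emeasure (weighted w) B0
          \<le> ennreal A * ennreal_powr (emeasure lebesgue B0) q * ?nf"
          unfolding B0_def using R0 by (intro average_le) auto
        also have "\<dots> < top" using fin lebesgue_ball[OF R0, of y]
          by (auto simp: B0_def less_top[symmetric] ennreal_mult_eq_top_iff)
        finally have "ennreal_powr (\<integral>\<^sup>+x. ennreal (norm (f x)) * indicator B0 x \<partial>lebesgue) q * emeasure (weighted w) B0 \<noteq> top" by simp
        moreover have "emeasure (weighted w) B0 \<noteq> 0" unfolding B0_def using wmeas_ball[OF R0, of y] by simp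
        ultimately show ?thesis by (auto simp: ennreal_mult_eq_top_iff less_top[symmetric])
      qed
      finally show "(\<integral>\<^sup>+x. ennreal (norm (f1 x)) \<partial>lebesgue) < \<infinity>" .
    qed
    obtain \<psi> where \<psi>: "\<And>k m. \<psi> k m \<in> kernel \<gamma> k m"
      "\<And>k m. kernel_sup \<gamma> f1 k m \<le> ennreal (2 * norm (LINT z|lebesgue. f1 z * \<psi> k m z))"
      by (rule kernel_choice[OF f1, where \<gamma> = \<gamma>]) blast
    have kf: "kernel_family \<gamma> lam \<psi>" by (intro kernel_family.intro \<gamma> lam \<psi>(1))
    let ?sq = "\<lambda>N::nat. kernel_family.square lam \<psi> (int N) f1 K"
    define U where "U x = (SUP N. ennreal (?sq N x))" for x
    have sq_meas[measurable]: "?sq N \<in> borel_measurable lebesgue" for N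
      by (rule kernel_family.square_measurable[OF kf])
    have U_meas[measurable]: "U \<in> borel_measurable lebesgue" unfolding U_def[abs_def] by measurable
    have levels: "(\<Sum>k\<in>{-int N..int N}. level \<gamma> lam (int N) f k (cell k x)) \<le> ennreal 4 * U x + ennreal c * V\<^sup>2"
      if x: "x \<in> ball y r" for x and N :: nat
    proof -
      have xy: "near 1 (cell K y) (cell K x)"
        using x K(2) by (intro norm_near_cell) (auto simp: dist_norm)
      define L where "L = nat (int N + \<bar>K\<bar>)"
      have "(\<Sum>k\<in>{-int N..int N}. level \<gamma> lam (int N) f k (cell k x)) \<le>
        (\<Sum>k\<in>{-int N..K} \<union> {K + 1..K + int L}. level \<gamma> lam (int N) f k (cell k x))"
        by (intro sum_mono2) (auto simp: L_def)
      also have "\<dots> = (\<Sum>k\<in>{-int N..K}. level \<gamma> lam (int N) f k (cell k x)) + (\<Sum>k\<in>{K + 1..K + int L}. level \<gamma> lam (int N) f k (cell k x))"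
        by (rule sum.union_disjoint) auto
      also have "(\<Sum>k\<in>{-int N..K}. level \<gamma> lam (int N) f k (cell k x)) \<le> (\<Sum>k\<in>{-int N..K}. ennreal (4 * kernel_family.beta lam \<psi> (int N) f1 k (cell k x)))"
      proof (intro sum_mono level_le_beta[OF \<psi>(2) kf])
        fix k z assume k: "k \<in> {-int N..K}" and z: "z \<in> star 2 k (cell k x)"
        have "near 2 (cell K x) (cell K z)" using z k near_cell_mono[of 2 k x z K] by simp
        then have "near (1 + 2) (cell K y) (cell K z)" using xy by (rule near_trans[rotated])
        then show "f z = f1 z" by (simp add: f1_def S3_def)
      qed
      also have "\<dots> = ennreal 4 * ennreal (?sq N x)"
        using kernel_family.beta_nonneg[OF kf]
        by (simp add: kernel_family.square_def[OF kf] ennreal_mult sum_nonneg flip: sum_ennreal sum_distrib_left)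
      also have "\<dots> \<le> ennreal 4 * U x" unfolding U_def by (intro mult_left_mono SUP_upper) auto
      also have "(\<Sum>k\<in>{K + 1..K + int L}. level \<gamma> lam (int N) f k (cell k x)) = (\<Sum>i\<in>{1..L}. level \<gamma> lam (int N) f (K + int i) (cell (K + int i) x))"
      proof -
        have "{K + 1..K + int L} = (\<lambda>i. K + int i) ` {1..L}"
        proof
          show "{K + 1..K + int L} \<subseteq> (\<lambda>i. K + int i) ` {1..L}"
          proof
            fix k assume "k \<in> {K + 1..K + int L}"
            then show "k \<in> (\<lambda>i. K + int i) ` {1..L}" by (intro image_eqI[of _ _ "nat (k - K)"]) auto
          qed
        qed auto
        then show ?thesis by (simp add: sum.reindex inj_on_def)
      qed
      also have "\<dots> \<le> (\<Sum>i\<in>{1..L}. ennreal c * (v i)\<^sup>2)"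
      proof (rule sum_mono)
        fix i
        let ?k = "K + int i"
        have pk: "2 powi ?k = 2 ^ i * (2 powi K :: real)" by (simp add: power_int_add)
        have "level \<gamma> lam (int N) f ?k (cell ?k x) \<le> ennreal c *
          (ennreal (1 / (2 powi ?k) ^ CARD('n)) * (\<integral>\<^sup>+z. ennreal (norm (f z)) * indicator (star 2 ?k (cell ?k x)) z \<partial>lebesgue))\<^sup>2"
          unfolding c_def by (rule level_le_average[OF \<gamma> lam f])
        also have "\<dots> \<le> ennreal c * (v i)\<^sup>2"
          unfolding v_def
        proof (intro mult_left_mono power_mono mult_mono ennreal_leI nn_integral_mono)
          show "1 / (2 powi ?k) ^ CARD('n) \<le> 1 / (2 ^ i * r) ^ CARD('n)"
            unfolding pk using K r by (intro divide_left_mono power_mono mult_left_mono mult_pos_pos zero_less_power) auto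
          fix z
          have "z \<in> ball y (8 * ?n * 2 ^ i * r)" if "z \<in> star 2 ?k (cell ?k x)"
          proof -
            have "norm (x - z) < ?n * (3 * (2 ^ i * 2 powi K))" using that near_cell_norm[of 2 ?k x z] pk by simp
            also have "\<dots> \<le> ?n * (3 * (2 ^ i * (2 * r)))" using K by (intro mult_left_mono) auto
            finally have "norm (x - z) < 6 * ?n * 2 ^ i * r" by simp
            moreover have "norm (y - x) < 1 * 1 * r" using x by (simp add: dist_norm)
            moreover have "1 * 1 * r \<le> ?n * 2 ^ i * r" using n1 r by (intro mult_mono) auto
            moreover have "norm (y - z) \<le> norm (y - x) + norm (x - z)" using norm_triangle_ineq[of "y - x" "x - z"] by simp
            moreover have "0 \<le> ?n * 2 ^ i * r" using r by simp
            ultimately have "norm (y - z) < 8 * (?n * 2 ^ i * r)" by linarith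
            then show ?thesis by (simp add: dist_norm mult.assoc)
          qed
          then show "indicator (star 2 ?k (cell ?k x)) z \<le> (indicator (ball y (8 * ?n * 2 ^ i * r)) z :: ennreal)"
            unfolding indicator_def by (simp del: mem_star mem_ball)
        qed auto
        finally show "level \<gamma> lam (int N) f ?k (cell ?k x) \<le> ennreal c * (v i)\<^sup>2" .
      qed
      also have "\<dots> \<le> ennreal c * V\<^sup>2"
      proof -
        have fs: "(\<Sum>i\<in>I. v i) \<le> V" if "finite I" for I unfolding V_def by (rule sum_le_suminf) (use that in auto)
        have "(\<Sum>i\<in>{1..L}. (v i)\<^sup>2) \<le> (\<Sum>i\<in>{1..L}. v i * V)"
          unfolding power2_eq_square using fs[of "{_}"] by (intro sum_mono mult_left_mono) auto
        also have "\<dots> = (\<Sum>i\<in>{1..L}. v i) * V" by (simp add: sum_distrib_right)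
        also have "\<dots> \<le> V * V" by (intro mult_right_mono fs) auto
        finally show ?thesis by (simp add: power2_eq_square mult_left_mono flip: sum_distrib_left)
      qed
      finally show ?thesis by (simp add: add_mono)
    qed
    define H where "H x = ennreal a1 * ennreal_powr (U x) (q / 2) + ennreal a2 * ennreal_powr V q * indicator (ball y r) x" for x
    have bm[measurable]: "ball y r \<in> sets lebesgue" by auto
    have [measurable]: "H \<in> borel_measurable lebesgue" unfolding H_def[abs_def] by measurable
    have point: "ennreal_powr (gstar lam \<gamma> f x * indicator (ball y r) x) q \<le> H x" for x
    proof (cases "x \<in> ball y r")
      case True
      have "(gstar lam \<gamma> f x)\<^sup>2 \<le> ennreal D * (SUP N::nat. \<Sum>k\<in>{-int N..int N}. level \<gamma> lam (int N) f k (cell k x))"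
        unfolding D_def using lam by (intro gstar_le_levels \<gamma>) auto
      also have "\<dots> \<le> ennreal D * (ennreal 4 * U x + ennreal c * V\<^sup>2)"
        by (intro mult_left_mono SUP_least levels True) auto
      also have "\<dots> = ennreal (4 * D) * U x + ennreal (D * c) * V\<^sup>2"
        using D c by (simp add: distrib_left ennreal_mult mult_ac)
      finally have sq: "(gstar lam \<gamma> f x)\<^sup>2 \<le> ennreal (4 * D) * U x + ennreal (D * c) * V\<^sup>2" .
      have "ennreal_powr (gstar lam \<gamma> f x) q = ennreal_powr ((gstar lam \<gamma> f x)\<^sup>2) (q / 2)"
        by (simp add: ennreal_powr_powr flip: ennreal_powr_two)
      also have "\<dots> \<le> ennreal_powr (ennreal (4 * D) * U x + ennreal (D * c) * V\<^sup>2) (q / 2)"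
        using q by (intro ennreal_powr_mono sq) auto
      also have "\<dots> \<le> ennreal (2 powr (q / 2)) * (ennreal_powr (ennreal (4 * D) * U x) (q / 2) + ennreal_powr (ennreal (D * c) * V\<^sup>2) (q / 2))"
        using q by (intro ennreal_powr_add_le) auto
      also have "ennreal_powr (ennreal (4 * D) * U x) (q / 2) = ennreal ((4 * D) powr (q / 2)) * ennreal_powr (U x) (q / 2)"
        using D q by (intro ennreal_powr_cmult) auto
      also have "ennreal_powr (ennreal (D * c) * V\<^sup>2) (q / 2) = ennreal ((D * c) powr (q / 2)) * ennreal_powr V q"
        using D c q by (subst ennreal_powr_cmult) (auto simp: ennreal_powr_powr simp flip: ennreal_powr_two)
      also have "ennreal (2 powr (q / 2)) * (ennreal ((4 * D) powr (q / 2)) * ennreal_powr (U x) (q / 2) + ennreal ((D * c) powr (q / 2)) * ennreal_powr V q) = H x"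
        using True by (simp add: H_def a1_def a2_def ennreal_mult distrib_left mult.assoc)
      finally show ?thesis using True by simp
    qed simp
    have "(\<integral>\<^sup>+x. ennreal_powr (gstar lam \<gamma> f x * indicator (ball y r) x) q * ennreal (w x) \<partial>lebesgue) \<le> (\<integral>\<^sup>+x. ennreal (w x) * H x \<partial>lebesgue)"
      by (intro nn_integral_mono) (simp add: mult.commute[of "ennreal (w _)"] mult_right_mono point)
    also have "\<dots> = (\<integral>\<^sup>+x. H x \<partial>weighted w)" by (rule nn_integral_density[symmetric]) auto
    also have "\<dots> = ennreal a1 * (\<integral>\<^sup>+x. ennreal_powr (U x) (q / 2) \<partial>weighted w) + ennreal a2 * ennreal_powr V q * emeasure (weighted w) (ball y r)"
      unfolding H_def by (subst nn_integral_add, measurable, subst nn_integral_cmult, measurable, subst nn_integral_cmult_indicator) auto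
    also have "(\<integral>\<^sup>+x. ennreal_powr (U x) (q / 2) \<partial>weighted w) \<le> ennreal C0 * ?nf"
    proof -
      have inc: "incseq (\<lambda>N x. ennreal_powr (ennreal (?sq N x)) (q / 2))"
      proof (intro incseq_SucI le_funI ennreal_powr_mono ennreal_leI)
        fix N x
        have "kernel_family.beta lam \<psi> (int N) f1 k m \<le> kernel_family.beta lam \<psi> (int (Suc N)) f1 k m" for k m
          unfolding kernel_family.beta_def[OF kf] by (intro sum_mono2) (auto intro!: sum_nonneg)
        then have "?sq N x \<le> (\<Sum>k\<in>{-int N..K}. kernel_family.beta lam \<psi> (int (Suc N)) f1 k (cell k x))"
          unfolding kernel_family.square_def[OF kf] by (intro sum_mono)
        also have "\<dots> \<le> ?sq (Suc N) x"
          unfolding kernel_family.square_def[OF kf] using kernel_family.beta_nonneg[OF kf] by (intro sum_mono2) auto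
        finally show "?sq N x \<le> ?sq (Suc N) x" .
      qed (use q in auto)
      have "(\<integral>\<^sup>+x. ennreal_powr (U x) (q / 2) \<partial>weighted w) = (\<integral>\<^sup>+x. (SUP N. ennreal_powr (ennreal (?sq N x)) (q / 2)) \<partial>weighted w)"
        unfolding U_def using q by (subst ennreal_powr_SUP) auto
      also have "\<dots> = (SUP N. \<integral>\<^sup>+x. ennreal_powr (ennreal (?sq N x)) (q / 2) \<partial>weighted w)"
        by (rule nn_integral_monotone_convergence_SUP[OF inc]) measurable
      also have "\<dots> \<le> ennreal C0 * (\<integral>\<^sup>+x. ennreal_powr (ennreal (norm (f1 x))) q \<partial>weighted w)"
        by (intro SUP_least C0 kf f1)
      also have "\<dots> \<le> ennreal C0 * ?nf"
        using S3_sub by (intro mult_left_mono nn_integral_mono) (auto simp: f1_def indicator_def)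
      finally show ?thesis .
    qed
    finally have "(\<integral>\<^sup>+x. ennreal_powr (gstar lam \<gamma> f x * indicator (ball y r) x) q * ennreal (w x) \<partial>lebesgue)
      \<le> ennreal a1 * (ennreal C0 * ?nf) + ennreal a2 * ennreal_powr V q * emeasure (weighted w) (ball y r)"
      by (simp add: mult_left_mono add_right_mono)
    also have "\<dots> = ennreal (a1 * C0) * ?nf + ennreal a2 * (ennreal_powr V q * emeasure (weighted w) (ball y r))"
      using a C0 by (simp add: ennreal_mult mult.assoc)
    also have "\<dots> \<le> ennreal C * ?nf + ennreal C * (ennreal_powr V q * emeasure (weighted w) (ball y r))"
      using a C0 by (intro add_mono mult_right_mono ennreal_leI) (auto simp: C_def)
    finally show ?thesis unfolding V_def v_def B0_def by (simp add: distrib_left)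
  qed
  show ?thesis by (intro exI[of _ C] conjI allI impI C main)
qed

end

section \<open>Mixed norms\<close>

context dual_weights
begin

lemma average_norm_bound:
  fixes f :: "real ^ 'n \<Rightarrow> complex"
  assumes [measurable]: "f \<in> borel_measurable lebesgue" and s: "0 < s" and \<rho>: "0 < \<rho>"
  shows "ennreal (1 / s ^ CARD('n)) * (\<integral>\<^sup>+x. ennreal (norm (f x)) * indicator (ball y (\<rho> * s)) x \<partial>lebesgue) \<le>
    ennreal (A powr (1 / q) * (unit_ball_vol CARD('n) * \<rho> ^ CARD('n)) * wmeas w (ball y (\<rho> * s)) powr (- 1 / q)) *
      weighted_Lq_norm w q (\<lambda>x. ennreal (norm (f x)) * indicator (ball y (\<rho> * s)) x)"
proof -
  let ?B = "ball y (\<rho> * s)"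
  have R: "0 < \<rho> * s" using s \<rho> by simp
  have [measurable]: "?B \<in> sets lebesgue" by auto
  let ?S = "\<integral>\<^sup>+x. ennreal (norm (f x)) * indicator ?B x \<partial>lebesgue"
  let ?nf = "\<integral>\<^sup>+x. ennreal_powr (ennreal (norm (f x))) q * indicator ?B x \<partial>weighted w"
  define v where "v = unit_ball_vol CARD('n) * \<rho> ^ CARD('n)"
  have v: "0 < v" unfolding v_def using \<rho> by (intro mult_pos_pos unit_ball_vol_pos) auto
  have L: "emeasure lebesgue ?B = ennreal (v * s ^ CARD('n))"
    unfolding lebesgue_ball[OF R] by (simp add: v_def power_mult_distrib mult_ac)
  define b where "b = wmeas w ?B"
  have b: "0 < b" "emeasure (weighted w) ?B = ennreal b" using wmeas_ball[OF R, of y] by (auto simp: b_def)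
  have vs: "0 < v * s ^ CARD('n)" using v s by simp
  have X: "weighted_Lq_norm w q (\<lambda>x. ennreal (norm (f x)) * indicator ?B x) = ennreal_powr ?nf (1 / q)"
    unfolding weighted_Lq_norm_def powr_indicator by (subst nn_integral_density) (auto simp: mult_ac)
  have "ennreal_powr ?S q * ennreal b \<le> ennreal A * ennreal_powr (ennreal (v * s ^ CARD('n))) q * ?nf"
    using average_le[of "\<lambda>x. ennreal (norm (f x))" "\<rho> * s" y] R unfolding L b by auto
  then have "ennreal_powr ?S q * ennreal b * ennreal (1 / b) \<le> ennreal A * ennreal_powr (ennreal (v * s ^ CARD('n))) q * ?nf * ennreal (1 / b)"
    by (rule mult_right_mono) simp
  moreover have "ennreal_powr ?S q * ennreal b * ennreal (1 / b) = ennreal_powr ?S q"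
    using b by (simp add: mult.assoc flip: ennreal_mult)
  moreover have "ennreal A * ennreal_powr (ennreal (v * s ^ CARD('n))) q * ?nf * ennreal (1 / b) = ennreal (A * (v * s ^ CARD('n)) powr q * (1 / b)) * ?nf"
  proof -
    have "ennreal (A * (v * s ^ CARD('n)) powr q * (1 / b)) = ennreal A * ennreal_powr (ennreal (v * s ^ CARD('n))) q * ennreal (1 / b)"
      using A b vs by (subst ennreal_powr_ennreal) (simp_all add: ennreal_mult[symmetric] del: times_divide_eq_right)
    then show ?thesis by (simp only: ac_simps)
  qed
  ultimately have "ennreal_powr ?S q \<le> ennreal (A * (v * s ^ CARD('n)) powr q * (1 / b)) * ?nf" by simp
  then have "?S \<le> ennreal_powr (ennreal (A * (v * s ^ CARD('n)) powr q * (1 / b)) * ?nf) (1 / q)"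
    using q by (subst (asm) ennreal_powr_le_iff) auto
  also have "\<dots> = ennreal ((A * (v * s ^ CARD('n)) powr q * (1 / b)) powr (1 / q)) * ennreal_powr ?nf (1 / q)"
    using A b vs q by (intro ennreal_powr_cmult mult_pos_pos) auto
  also have "(A * (v * s ^ CARD('n)) powr q * (1 / b)) powr (1 / q) = A powr (1 / q) * (v * s ^ CARD('n)) * b powr (- 1 / q)"
  proof -
    have p: "((v * s ^ CARD('n)) powr q) powr (1 / q) = v * s ^ CARD('n)" using q vs by (simp only: powr_powr) simp
    have bq: "(1 / b) powr (1 / q) = b powr (- 1 / q)" using b by (simp add: powr_divide powr_minus_divide)
    show ?thesis
      by (simp only: powr_mult[of "A * (v * s ^ CARD('n)) powr q" "1 / b"] powr_mult[of A "(v * s ^ CARD('n)) powr q"] p bq)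
  qed
  finally have "ennreal (1 / s ^ CARD('n)) * ?S \<le> ennreal (1 / s ^ CARD('n)) * (ennreal (A powr (1 / q) * (v * s ^ CARD('n)) * b powr (- 1 / q)) * ennreal_powr ?nf (1 / q))"
    by (rule mult_left_mono) simp
  also have "\<dots> = ennreal (1 / s ^ CARD('n) * (A powr (1 / q) * (v * s ^ CARD('n)) * b powr (- 1 / q))) * ennreal_powr ?nf (1 / q)"
    using s v by (subst ennreal_mult) (simp_all add: mult.assoc)
  also have "1 / s ^ CARD('n) * (A powr (1 / q) * (v * s ^ CARD('n)) * b powr (- 1 / q)) = A powr (1 / q) * v * b powr (- 1 / q)"
    using s by simp
  finally show ?thesis unfolding X v_def b_def .
qed

text \<open>The averages at radius \<open>8 n 2\<^sup>i r\<close> cost the power \<open>- 1 / q\<close> of the weight of that ball, while the ball of radius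
  \<open>r\<close> supplies the power \<open>e + 1 / q > 0\<close>. By \<open>ball_reverse_doubling_iterated\<close> the latter may be exchanged for the same
  power of the large ball at a gain of \<open>\<eta> powr (e + 1 / q)\<close> for each \<open>i\<close>, which restores the normalization
  with exponent \<open>e\<close>.\<close>

lemma local_norm_gstar:
  assumes \<gamma>: "0 < \<gamma>" "\<gamma> \<le> 1" and lam: "2 < lam" and e: "e \<le> 0" "0 < e + 1 / q"
  shows "\<exists>C>0. \<forall>(f :: real ^ 'n \<Rightarrow> complex) r y. f \<in> borel_measurable lebesgue \<longrightarrow> 0 < r \<longrightarrow>
    local_norm w q e (gstar lam \<gamma> f) r y \<le>
    ennreal C * (\<Sum>i. ennreal ((\<eta> powr (e + 1 / q)) ^ i) * local_norm w q e (\<lambda>x. ennreal (norm (f x))) (8 * real CARD('n) * (2 ^ i * r)) y)"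
proof -
  let ?n = "real CARD('n)"
  have n1: "1 \<le> ?n" by (simp add: Suc_le_eq)
  obtain C1 where C1: "0 < C1" and main: "\<And>(f :: real ^ 'n \<Rightarrow> complex) y r K. f \<in> borel_measurable lebesgue \<Longrightarrow> 2 powi K / 2 < r \<Longrightarrow> r \<le> 2 powi K \<Longrightarrow>
    (\<integral>\<^sup>+x. ennreal_powr (ennreal (norm (f x))) q * indicator (ball y (8 * ?n * r)) x \<partial>weighted w) \<noteq> top \<Longrightarrow>
    (\<integral>\<^sup>+x. ennreal_powr (gstar lam \<gamma> f x * indicator (ball y r) x) q * ennreal (w x) \<partial>lebesgue) \<le>
     ennreal C1 * ((\<integral>\<^sup>+x. ennreal_powr (ennreal (norm (f x))) q * indicator (ball y (8 * ?n * r)) x \<partial>weighted w)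
       + ennreal_powr (\<Sum>i. ennreal (1 / (2 ^ i * r) ^ CARD('n)) * (\<integral>\<^sup>+x. ennreal (norm (f x)) * indicator (ball y (8 * ?n * 2 ^ i * r)) x \<partial>lebesgue)) q
         * emeasure (weighted w) (ball y r))"
    using gstar_local[OF \<gamma> lam] by blast
  define t where "t = \<eta> powr (e + 1 / q)"
  have t: "0 < t" using eta by (simp add: t_def)
  define D where "D = A * ((8 * ?n) ^ CARD('n)) powr q"
  have D: "0 < D" using A n1 by (simp add: D_def)
  define c2 where "c2 = A powr (1 / q) * (unit_ball_vol CARD('n) * (8 * ?n) ^ CARD('n))"
  have c2: "0 < c2" unfolding c2_def using A n1 by (intro mult_pos_pos unit_ball_vol_pos) auto
  define C2 where "C2 = C1 powr (1 / q) * 2 powr (1 / q)"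
  have C2: "0 < C2" using C1 by (simp add: C2_def)
  define C where "C = C2 * (D powr (- e) + c2)"
  have C: "0 < C" unfolding C_def using C2 c2 by (intro mult_pos_pos add_nonneg_pos) auto
  have main2: "local_norm w q e (gstar lam \<gamma> f) r y \<le>
    ennreal C * (\<Sum>i. ennreal (t ^ i) * local_norm w q e (\<lambda>x. ennreal (norm (f x))) (8 * ?n * (2 ^ i * r)) y)"
    if f[measurable]: "f \<in> borel_measurable lebesgue" and r: "0 < r" for f :: "real ^ 'n \<Rightarrow> complex" and r y
  proof -
    let ?\<rho> = "\<lambda>i. 8 * ?n * (2 ^ i * r)"
    have R: "0 < ?\<rho> i" for i using n1 r by simp
    define b where "b = wmeas w (ball y r)"
    define bi where "bi i = wmeas w (ball y (?\<rho> i))" for i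
    have b: "0 < b" and bi: "0 < bi i" for i using wmeas_ball(2)[OF r, of y] wmeas_ball(2)[OF R, of y] by (auto simp: b_def bi_def)
    define X where "X i = weighted_Lq_norm w q (\<lambda>x. ennreal (norm (f x)) * indicator (ball y (?\<rho> i)) x)" for i
    define u where "u i = local_norm w q e (\<lambda>x. ennreal (norm (f x))) (?\<rho> i) y" for i
    have u: "u i = ennreal (bi i powr e) * X i" for i by (simp add: u_def local_norm_def bi_def X_def)
    let ?\<Sigma> = "\<Sum>i. ennreal (t ^ i) * u i"
    have single: "ennreal (t ^ i) * u i \<le> ?\<Sigma>" for i
      using sum_le_suminf[of "\<lambda>i. ennreal (t ^ i) * u i" "{i}"] by auto
    have u0: "u 0 \<le> ?\<Sigma>" using single[of 0] by simp
    let ?nf = "\<integral>\<^sup>+x. ennreal_powr (ennreal (norm (f x))) q * indicator (ball y (8 * ?n * r)) x \<partial>weighted w"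
    have X0: "X 0 = ennreal_powr ?nf (1 / q)"
    proof -
      have [measurable]: "ball y (8 * ?n * r) \<in> sets lebesgue" by auto
      have "?nf = (\<integral>\<^sup>+x. ennreal (w x) * (ennreal_powr (ennreal (norm (f x))) q * indicator (ball y (8 * ?n * r)) x) \<partial>lebesgue)"
        by (rule nn_integral_density) measurable
      also have "\<dots> = (\<integral>\<^sup>+x. ennreal_powr (ennreal (norm (f x))) q * ennreal (w x) * indicator (ball y (8 * ?n * r)) x \<partial>lebesgue)"
        by (simp only: ac_simps)
      finally show ?thesis unfolding X_def weighted_Lq_norm_def powr_indicator by simp
    qed
    show ?thesis
    proof (cases "?nf = top")
      case True
      then have "u 0 = top" using bi[of 0] by (simp add: u X0 ennreal_mult_top)
      then have "?\<Sigma> = top" using u0 by (simp add: top_unique)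
      moreover have "ennreal C \<noteq> 0" using C by simp
      ultimately show ?thesis unfolding u_def by (simp only: ennreal_mult_top if_False top_greatest)
    next
      case False
      obtain K :: int where K: "2 powi K / 2 < r" "r \<le> 2 powi K" by (rule dyadic_scale[OF r])
      define v where "v i = ennreal (1 / (2 ^ i * r) ^ CARD('n)) * (\<integral>\<^sup>+x. ennreal (norm (f x)) * indicator (ball y (?\<rho> i)) x \<partial>lebesgue)" for i
      define V where "V = (\<Sum>i. v i)"
      have v_le: "v i \<le> ennreal (c2 * bi i powr (- 1 / q)) * X i" for i
        unfolding v_def X_def bi_def c2_def using n1 r by (intro average_norm_bound f) auto
      have "(\<integral>\<^sup>+x. ennreal_powr (gstar lam \<gamma> f x * indicator (ball y r) x) q * ennreal (w x) \<partial>lebesgue)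
        \<le> ennreal C1 * (?nf + ennreal_powr V q * ennreal b)"
        using main[OF f K False] wmeas_ball(1)[OF r, of y] by (simp add: V_def v_def b_def mult.assoc)
      then have "weighted_Lq_norm w q (\<lambda>x. gstar lam \<gamma> f x * indicator (ball y r) x)
        \<le> ennreal_powr (ennreal C1 * (?nf + ennreal_powr V q * ennreal b)) (1 / q)"
        unfolding weighted_Lq_norm_def using q by (intro ennreal_powr_mono) auto
      also have "\<dots> = ennreal (C1 powr (1 / q)) * ennreal_powr (?nf + ennreal_powr V q * ennreal b) (1 / q)"
        using C1 q by (intro ennreal_powr_cmult) auto
      also have "\<dots> \<le> ennreal (C1 powr (1 / q)) * (ennreal (2 powr (1 / q)) * (ennreal_powr ?nf (1 / q) + ennreal_powr (ennreal_powr V q * ennreal b) (1 / q)))"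
        using q by (intro mult_left_mono ennreal_powr_add_le) auto
      also have "ennreal_powr (ennreal_powr V q * ennreal b) (1 / q) = ennreal (b powr (1 / q)) * V"
        using q b by (simp add: ennreal_powr_mult ennreal_powr_powr ennreal_powr_ennreal mult.commute less_imp_le)
      also have "ennreal (C1 powr (1 / q)) * (ennreal (2 powr (1 / q)) * (ennreal_powr ?nf (1 / q) + ennreal (b powr (1 / q)) * V)) = ennreal C2 * (X 0 + ennreal (b powr (1 / q)) * V)"
        by (simp add: C2_def ennreal_mult mult.assoc X0)
      finally have "local_norm w q e (gstar lam \<gamma> f) r y \<le> ennreal (b powr e) * (ennreal C2 * (X 0 + ennreal (b powr (1 / q)) * V))"
        unfolding local_norm_def b_def by (rule mult_left_mono) simp
      also have "\<dots> = ennreal C2 * (ennreal (b powr e) * X 0 + ennreal (b powr (e + 1 / q)) * V)"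
      proof -
        have "ennreal (b powr (e + 1 / q)) = ennreal (b powr e) * ennreal (b powr (1 / q))" by (simp add: powr_add ennreal_mult)
        then show ?thesis by (simp add: distrib_left mult_ac)
      qed
      also have "\<dots> \<le> ennreal C2 * (ennreal (D powr (- e)) * ?\<Sigma> + ennreal c2 * ?\<Sigma>)"
      proof (intro mult_left_mono add_mono)
        have "bi 0 \<le> D * b"
          using ball_doubling[OF r, of "8 * ?n" y] n1 by (simp add: bi_def b_def D_def)
        then have "bi 0 / D \<le> b" using D by (simp add: divide_le_eq mult.commute)
        then have "b powr e \<le> (bi 0 / D) powr e" using e bi[of 0] D by (intro powr_mono2') auto
        also have "\<dots> = D powr (- e) * bi 0 powr e" using D by (simp add: powr_divide powr_minus_divide)
        finally have "ennreal (b powr e) * X 0 \<le> ennreal (D powr (- e) * bi 0 powr e) * X 0"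
          by (intro mult_right_mono ennreal_leI) auto
        also have "\<dots> = ennreal (D powr (- e)) * u 0" by (simp add: u ennreal_mult mult.assoc)
        also have "\<dots> \<le> ennreal (D powr (- e)) * ?\<Sigma>" by (intro mult_left_mono u0) auto
        finally show "ennreal (b powr e) * X 0 \<le> ennreal (D powr (- e)) * ?\<Sigma>" .
      next
        have "ennreal (b powr (e + 1 / q)) * v i \<le> ennreal c2 * (ennreal (t ^ i) * u i)" for i
        proof -
          have "b \<le> \<eta> ^ i * wmeas w (ball y (2 ^ i * r))" unfolding b_def by (rule ball_reverse_doubling_iterated[OF r])
          also have "\<dots> \<le> \<eta> ^ i * bi i"
          proof -
            have "1 * (2 ^ i * r) \<le> 8 * ?n * (2 ^ i * r)"
            proof (rule mult_right_mono)
              show "1 \<le> 8 * ?n" using n1 by linarith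
              show "0 \<le> 2 ^ i * r" using r by simp
            qed
            then show ?thesis unfolding bi_def using r eta by (intro mult_left_mono wmeas_ball_mono) auto
          qed
          finally have "b powr (e + 1 / q) \<le> (\<eta> ^ i * bi i) powr (e + 1 / q)"
            using b e by (intro powr_mono2) auto
          also have "\<dots> = t ^ i * bi i powr (e + 1 / q)"
          proof -
            have "(\<eta> ^ i) powr (e + 1 / q) = t ^ i"
              using eta by (simp add: t_def powr_powr mult.commute flip: powr_realpow)
            then show ?thesis by (simp add: powr_mult)
          qed
          finally have le: "b powr (e + 1 / q) \<le> t ^ i * bi i powr (e + 1 / q)" .
          have "ennreal (b powr (e + 1 / q)) * v i \<le> ennreal (t ^ i * bi i powr (e + 1 / q)) * (ennreal (c2 * bi i powr (- 1 / q)) * X i)"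
            by (intro mult_mono ennreal_leI le v_le) auto
          also have "\<dots> = ennreal (t ^ i * bi i powr (e + 1 / q) * (c2 * bi i powr (- 1 / q))) * X i"
            using t c2 by (subst ennreal_mult) (auto simp: mult.assoc)
          also have "t ^ i * bi i powr (e + 1 / q) * (c2 * bi i powr (- 1 / q)) = c2 * (t ^ i * bi i powr e)"
            using bi[of i] by (simp add: powr_add powr_minus_divide)
          also have "ennreal (c2 * (t ^ i * bi i powr e)) * X i = ennreal c2 * (ennreal (t ^ i) * u i)"
            using c2 t by (simp add: u ennreal_mult mult.assoc)
          finally show ?thesis .
        qed
        then have "(\<Sum>i. ennreal (b powr (e + 1 / q)) * v i) \<le> (\<Sum>i. ennreal c2 * (ennreal (t ^ i) * u i))"
          by (intro suminf_le) auto
        then show "ennreal (b powr (e + 1 / q)) * V \<le> ennreal c2 * ?\<Sigma>" by (simp add: V_def)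
      qed auto
      also have "\<dots> = ennreal C * ?\<Sigma>"
        using C2 c2 by (simp add: C_def ennreal_mult distrib_right mult.assoc flip: distrib_left)
      finally show ?thesis unfolding u_def .
    qed
  qed
  show ?thesis unfolding t_def[symmetric] by (intro exI[of _ C] conjI allI impI C main2)
qed

end

lemma suminf_geometric_ennreal:
  assumes "0 < t" "t < 1" shows "(\<Sum>i. ennreal (t ^ i)) = ennreal (1 / (1 - t))"
  using assms by (subst suminf_ennreal2) (auto simp: suminf_geometric summable_geometric)

text \<open>Instead of Minkowski's inequality: a geometrically damped series is dominated by a supremum,
  and the \<open>p\<close>-th power of a supremum by the series of the \<open>p\<close>-th powers.\<close>

lemma Lp_norm_geometric:
  assumes p: "0 < p" and t: "0 < t" "t < 1" and C: "0 < C"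
  shows "\<exists>C'>0. \<forall>(F :: real ^ 'n \<Rightarrow> ennreal) u M. F \<in> borel_measurable lebesgue \<longrightarrow> (\<forall>i. u i \<in> borel_measurable lebesgue) \<longrightarrow>
    (\<forall>y. F y \<le> ennreal C * (\<Sum>i. ennreal (t ^ i) * u i y)) \<longrightarrow> (\<forall>i. Lp_norm p (u i) \<le> M) \<longrightarrow> Lp_norm p F \<le> ennreal C' * M"
proof (cases "p = \<infinity>")
  case True
  define C' where "C' = C / (1 - t)"
  have "Lp_norm p F \<le> ennreal C' * M"
    if F: "F \<in> borel_measurable lebesgue" "\<And>i. u i \<in> borel_measurable lebesgue"
      "\<And>y. F y \<le> ennreal C * (\<Sum>i. ennreal (t ^ i) * u i y)" "\<And>i. Lp_norm p (u i) \<le> M"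
    for F :: "real ^ 'n \<Rightarrow> ennreal" and u M
  proof -
    have "AE y in lebesgue. u i y \<le> M" for i
    proof -
      have "esssup lebesgue (u i) \<le> M" using F(4)[of i] True by (simp add: Lp_norm_def)
      moreover have "AE y in lebesgue. u i y \<le> esssup lebesgue (u i)" by (rule esssup_AE)
      ultimately show ?thesis by (auto elim!: eventually_mono)
    qed
    then have "AE y in lebesgue. \<forall>i. u i y \<le> M" by (simp add: AE_all_countable)
    then have "AE y in lebesgue. F y \<le> ennreal C' * M"
    proof (rule eventually_mono)
      fix y assume u: "\<forall>i. u i y \<le> M"
      have "F y \<le> ennreal C * (\<Sum>i. ennreal (t ^ i) * u i y)" by (rule F(3))
      also have "\<dots> \<le> ennreal C * (\<Sum>i. ennreal (t ^ i) * M)"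
        using u by (intro mult_left_mono suminf_le) auto
      also have "\<dots> = ennreal C * (ennreal (1 / (1 - t)) * M)" using suminf_geometric_ennreal[OF t] by simp
      also have "\<dots> = ennreal C' * M" using C t by (simp add: C'_def mult.assoc[symmetric] flip: ennreal_mult)
      finally show "F y \<le> ennreal C' * M" .
    qed
    then have "esssup lebesgue F \<le> ennreal C' * M" by (rule esssup_I[OF F(1)])
    then show ?thesis using True by (simp add: Lp_norm_def)
  qed
  moreover have "0 < C'" using C t by (simp add: C'_def)
  ultimately show ?thesis by blast
next
  case False
  define P where "P = enn2real p"
  have P: "0 < P" using p False by (simp add: P_def enn2real_positive_iff less_top)
  \<comment> \<open>One half of the decay sums the series against the supremum, the other half sums the \<open>p\<close>-th powers.\<close>
  define s where "s = sqrt t"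
  have s: "0 < s" "s < 1" "s * s = t" using t by (auto simp: s_def)
  define G where "G = C * (1 / (1 - s))"
  have G: "0 < G" using C s by (simp add: G_def)
  have sP: "0 < s powr P" "s powr P < 1" using s P powr_less_mono2[of P s 1] by auto
  define C' where "C' = G * (1 / (1 - s powr P)) powr (1 / P)"
  have "Lp_norm p F \<le> ennreal C' * M"
    if F: "\<And>i. u i \<in> borel_measurable lebesgue"
      "\<And>y. F y \<le> ennreal C * (\<Sum>i. ennreal (t ^ i) * u i y)" "\<And>i. Lp_norm p (u i) \<le> M"
    for F :: "real ^ 'n \<Rightarrow> ennreal" and u M
  proof -
    have [measurable]: "u i \<in> borel_measurable lebesgue" for i by (rule F(1))
    have int: "(\<integral>\<^sup>+y. ennreal_powr (u i y) P \<partial>lebesgue) \<le> ennreal_powr M P" for i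
      using F(3)[of i] False P ennreal_powr_le_iff[of "1 / P" "\<integral>\<^sup>+y. ennreal_powr (u i y) P \<partial>lebesgue" M]
      by (simp add: Lp_norm_def P_def)
    have point: "ennreal_powr (F y) P \<le> ennreal (G powr P) * (\<Sum>i. ennreal ((s powr P) ^ i) * ennreal_powr (u i y) P)" for y
    proof -
      define S where "S = (SUP i. ennreal (s ^ i) * u i y)"
      have "F y \<le> ennreal C * (\<Sum>i. ennreal (t ^ i) * u i y)" by (rule F(2))
      also have "\<dots> \<le> ennreal C * (\<Sum>i. ennreal (s ^ i) * S)"
      proof (intro mult_left_mono suminf_le)
        fix i
        have "ennreal (t ^ i) * u i y = ennreal (s ^ i) * (ennreal (s ^ i) * u i y)"
          using s by (simp add: s(3)[symmetric] power_mult_distrib ennreal_mult mult.assoc)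
        also have "\<dots> \<le> ennreal (s ^ i) * S" unfolding S_def by (intro mult_left_mono SUP_upper) auto
        finally show "ennreal (t ^ i) * u i y \<le> ennreal (s ^ i) * S" .
      qed auto
      also have "\<dots> = ennreal C * (ennreal (1 / (1 - s)) * S)" using suminf_geometric_ennreal[OF s(1,2)] by simp
      also have "\<dots> = ennreal G * S" using C s by (simp add: G_def mult.assoc[symmetric] flip: ennreal_mult)
      finally have "ennreal_powr (F y) P \<le> ennreal_powr (ennreal G * S) P" using P by (intro ennreal_powr_mono) auto
      also have "\<dots> = ennreal (G powr P) * ennreal_powr S P" using G P by (rule ennreal_powr_cmult)
      also have "ennreal_powr S P = (SUP i. ennreal_powr (ennreal (s ^ i) * u i y) P)" unfolding S_def by (rule ennreal_powr_SUP[OF P])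
      also have "\<dots> \<le> (\<Sum>i. ennreal ((s powr P) ^ i) * ennreal_powr (u i y) P)"
      proof (rule SUP_least)
        fix i
        have "ennreal_powr (ennreal (s ^ i) * u i y) P = ennreal ((s ^ i) powr P) * ennreal_powr (u i y) P"
          using s P by (intro ennreal_powr_cmult) auto
        also have "(s ^ i) powr P = (s powr P) ^ i" using s by (simp add: powr_powr mult.commute flip: powr_realpow)
        also have "ennreal ((s powr P) ^ i) * ennreal_powr (u i y) P \<le> (\<Sum>i. ennreal ((s powr P) ^ i) * ennreal_powr (u i y) P)"
          using sum_le_suminf[of "\<lambda>i. ennreal ((s powr P) ^ i) * ennreal_powr (u i y) P" "{i}"] by auto
        finally show "ennreal_powr (ennreal (s ^ i) * u i y) P \<le> (\<Sum>i. ennreal ((s powr P) ^ i) * ennreal_powr (u i y) P)" .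
      qed
      finally show ?thesis by (simp add: mult_left_mono)
    qed
    have "(\<integral>\<^sup>+y. ennreal_powr (F y) P \<partial>lebesgue) \<le> (\<integral>\<^sup>+y. ennreal (G powr P) * (\<Sum>i. ennreal ((s powr P) ^ i) * ennreal_powr (u i y) P) \<partial>lebesgue)"
      by (intro nn_integral_mono point)
    also have "\<dots> = ennreal (G powr P) * (\<Sum>i. ennreal ((s powr P) ^ i) * (\<integral>\<^sup>+y. ennreal_powr (u i y) P \<partial>lebesgue))"
      by (simp add: nn_integral_cmult nn_integral_suminf)
    also have "\<dots> \<le> ennreal (G powr P) * (\<Sum>i. ennreal ((s powr P) ^ i) * ennreal_powr M P)"
      by (intro mult_left_mono suminf_le int) auto
    also have "\<dots> = ennreal (G powr P) * (ennreal (1 / (1 - s powr P)) * ennreal_powr M P)"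
      using suminf_geometric_ennreal[OF sP] by simp
    also have "\<dots> = ennreal (G powr P * (1 / (1 - s powr P))) * ennreal_powr M P"
      using sP by (subst ennreal_mult) (auto simp: mult.assoc)
    finally have "ennreal_powr (\<integral>\<^sup>+y. ennreal_powr (F y) P \<partial>lebesgue) (1 / P) \<le> ennreal_powr (ennreal (G powr P * (1 / (1 - s powr P))) * ennreal_powr M P) (1 / P)"
      using P by (intro ennreal_powr_mono) auto
    also have "\<dots> = ennreal ((G powr P * (1 / (1 - s powr P))) powr (1 / P)) * ennreal_powr (ennreal_powr M P) (1 / P)"
      using P G sP by (intro ennreal_powr_cmult mult_pos_pos) auto
    also have "(G powr P * (1 / (1 - s powr P))) powr (1 / P) = C'"
      unfolding C'_def powr_mult using P G by (simp add: powr_powr)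
    also have "ennreal_powr (ennreal_powr M P) (1 / P) = M" using P by (simp add: ennreal_powr_powr)
    finally show ?thesis using False by (simp add: Lp_norm_def P_def)
  qed
  moreover have "0 < C'" unfolding C'_def using G sP by (intro mult_pos_pos) auto
  ultimately show ?thesis by blast
qed

lemma Muckenhoupt_dual_weights:
  fixes w :: "real ^ 'n \<Rightarrow> real"
  assumes "Muckenhoupt q w" "1 < q"
  obtains A where "dual_weights w (\<lambda>x. w x powr (- 1 / (q - 1))) q A"
proof -
  let ?\<sigma> = "\<lambda>x. w x powr (- 1 / (q - 1))"
  obtain A where A: "0 < A" and Aq: "\<And>y r. 0 < r \<Longrightarrow>
        ((\<integral>\<^sup>+x\<in>ball y r. ennreal (w x) \<partial>lebesgue) / emeasure lebesgue (ball y r)) *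
        ennreal_powr ((\<integral>\<^sup>+x\<in>ball y r. ennreal (?\<sigma> x) \<partial>lebesgue) / emeasure lebesgue (ball y r)) (q - 1) \<le> ennreal A"
    and w: "weight w"
    using assms(1) unfolding Muckenhoupt_def by blast
  have [measurable]: "w \<in> borel_measurable lebesgue" and pos: "\<And>x. 0 < w x" using w by (auto simp: weight_def)
  have "dual_weights w ?\<sigma> q A"
  proof
    fix y :: "real ^ 'n" and r :: real assume r: "0 < r"
    let ?B = "ball y r"
    have [measurable]: "?B \<in> sets lebesgue" by auto
    define v where "v = unit_ball_vol (real CARD('n)) * r ^ CARD('n)"
    have v: "0 < v" unfolding v_def using r by (intro mult_pos_pos unit_ball_vol_pos) auto
    have L: "emeasure lebesgue ?B = ennreal v" using r by (simp add: emeasure_ball v_def emeasure_completion)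
    have W: "emeasure (weighted g) ?B = (\<integral>\<^sup>+x\<in>?B. ennreal (g x) \<partial>lebesgue)" if "g \<in> borel_measurable lebesgue" for g
      using that by (intro emeasure_density) auto
    let ?W = "emeasure (weighted w) ?B" and ?S = "emeasure (weighted ?\<sigma>) ?B"
    have div: "x / ennreal v * ennreal v = x" for x
    proof -
      have "x / ennreal v * ennreal v = x * (ennreal v / ennreal v)" by (rule ennreal_divide_times)
      also have "ennreal v / ennreal v = 1" using v by (intro ennreal_divide_self) auto
      finally show ?thesis by simp
    qed
    have vq: "ennreal v * ennreal_powr (ennreal v) (q - 1) = ennreal_powr (ennreal v) q"
      using v by (simp add: ennreal_powr_ennreal powr_diff flip: ennreal_mult)
    have "?W * ennreal_powr ?S (q - 1) = (?W / ennreal v * ennreal v) * ennreal_powr (?S / ennreal v * ennreal v) (q - 1)"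
      unfolding div ..
    also have "\<dots> = (?W / ennreal v * ennreal_powr (?S / ennreal v) (q - 1)) * (ennreal v * ennreal_powr (ennreal v) (q - 1))"
      by (subst ennreal_powr_mult) (use assms(2) in simp, simp only: ac_simps)
    also have "\<dots> \<le> ennreal A * (ennreal v * ennreal_powr (ennreal v) (q - 1))"
      using Aq[OF r, of y] unfolding L by (intro mult_right_mono) (simp_all add: W)
    finally show "?W * ennreal_powr ?S (q - 1) \<le> ennreal A * ennreal_powr (emeasure lebesgue ?B) q"
      unfolding vq L .
  qed (use A assms pos in auto)
  then show ?thesis by (rule that)
qed

section \<open>Boundedness of the intrinsic square function on mixed norm spaces\<close>

theorem theorem3p2:
  fixes w :: "real ^ 'n \<Rightarrow> real" and \<gamma> q \<alpha> lam :: real and p :: ennreal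
  assumes "0 < \<gamma>" "\<gamma> \<le> 1"
    and "1 < q" "q \<le> \<alpha>" "ennreal \<alpha> < p" "p \<le> \<infinity>"
    and "Muckenhoupt q w"
    and "lam > max q 3"
  shows "\<exists>C::real. C > 0 \<and>
    (\<forall>f \<in> mixed_space w q p \<alpha>.
       mixed_norm w q p \<alpha> (gstar lam \<gamma> f)
         \<le> ennreal C * mixed_norm w q p \<alpha> (\<lambda>x. ennreal (norm (f x))))"
proof -
  obtain A where "dual_weights w (\<lambda>x. w x powr (- 1 / (q - 1))) q A"
    using Muckenhoupt_dual_weights[OF assms(7,3)] by blast
  then interpret dual_weights w "\<lambda>x. w x powr (- 1 / (q - 1))" q A .
  define e where "e = 1 / \<alpha> - 1 / q - enn2real (1 / p)"
  have \<alpha>: "0 < \<alpha>" using assms by simp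
  \<comment> \<open>\<open>\<alpha> < p\<close> is what makes \<open>e + 1 / q = 1 / \<alpha> - 1 / p\<close> positive.\<close>
  have p1: "enn2real (1 / p) < 1 / \<alpha>"
  proof (cases p)
    case (real P)
    then have "\<alpha> < P" using assms(5) \<alpha> by (simp add: ennreal_less_iff)
    moreover have "1 / p = ennreal (1 / P)" using real \<open>\<alpha> < P\<close> \<alpha> by (simp add: divide_ennreal flip: ennreal_1)
    ultimately show ?thesis using \<alpha> by (simp add: frac_less2)
  next
    case top
    then show ?thesis using \<alpha> by simp
  qed
  have "1 / \<alpha> \<le> 1 / q" using assms by (intro divide_left_mono) auto
  moreover have "0 \<le> enn2real (1 / p)" by simp
  ultimately have e: "e \<le> 0" "0 < e + 1 / q" using p1 unfolding e_def by linarith+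
  let ?t = "\<eta> powr (e + 1 / q)"
  have t: "0 < ?t" "?t < 1" using eta e powr_less_mono2[of "e + 1 / q" \<eta> 1] by auto
  obtain C1 where C1: "0 < C1" and bound: "\<And>(f :: real ^ 'n \<Rightarrow> complex) r y. f \<in> borel_measurable lebesgue \<Longrightarrow> 0 < r \<Longrightarrow>
    local_norm w q e (gstar lam \<gamma> f) r y \<le>
    ennreal C1 * (\<Sum>i. ennreal (?t ^ i) * local_norm w q e (\<lambda>x. ennreal (norm (f x))) (8 * real CARD('n) * (2 ^ i * r)) y)"
    using local_norm_gstar[OF assms(1,2) _ e, of lam] assms(8) by auto
  have p0: "0 < p" using assms(5) by (rule le_less_trans[rotated]) simp
  obtain C where C: "0 < C" and Lp: "\<And>(F :: real ^ 'n \<Rightarrow> ennreal) u M. F \<in> borel_measurable lebesgue \<Longrightarrow> (\<forall>i. u i \<in> borel_measurable lebesgue) \<Longrightarrow>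
    (\<forall>y. F y \<le> ennreal C1 * (\<Sum>i. ennreal (?t ^ i) * u i y)) \<Longrightarrow> (\<forall>i. Lp_norm p (u i) \<le> M) \<Longrightarrow> Lp_norm p F \<le> ennreal C * M"
    using Lp_norm_geometric[OF p0 t C1] by blast
  have mixed: "mixed_norm w q p \<alpha> u = (SUP r\<in>{0<..}. Lp_norm p (local_norm w q e u r))" for u
    unfolding mixed_norm_def local_norm_def e_def ..
  show ?thesis
  proof (intro exI[of _ C] conjI ballI C)
    fix f assume "f \<in> mixed_space w q p \<alpha>"
    then have f: "f \<in> borel_measurable lebesgue" by (simp add: mixed_space_def)
    let ?N = "mixed_norm w q p \<alpha> (\<lambda>x. ennreal (norm (f x)))"
    show "mixed_norm w q p \<alpha> (gstar lam \<gamma> f) \<le> ennreal C * ?N"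
      unfolding mixed[of "gstar lam \<gamma> f"]
    proof (rule SUP_least)
      fix r :: real assume "r \<in> {0<..}"
      then have r: "0 < r" by simp
      have R: "0 < 8 * real CARD('n) * (2 ^ i * r)" for i using r by simp
      show "Lp_norm p (local_norm w q e (gstar lam \<gamma> f) r) \<le> ennreal C * ?N"
      proof (rule Lp)
        show "local_norm w q e (gstar lam \<gamma> f) r \<in> borel_measurable lebesgue" by (rule measurable_local_norm[OF r])
        show "\<forall>i. local_norm w q e (\<lambda>x. ennreal (norm (f x))) (8 * real CARD('n) * (2 ^ i * r)) \<in> borel_measurable lebesgue"
          using measurable_local_norm[OF R] by blast
        show "\<forall>y. local_norm w q e (gstar lam \<gamma> f) r y \<le> ennreal C1 * (\<Sum>i. ennreal (?t ^ i) * local_norm w q e (\<lambda>x. ennreal (norm (f x))) (8 * real CARD('n) * (2 ^ i * r)) y)"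
          using bound[OF f r] by blast
        show "\<forall>i. Lp_norm p (local_norm w q e (\<lambda>x. ennreal (norm (f x))) (8 * real CARD('n) * (2 ^ i * r))) \<le> ?N"
          unfolding mixed using R by (auto intro!: SUP_upper)
      qed
    qed
  qed
qed

end
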